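(* Suppose $d=1+\Pi^n\sum_{j\in\mathbb Z/p^s\mathbb Z}b_ju^j$ (all $b_j\in B$) has level $n\ge1$, with $\mathrm{nr}(d)=1$. Let $w$ be the weight of $n$. Then: (i) If $n$ is ordinary, then $\lambda_n(b_{p^wv})\equiv0\bmod\pi A$ for $0\le v<p^{s-w}$. (ii) If $n$ is transitional, then, for $0\le v<p^{s-(w+1)}$, $$\lambda_n^+(b_{p^{w+1}v})\equiv\sum_{z=0}^{p-1}\lambda_n(b_{p^wv+p^{s-1}z})^p(1+T)^z\pmod{\pi A}.$$ In particular, $\lambda^+_n(b_{p^{w+1}v})$ and $\{\lambda_n(b_{p^wv+p^{s-1}z}):0\le z<p\}$ determine each other $\bmod\ \pi A$.
   Context: Let $p$ be an odd prime, $r\ge1$, $s\ge1$ integers, $F/\mathbb Q_p$ a finite unramified extension with ring of integers $\mathfrak O$. Fix primitive $p^m$-th roots of unity $\zeta_m$ with $\zeta_0=1$, $\zeta_m^p=\zeta_{m-1}$; put $\mathfrak O_m=\mathfrak O[\zeta_m]$, $\pi_m=1-\zeta_m$, $\Pi=\pi_{r+s}$, $\pi=\pi_r$, $A=\mathfrak O_r[[T]]$, $B=\mathfrak O_{r+s}[[T]]$, with fraction fields $\mathfrak q(A),\mathfrak q(B)$. Let $g$ be the generator of the cyclic group $\mathrm{Gal}(\mathfrak q(B)/\mathfrak q(A))$ (of order $p^s$) fixing $\mathfrak q(A)$ with $\zeta_{r+s}\mapsto\zeta_{r+s}^{1+p^r}$. $D=\bigoplus_{j=0}^{p^s-1}\mathfrak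 q(B)u^j$ with $ub={}^gb\,u$ and $u^{p^s}=1+T$ is a division algebra with centre $\mathfrak q(A)$, $\Delta=\bigoplus_{j=0}^{p^s-1}Bu^j$ is an $A$-order in $D$, and $\mathrm{nr}:D\to\mathfrak q(A)$ is the reduced norm. For $j\in\mathbb Z/p^s\mathbb Z$, $u^j$ means $u^{\hat j}$ with $\hat j$ the representative of $j$ satisfying $0\le\hat j<p^s$, and for an integer $k$, $b_k$ is the coefficient indexed by the class of $k$. The level of $d\in1+\Pi\Delta$ is $\max\{k\ge1:d\in1+\Pi^k\Delta\}$. The weight $w$ of $n\ge1$ is the smallest $w\ge0$ with $n<p^{r+w}+p^w$; $n$ of weight $w$ is ordinary if $n<p^{r+w}-p^w$, and transitional if $p^{r+w}-p^w\le n<p^{r+w}+p^w$. Each $b\in B$ is uniquely $b=\sum_{i=0}^{p^s-1}a_i\Pi^i$ with $a_i\in A$. For $n\ge1$ and $0\le k\le s$ put $\lambda_n^{(k)}(b)=\sum_{i=0}^{n^*-n}a_i$, where $n^*\ge n$ is minimal with $n^*\equiv-1\bmod p^k$. For $n$ of weight $w$, $\lambda_n(b)=\lambda_n^{(w)}(b)$; and, when $n$ is transitional of weight $w\le s-1$, $\lambda^+_n(b)=\lambda_n^{(w+1)}(b)$, that is, $\lambda_n^+(b)=\sum_{i=0}^{n^+-n}a_i$, where $n^+\ge n$ is minimal with $n^+\equiv-1\bmod p^{w+1}$. *)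

theory Defs
  imports
    "HOL-Computational_Algebra.Formal_Laurent_Series"
    "HOL-Computational_Algebra.Primes"
    "HOL-Number_Theory.Cong"
    "Jordan_Normal_Form.Determinant"
begin

text \<open>
  All fields are subsets of an ambient field: \<open>F\<close> and the roots of unity live in a
  type \<open>'a\<close> of characteristic 0, and the rings of power series over \<open>\<OO>\<^sub>m\<close>, together
  with their fraction fields, live in the field of Laurent series over \<open>'a\<close>.
\<close>

definition is_subfield :: "'a::field set \<Rightarrow> bool" where
  "is_subfield K \<longleftrightarrow>
     0 \<in> K \<and> 1 \<in> K \<and> (\<forall>x\<in>K. \<forall>y\<in>K. x - y \<in> K \<and> x * y \<in> K) \<and> (\<forall>x\<in>K. inverse x \<in> K)"

definition finite_extension :: "'a::field set \<Rightarrow> 'a set \<Rightarrow> bool" where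
  "finite_extension k K \<longleftrightarrow>
     is_subfield k \<and> is_subfield K \<and> k \<subseteq> K \<and>
     (\<exists>S. finite S \<and> S \<subseteq> K \<and> (\<forall>x\<in>K. \<exists>c. (\<forall>b\<in>S. c b \<in> k) \<and> x = (\<Sum>b\<in>S. c b * b)))"

definition padic_abs :: "nat \<Rightarrow> rat \<Rightarrow> real" where
  "padic_abs p q =
     (if q = 0 then 0
      else case quotient_of q of (a, b) \<Rightarrow>
        real p powi (int (multiplicity (int p) b) - int (multiplicity (int p) a)))"

text \<open>\<open>(Q, av)\<close> is the completion of the rational numbers for the \<open>p\<close>-adic absolute value.\<close>

definition is_padic_field :: "nat \<Rightarrow> 'a::field_char_0 set \<Rightarrow> ('a \<Rightarrow> real) \<Rightarrow> bool" where
  "is_padic_field p Q av \<longleftrightarrow>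
     is_subfield Q \<and>
     (\<forall>x\<in>Q. 0 \<le> av x \<and> (av x = 0 \<longleftrightarrow> x = 0)) \<and>
     (\<forall>x\<in>Q. \<forall>y\<in>Q. av (x * y) = av x * av y \<and> av (x + y) \<le> av x + av y) \<and>
     (\<forall>q. av (of_rat q) = padic_abs p q) \<and>
     (\<forall>x\<in>Q. \<forall>e>0. \<exists>q. av (x - of_rat q) < e) \<and>
     (\<forall>X :: nat \<Rightarrow> 'a.
        (\<forall>i. X i \<in> Q) \<and> (\<forall>e>0. \<exists>M. \<forall>i\<ge>M. \<forall>j\<ge>M. av (X i - X j) < e) \<longrightarrow>
        (\<exists>L\<in>Q. (\<lambda>i. av (X i - L)) \<longlonglongrightarrow> 0))"

definition integral_closure :: "'a::field set \<Rightarrow> 'a set \<Rightarrow> 'a set" where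
  "integral_closure R K =
     {x \<in> K. \<exists>f. lead_coeff f = 1 \<and> (\<forall>i. coeff f i \<in> R) \<and> poly f x = 0}"

definition ring_of_integers :: "'a::field set \<Rightarrow> ('a \<Rightarrow> real) \<Rightarrow> 'a set \<Rightarrow> 'a set" where
  "ring_of_integers Q av F = integral_closure {x \<in> Q. av x \<le> 1} F"

text \<open>
  The ring of integers of \<open>F\<close> is local, so its maximal ideal is the set of its non-units.
  Unramified means that \<open>p\<close> generates it; separability of the residue field extension is
  automatic, the residue field of \<open>Q\<close> being finite.
\<close>

definition finite_unramified_extension ::
    "nat \<Rightarrow> 'a::field_char_0 set \<Rightarrow> ('a \<Rightarrow> real) \<Rightarrow> 'a set \<Rightarrow> bool" where
  "finite_unramified_extension p Q av F \<longleftrightarrow>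
     finite_extension Q F \<and>
     (let R = ring_of_integers Q av F
      in {x \<in> R. \<not> (\<exists>y\<in>R. x * y = 1)} = (\<lambda>x. of_nat p * x) ` R)"

definition primitive_root_of_unity :: "nat \<Rightarrow> 'a::field \<Rightarrow> bool" where
  "primitive_root_of_unity m z \<longleftrightarrow> z ^ m = 1 \<and> (\<forall>k. 0 < k \<and> k < m \<longrightarrow> z ^ k \<noteq> 1)"

definition adjoin :: "'a::field set \<Rightarrow> 'a \<Rightarrow> 'a set" where
  "adjoin R z = {poly f z | f. \<forall>i. coeff f i \<in> R}"

definition power_series :: "'a::field set \<Rightarrow> 'a fls set" where
  "power_series R = {fps_to_fls f | f. \<forall>i. fps_nth f i \<in> R}"

definition fraction_field :: "'a::field set \<Rightarrow> 'a set" where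
  "fraction_field R = {x / y | x y. x \<in> R \<and> y \<in> R \<and> y \<noteq> 0}"

text \<open>Automorphisms of \<open>K\<close> over \<open>k\<close>; only their values on \<open>K\<close> are meaningful.\<close>

definition Gal :: "'a::field set \<Rightarrow> 'a set \<Rightarrow> ('a \<Rightarrow> 'a) set" where
  "Gal K k =
     {\<sigma>. bij_betw \<sigma> K K \<and>
         (\<forall>x\<in>K. \<forall>y\<in>K. \<sigma> (x + y) = \<sigma> x + \<sigma> y \<and> \<sigma> (x * y) = \<sigma> x * \<sigma> y) \<and>
         (\<forall>x\<in>k. \<sigma> x = x)}"

text \<open>
  The type \<open>'d\<close> is the ring \<open>D = \<Oplus>\<^sub>j K u\<^sup>j\<close> (\<open>0 \<le> j < N\<close>) with \<open>u b = g(b) u\<close> and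
  \<open>u\<^sup>N = c\<close>, where \<open>\<iota>\<close> is the inclusion of \<open>K\<close> in \<open>D\<close>.
\<close>

definition is_cyclic_algebra ::
    "'k::field set \<Rightarrow> ('k \<Rightarrow> 'k) \<Rightarrow> nat \<Rightarrow> 'k \<Rightarrow> ('k \<Rightarrow> 'd::ring_1) \<Rightarrow> 'd \<Rightarrow> bool" where
  "is_cyclic_algebra K g N c \<iota> u \<longleftrightarrow>
     \<iota> 1 = 1 \<and>
     (\<forall>x\<in>K. \<forall>y\<in>K. \<iota> (x + y) = \<iota> x + \<iota> y \<and> \<iota> (x * y) = \<iota> x * \<iota> y) \<and>
     (\<forall>b\<in>K. u * \<iota> b = \<iota> (g b) * u) \<and>
     u ^ N = \<iota> c \<and>
     (\<forall>x. \<exists>!f. (\<forall>j<N. f j \<in> K) \<and> (\<forall>j\<ge>N. f j = 0) \<and> x = (\<Sum>j<N. \<iota> (f j) * u ^ j))"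

definition cyclic_order :: "'k::field set \<Rightarrow> nat \<Rightarrow> ('k \<Rightarrow> 'd::ring_1) \<Rightarrow> 'd \<Rightarrow> 'd set" where
  "cyclic_order B N \<iota> u = {(\<Sum>j<N. \<iota> (f j) * u ^ j) | f. \<forall>j<N. f j \<in> B}"

text \<open>
  A splitting of an algebra over \<open>k\<close> of dimension \<open>N\<^sup>2\<close> by an extension field \<open>L\<close> of \<open>k\<close>,
  that is, an isomorphism \<open>D \<otimes>\<^sub>k L \<cong> M\<^sub>N(L)\<close> of \<open>L\<close>-algebras, given by its restriction to \<open>D\<close>.
  The last clause is surjectivity; injectivity follows as both sides have dimension \<open>N\<^sup>2\<close>.
\<close>

definition is_splitting ::
    "'k::field set \<Rightarrow> 'k set \<Rightarrow> ('k \<Rightarrow> 'd::ring_1) \<Rightarrow> nat \<Rightarrow> ('d \<Rightarrow> 'k mat) \<Rightarrow> bool" where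
  "is_splitting k L \<iota> N \<phi> \<longleftrightarrow>
     (\<forall>x. \<phi> x \<in> carrier_mat N N \<and> elements_mat (\<phi> x) \<subseteq> L) \<and>
     (\<forall>x y. \<phi> (x + y) = \<phi> x + \<phi> y \<and> \<phi> (x * y) = \<phi> x * \<phi> y) \<and>
     (\<forall>a\<in>k. \<phi> (\<iota> a) = a \<cdot>\<^sub>m 1\<^sub>m N) \<and>
     (\<forall>M \<in> carrier_mat N N. elements_mat M \<subseteq> L \<longrightarrow>
        (\<exists>X c. finite X \<and> (\<forall>x\<in>X. c x \<in> L) \<and>
           (\<forall>i<N. \<forall>j<N. M $$ (i, j) = (\<Sum>x\<in>X. c x * \<phi> x $$ (i, j)))))"

text \<open>By the Skolem-Noether theorem, \<open>nr\<close> does not depend on the splitting.\<close>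

definition is_reduced_norm ::
    "'k::field set \<Rightarrow> 'k set \<Rightarrow> ('k \<Rightarrow> 'd::ring_1) \<Rightarrow> nat \<Rightarrow> ('d \<Rightarrow> 'k) \<Rightarrow> bool" where
  "is_reduced_norm k L \<iota> N nr \<longleftrightarrow> (\<exists>\<phi>. is_splitting k L \<iota> N \<phi> \<and> (\<forall>x. nr x = det (\<phi> x)))"

definition is_level ::
    "('k::field \<Rightarrow> 'd::ring_1) \<Rightarrow> 'd set \<Rightarrow> 'k \<Rightarrow> 'd \<Rightarrow> nat \<Rightarrow> bool" where
  "is_level \<iota> \<Delta> P d n \<longleftrightarrow>
     n \<ge> 1 \<and> d \<in> (\<lambda>x. 1 + \<iota> (P ^ n) * x) ` \<Delta> \<and>
     (\<forall>k\<ge>1. d \<in> (\<lambda>x. 1 + \<iota> (P ^ k) * x) ` \<Delta> \<longrightarrow> k \<le> n)"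

definition weight :: "nat \<Rightarrow> nat \<Rightarrow> nat \<Rightarrow> nat" where
  "weight p r n = (LEAST w. n < p ^ (r + w) + p ^ w)"

definition ordinary :: "nat \<Rightarrow> nat \<Rightarrow> nat \<Rightarrow> bool" where
  "ordinary p r n \<longleftrightarrow> (let w = weight p r n in n < p ^ (r + w) - p ^ w)"

definition transitional :: "nat \<Rightarrow> nat \<Rightarrow> nat \<Rightarrow> bool" where
  "transitional p r n \<longleftrightarrow>
     (let w = weight p r n in p ^ (r + w) - p ^ w \<le> n \<and> n < p ^ (r + w) + p ^ w)"

text \<open>The coefficients \<open>a\<^sub>i\<close> in \<open>b = \<Sum>\<^sub>i a\<^sub>i P\<^sup>i\<close> (\<open>0 \<le> i < N\<close>).\<close>

definition expansion :: "'k::field set \<Rightarrow> 'k \<Rightarrow> nat \<Rightarrow> 'k \<Rightarrow> nat \<Rightarrow> 'k" where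
  "expansion A P N b =
     (THE a. (\<forall>i<N. a i \<in> A) \<and> (\<forall>i\<ge>N. a i = 0) \<and> b = (\<Sum>i<N. a i * P ^ i))"

definition star :: "nat \<Rightarrow> nat \<Rightarrow> nat \<Rightarrow> nat" where
  "star p k n = (LEAST m. n \<le> m \<and> [int m = - 1] (mod int (p ^ k)))"

text \<open>\<open>\<lambda>\<^sub>n\<^sup>(\<^sup>k\<^sup>)(b)\<close>, to be used for \<open>N = p\<^sup>s\<close> and \<open>k \<le> s\<close> only.\<close>

definition lam :: "'k::field set \<Rightarrow> 'k \<Rightarrow> nat \<Rightarrow> nat \<Rightarrow> nat \<Rightarrow> nat \<Rightarrow> 'k \<Rightarrow> 'k" where
  "lam A P N p k n b = (\<Sum>i = 0..star p k n - n. expansion A P N b i)"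

end

theory Submission
  imports "HOL-Number_Theory.Residues" "Jordan_Normal_Form.Char_Poly" Defs
begin

text \<open>
  In the basis of eigenvectors of \<open>\<zeta>\<close>, the reduced norm of \<open>d\<close> is the determinant of an \<open>N \<times> N\<close> matrix
  with cyclic structure (\<open>N = p\<^sup>s\<close>). Expanding it completely in terms of the coefficients \<open>a\<^sub>i\<close> of the
  \<open>b\<^sub>j\<close>, the group \<open>\<int>/N\<close> permutes the terms in the way the Galois group acts on their values. The sum
  over an orbit of length \<open>p\<^sup>k\<close> is therefore a trace from \<open>\<OO>\<^sub>r\<^sub>+\<^sub>k\<close> of a product of \<open>m\<close> norms, each divisible by
  \<open>\<pi>\<^sub>r\<^sub>+\<^sub>k\<^sup>n\<close>, so it lies in \<open>p\<^sup>k \<pi>\<^sup>q A\<close> with \<open>q = \<lfloor>m n / p\<^sup>k\<rfloor>\<close>. The terms with \<open>m = 1\<close> add up to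
  \<open>p\<^sup>k \<pi>\<^sup>q \<Sum>\<^sub>v \<lambda>(b\<^sub>j)\<^sup>M (1 + T)\<^sup>v\<close> modulo \<open>p\<^sup>k \<pi>\<^sup>q\<^sup>+\<^sup>1\<close>, where \<open>M = p\<^sup>s\<^sup>-\<^sup>k\<close>, \<open>0 \<le> v < M\<close> and \<open>j = p\<^sup>k v\<close>;
  here \<open>(1 + T)\<^sup>v\<close> arises as the \<open>M\<close>-th power of \<open>u\<^sup>j\<close>. As \<open>p\<close> is \<open>- \<pi>\<^sup>c\<close> to first order with \<open>c = (p - 1) p\<^sup>r\<^sup>-\<^sup>1\<close>, the
  valuation \<open>k c + \<lfloor>n / p\<^sup>k\<rfloor>\<close> is minimal at \<open>k = w\<close> alone if \<open>n\<close> is ordinary, and at \<open>w\<close> and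
  \<open>w + 1\<close> if \<open>n\<close> is transitional. Comparing leading coefficients gives the congruences, since the powers
  \<open>(1 + T)\<^sup>v\<close>, \<open>v < M\<close>, are independent over \<open>M\<close>-th powers modulo \<open>\<pi>\<close>.
\<close>

section \<open>Subrings and congruences\<close>

text \<open>The splitting behind \<open>nr\<close> is arbitrary. All that is used of the image of
  \<zeta> is that its N-th power is a scalar from A: this gives one eigenvector, with some
  eigenvalue \<theta> such that \<theta>^N = \<zeta>^N, and multiplication by u moves it to the
  other eigenvectors. Hence the tower is built on \<theta>, of which only the N-th power is known to
  lie in A. No automorphism acts on \<theta>; its conjugates are the explicit powers
  \<open>\<theta> ^ (G ^ j)\<close>, an element of a layer is a polynomial over A evaluated at them,
  and a trace is a sum of powers of roots of unity. No valuation on A is set up either. Every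
  estimate is an explicit factorization with quotient in A, and the lowest power of \<pi> is
  cancelled in the ambient field. Orbits with m at least 2 drop out because k c + floor(2 n / p^k)
  exceeds the minimum for every k. In the transitional case the two minimal levels carry the signs
  (-1)^w and (-1)^(w+1), which turns the vanishing of their sum into a congruence between them.
  Extracting M-th powers at the end requires that A modulo \<pi> has no nilpotents, which is deduced
  from the unramified base ring being local with maximal ideal generated by p.\<close>

definition is_subring :: "'a::comm_ring_1 set \<Rightarrow> bool" where
  "is_subring S \<longleftrightarrow> 1 \<in> S \<and> (\<forall>x\<in>S. \<forall>y\<in>S. x - y \<in> S \<and> x * y \<in> S)"

lemma
  assumes "is_subring S"
  shows subring_1: "1 \<in> S"
    and subring_diff: "x \<in> S \<Longrightarrow> y \<in> S \<Longrightarrow> x - y \<in> S"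
    and subring_mult: "x \<in> S \<Longrightarrow> y \<in> S \<Longrightarrow> x * y \<in> S"
  using assms by (auto simp: is_subring_def)

lemma subring_0: "is_subring S \<Longrightarrow> 0 \<in> S"
  by (metis subring_1 subring_diff diff_self)

lemma subring_uminus: "is_subring S \<Longrightarrow> x \<in> S \<Longrightarrow> - x \<in> S"
  by (metis subring_0 subring_diff diff_0)

lemma subring_add: "is_subring S \<Longrightarrow> x \<in> S \<Longrightarrow> y \<in> S \<Longrightarrow> x + y \<in> S"
  by (metis subring_uminus subring_diff diff_minus_eq_add)

lemma subring_power: "is_subring S \<Longrightarrow> x \<in> S \<Longrightarrow> x ^ k \<in> S"
  by (induction k) (auto intro: subring_1 subring_mult)

lemma subring_of_nat: "is_subring S \<Longrightarrow> of_nat k \<in> S"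
  by (induction k) (auto intro: subring_1 subring_0 subring_add)

lemma subring_sum: "is_subring S \<Longrightarrow> (\<And>i. i \<in> I \<Longrightarrow> f i \<in> S) \<Longrightarrow> sum f I \<in> S"
  by (induction I rule: infinite_finite_induct) (auto intro: subring_0 subring_add)

lemma subring_prod: "is_subring S \<Longrightarrow> (\<And>i. i \<in> I \<Longrightarrow> f i \<in> S) \<Longrightarrow> prod f I \<in> S"
  by (induction I rule: infinite_finite_induct) (auto intro: subring_1 subring_mult)

lemmas subring_intros =
  subring_0 subring_1 subring_add subring_diff subring_uminus subring_mult subring_power
  subring_of_nat subring_sum subring_prod

text \<open>In the ambient field every nonzero \<open>q\<close> divides everything, so the quotient
  has to be confined to \<open>S\<close> explicitly.\<close>

definition cong_in :: "'a::comm_ring_1 set \<Rightarrow> 'a \<Rightarrow> 'a \<Rightarrow> 'a \<Rightarrow> bool" where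
  "cong_in S q x y \<longleftrightarrow> (\<exists>z\<in>S. x = y + q * z)"

lemma cong_in_iff: "cong_in S q x y \<longleftrightarrow> x - y \<in> (\<lambda>a. q * a) ` S"
  unfolding cong_in_def by (auto simp: image_iff algebra_simps)

lemma cong_in_refl: "is_subring S \<Longrightarrow> cong_in S q x x"
  by (auto simp: cong_in_def intro!: bexI[of _ 0] subring_0)

lemma cong_in_sym: "is_subring S \<Longrightarrow> cong_in S q x y \<Longrightarrow> cong_in S q y x"
  by (auto simp: cong_in_def algebra_simps intro!: bexI[of _ "- _"] subring_uminus)

lemma cong_in_trans: "is_subring S \<Longrightarrow> cong_in S q x y \<Longrightarrow> cong_in S q y z \<Longrightarrow> cong_in S q x z"
  unfolding cong_in_def by (metis add.assoc distrib_left subring_add add.commute)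

lemma cong_in_add:
  assumes "is_subring S" "cong_in S q x y" "cong_in S q x' y'"
  shows "cong_in S q (x + x') (y + y')"
proof -
  obtain z z' where "z \<in> S" "z' \<in> S" "x = y + q * z" "x' = y' + q * z'"
    using assms by (auto simp: cong_in_def)
  then show ?thesis unfolding cong_in_def
    by (intro bexI[of _ "z + z'"]) (auto intro: subring_add assms simp: algebra_simps)
qed

lemma cong_in_uminus: "is_subring S \<Longrightarrow> cong_in S q x y \<Longrightarrow> cong_in S q (- x) (- y)"
  by (auto simp: cong_in_def algebra_simps intro!: bexI[of _ "- _"] subring_uminus)

lemma cong_in_diff:
  "is_subring S \<Longrightarrow> cong_in S q x y \<Longrightarrow> cong_in S q x' y' \<Longrightarrow> cong_in S q (x - x') (y - y')"
  using cong_in_add[of S q x y "- x'" "- y'"] cong_in_uminus by auto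

lemma cong_in_mult:
  assumes S: "is_subring S" and q: "q \<in> S" and xy: "x \<in> S" "y' \<in> S"
    and 1: "cong_in S q x y" and 2: "cong_in S q x' y'"
  shows "cong_in S q (x * x') (y * y')"
proof -
  obtain z z' where z: "z \<in> S" "z' \<in> S" "x = y + q * z" "x' = y' + q * z'"
    using 1 2 by (auto simp: cong_in_def)
  have "x * x' = y * y' + q * (z * y' + x * z')"
    unfolding z(4) by (simp add: z(3) algebra_simps)
  then show ?thesis unfolding cong_in_def
    by (intro bexI[of _ "z * y' + x * z'"]) (auto intro!: subring_intros S z xy)
qed

lemma cong_in_power:
  assumes S: "is_subring S" and q: "q \<in> S" and xy: "x \<in> S" "y \<in> S" and c: "cong_in S q x y"
  shows "cong_in S q (x ^ k) (y ^ k)"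
  by (induction k) (auto intro!: cong_in_mult cong_in_refl subring_power assms)

lemma cong_in_sum:
  assumes S: "is_subring S" and "\<And>i. i \<in> I \<Longrightarrow> cong_in S q (f i) (g i)"
  shows "cong_in S q (sum f I) (sum g I)"
  using assms(2)
  by (induction I rule: infinite_finite_induct) (auto intro!: cong_in_add cong_in_refl S)

lemma cong_in_prod:
  assumes S: "is_subring S" and q: "q \<in> S"
    and "\<And>i. i \<in> I \<Longrightarrow> cong_in S q (f i) (g i)" "\<And>i. i \<in> I \<Longrightarrow> f i \<in> S" "\<And>i. i \<in> I \<Longrightarrow> g i \<in> S"
  shows "cong_in S q (prod f I) (prod g I)"
  using assms(3-5)
  by (induction I rule: infinite_finite_induct)
    (auto intro!: cong_in_mult cong_in_refl subring_prod S q)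

lemma cong_in_mono:
  assumes "is_subring S" "q' = q * c" "c \<in> S" "cong_in S q' x y"
  shows "cong_in S q x y"
  using assms unfolding cong_in_def by (metis mult.assoc subring_mult)

lemma cong_in_scale:
  assumes "is_subring S" "c \<in> S" "cong_in S q x y"
  shows "cong_in S q (c * x) (c * y)"
  using assms unfolding cong_in_def by (metis mult.left_commute distrib_left subring_mult)

section \<open>Powers of sums modulo p\<close>

lemma freshman_prime:
  fixes x y :: "'a::comm_ring_1"
  assumes p: "prime p" and S: "is_subring S" and xy: "x \<in> S" "y \<in> S"
  shows "cong_in S (of_nat p) ((x + y) ^ p) (x ^ p + y ^ p)"
proof -
  have p0: "p > 0" using p prime_gt_0_nat by blast
  have "(x + y) ^ p = (\<Sum>k\<le>p. of_nat (p choose k) * x ^ k * y ^ (p - k))"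
    by (rule binomial_ring)
  also have "{..p} = insert 0 (insert p {0<..<p})" using p0 by auto
  also have "(\<Sum>k\<in>\<dots>. of_nat (p choose k) * x ^ k * y ^ (p - k)) =
     x ^ p + y ^ p + (\<Sum>k\<in>{0<..<p}. of_nat (p choose k) * x ^ k * y ^ (p - k))"
    using p0 by (simp add: algebra_simps)
  also have "(\<Sum>k\<in>{0<..<p}. of_nat (p choose k) * x ^ k * y ^ (p - k)) =
     (\<Sum>k\<in>{0<..<p}. of_nat p * (of_nat ((p choose k) div p) * x ^ k * y ^ (p - k)))"
  proof (intro sum.cong refl)
    fix k assume "k \<in> {0<..<p}"
    then have "p dvd (p choose k)" using p by (intro dvd_choose_prime) auto
    then have "of_nat (p choose k) = (of_nat (p * ((p choose k) div p)) :: 'a)" by simp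
    then show "of_nat (p choose k) * x ^ k * y ^ (p - k) =
        of_nat p * (of_nat ((p choose k) div p) * x ^ k * y ^ (p - k))"
      by (simp add: algebra_simps)
  qed
  finally show ?thesis
    unfolding cong_in_def sum_distrib_left[symmetric]
    by (rule bexI) (intro subring_intros S xy)
qed

lemma freshman:
  fixes x y :: "'a::comm_ring_1"
  assumes p: "prime p" and S: "is_subring S" and xy: "x \<in> S" "y \<in> S"
  shows "cong_in S (of_nat p) ((x + y) ^ (p ^ k)) (x ^ (p ^ k) + y ^ (p ^ k))"
proof (induction k)
  case 0
  then show ?case by (simp add: cong_in_refl S)
next
  case (Suc k)
  have "cong_in S (of_nat p) (((x + y) ^ (p ^ k)) ^ p) ((x ^ (p ^ k) + y ^ (p ^ k)) ^ p)"
    by (intro cong_in_power Suc subring_intros S xy)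
  moreover have "cong_in S (of_nat p) ((x ^ (p ^ k) + y ^ (p ^ k)) ^ p)
      ((x ^ (p ^ k)) ^ p + (y ^ (p ^ k)) ^ p)"
    by (intro freshman_prime p subring_intros S xy)
  ultimately show ?case
    using cong_in_trans[OF S] by (simp add: power_mult[symmetric] mult.commute)
qed

lemma freshman_sum:
  fixes f :: "'b \<Rightarrow> 'a::comm_ring_1"
  assumes p: "prime p" and S: "is_subring S" and f: "\<And>i. i \<in> I \<Longrightarrow> f i \<in> S"
  shows "cong_in S (of_nat p) ((\<Sum>i\<in>I. f i) ^ (p ^ k)) (\<Sum>i\<in>I. f i ^ (p ^ k))"
  using f
proof (induction I rule: infinite_finite_induct)
  case (insert i I)
  have "cong_in S (of_nat p) ((f i + sum f I) ^ (p ^ k)) (f i ^ (p ^ k) + sum f I ^ (p ^ k))"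
    by (intro freshman p S insert subring_intros) (use insert in auto)
  moreover have "cong_in S (of_nat p) (f i ^ (p ^ k) + sum f I ^ (p ^ k))
      (f i ^ (p ^ k) + (\<Sum>i\<in>I. f i ^ (p ^ k)))"
    by (intro cong_in_add cong_in_refl S insert.IH) (use insert in auto)
  ultimately show ?case using insert cong_in_trans[OF S] by simp
qed (use p prime_gt_0_nat in \<open>auto simp: zero_power cong_in_refl S\<close>)

text \<open>One polynomial evaluated at all conjugates of a root of unity stands for an element
  together with its conjugates; the trace lemmas below are stated in this form.\<close>

definition polys_over :: "'a::comm_ring_1 set \<Rightarrow> 'a poly set" where
  "polys_over S = {f. \<forall>i. coeff f i \<in> S}"

lemma subring_polys_over:
  assumes S: "is_subring S" shows "is_subring (polys_over S)"
  unfolding is_subring_def polys_over_def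
  by (auto simp: coeff_mult intro!: subring_intros S)

lemma polys_over_pCons:
  "is_subring S \<Longrightarrow> pCons a f \<in> polys_over S \<longleftrightarrow> a \<in> S \<and> f \<in> polys_over S"
  unfolding polys_over_def by (fastforce simp: coeff_pCons split: nat.splits)

lemma polys_over_monom: "is_subring S \<Longrightarrow> a \<in> S \<Longrightarrow> monom a k \<in> polys_over S"
  by (auto simp: polys_over_def intro: subring_0)

lemma polys_over_smult: "is_subring S \<Longrightarrow> a \<in> S \<Longrightarrow> f \<in> polys_over S \<Longrightarrow> smult a f \<in> polys_over S"
  by (auto simp: polys_over_def intro: subring_mult)

section \<open>Roots of unity\<close>

text \<open>The p-adic valuation of \<open>(1 + p ^ r) ^ (p ^ k) - 1\<close> is exactly r + k. Each
  p-th power adds exactly one: if p divides \<open>e\<close>, all terms of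
  \<open>(1 + e) ^ p\<close> beyond \<open>1 + p * e\<close> are divisible by
  \<open>p * e * p\<close>. Here p has to be odd, as 3^2 = 1 + 8 shows.\<close>

lemma one_plus_power_of_prime:
  fixes p r k :: nat
  assumes p: "prime p" "odd p" and r: "r \<ge> 1"
  shows "\<exists>u. (1 + p ^ r) ^ (p ^ k) = 1 + p ^ (r + k) * u \<and> \<not> p dvd u"
proof (induction k)
  case 0
  then show ?case using p by (intro exI[of _ 1]) (auto dest: prime_gt_1_nat)
next
  case (Suc k)
  then obtain u where u: "(1 + p ^ r) ^ (p ^ k) = 1 + p ^ (r + k) * u" "\<not> p dvd u" by blast
  define e where "e = p ^ (r + k) * u"
  have p3: "p \<ge> 3" using p prime_ge_2_nat[of p] by (cases "p = 2") auto
  have pe: "p dvd e" unfolding e_def using r by (simp add: dvd_power)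
  have "(1 + p ^ r) ^ (p ^ Suc k) = (e + 1) ^ p"
    unfolding power_Suc2 power_mult u(1) e_def by (simp only: add.commute)
  also have "\<dots> = (\<Sum>i\<le>p. (p choose i) * e ^ i)"
    by (subst binomial_ring) simp
  also have "{..p} = insert 0 (insert 1 (insert p {1<..<p}))" using p3 by auto
  also have "(\<Sum>i\<in>\<dots>. (p choose i) * e ^ i) = 1 + p * e + (e ^ p + (\<Sum>i\<in>{1<..<p}. (p choose i) * e ^ i))"
    using p3 by simp
  \<comment> \<open>For 1 < i < p one factor p comes from the binomial coefficient and one from the
    second \<open>e\<close>; for i = p both come from \<open>e * e * e\<close>, which divides
    \<open>e ^ p\<close> as p is at least 3.\<close>
  also have "\<exists>t. e ^ p + (\<Sum>i\<in>{1<..<p}. (p choose i) * e ^ i) = p * e * (p * t)"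
  proof -
    have "p * e * p dvd e ^ p"
    proof -
      have "e ^ p = e ^ (p - 3) * (e * e * e)"
        using p3 by (metis power_add power3_eq_cube le_add_diff_inverse2)
      moreover have "p * e * p dvd e * e * e"
        by (meson dvd_refl mult_dvd_mono pe)
      ultimately show ?thesis by (metis dvd_mult)
    qed
    moreover have "p * e * p dvd (p choose i) * e ^ i" if i: "i \<in> {1<..<p}" for i
    proof -
      have "e ^ i = e * e * e ^ (i - 2)" using i
        by (metis One_nat_def Suc_1 Suc_leI greaterThanLessThan_iff le_add_diff_inverse power2_eq_square power_add)
      moreover have "p dvd (p choose i)" using i p by (intro dvd_choose_prime) auto
      ultimately show ?thesis using pe by (metis dvd_mult2 mult.assoc mult_dvd_mono dvd_refl)
    qed
    ultimately have "p * e * p dvd e ^ p + (\<Sum>i\<in>{1<..<p}. (p choose i) * e ^ i)"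
      by (intro dvd_add dvd_sum)
    then show ?thesis by (auto simp: mult.assoc elim!: dvdE)
  qed
  then obtain t where "e ^ p + (\<Sum>i\<in>{1<..<p}. (p choose i) * e ^ i) = p * e * (p * t)" by blast
  finally have "(1 + p ^ r) ^ (p ^ Suc k) = 1 + p ^ (r + Suc k) * (u * (1 + p * t))"
    by (simp add: e_def algebra_simps)
  moreover have "\<not> p dvd u * (1 + p * t)"
    using u(2) p by (auto simp: prime_dvd_mult_iff dvd_add_left_iff dest: prime_gt_1_nat)
  ultimately show ?case by blast
qed

lemma one_plus_mult_power:
  fixes e m :: nat shows "\<exists>t. (1 + e) ^ m = 1 + m * e + e * e * t"
proof (induction m)
  case (Suc m)
  then obtain t where t: "(1 + e) ^ m = 1 + m * e + e * e * t" by blast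
  have "(1 + e) ^ Suc m = (1 + e) * (1 + m * e + e * e * t)" using t by simp
  also have "\<dots> = 1 + Suc m * e + e * e * (m + t + e * t)" by (simp add: algebra_simps)
  finally show ?case by blast
qed simp

text \<open>Write j = p^k m with m prime to p: then \<open>(1 + p ^ r) ^ j - 1\<close> has valuation
  exactly r + k. Thus \<open>1 + p ^ r\<close> has order \<open>p ^ l\<close> modulo
  \<open>p ^ (r + l)\<close>, the degree of the l-th layer of the tower.\<close>

lemma one_plus_power_cong_1_iff:
  fixes p r l j :: nat
  assumes p: "prime p" "odd p" and r: "r \<ge> 1"
  shows "[(1 + p ^ r) ^ j = 1] (mod p ^ (r + l)) \<longleftrightarrow> p ^ l dvd j"
proof
  assume "p ^ l dvd j"
  then obtain m where m: "j = p ^ l * m" by blast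
  obtain u where u: "(1 + p ^ r) ^ (p ^ l) = 1 + p ^ (r + l) * u"
    using one_plus_power_of_prime[OF p r] by blast
  have "[(1 + p ^ (r + l) * u) ^ m = 1 ^ m] (mod p ^ (r + l))"
    by (intro cong_pow) (simp add: cong_def mod_Suc mod_simps)
  then show "[(1 + p ^ r) ^ j = 1] (mod p ^ (r + l))" by (simp only: m power_mult u power_one)
next
  assume c: "[(1 + p ^ r) ^ j = 1] (mod p ^ (r + l))"
  show "p ^ l dvd j"
  proof (cases "j = 0")
    case False
    define k where "k = multiplicity p j"
    obtain m where m: "j = p ^ k * m" "\<not> p dvd m"
      unfolding k_def using False p
      by (metis multiplicity_decompose' not_prime_unit dvd_refl prime_nat_iff nat_neq_iff)
    obtain u where u: "(1 + p ^ r) ^ (p ^ k) = 1 + p ^ (r + k) * u" "\<not> p dvd u"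
      using one_plus_power_of_prime[OF p r] by blast
    obtain t where t: "(1 + p ^ (r + k) * u) ^ m = 1 + m * (p ^ (r + k) * u) + p ^ (r + k) * u * (p ^ (r + k) * u) * t"
      using one_plus_mult_power by blast
    have eq: "(1 + p ^ r) ^ j = 1 + p ^ (r + k) * (u * (m + p ^ (r + k) * u * t))"
      unfolding m power_mult u(1) t by (simp add: algebra_simps)
    have "\<not> p dvd u * (m + p ^ (r + k) * u * t)"
    proof -
      have "p dvd p ^ (r + k) * u * t" using r by (simp add: dvd_power)
      then show ?thesis using u m p by (simp add: prime_dvd_mult_iff dvd_add_left_iff)
    qed
    moreover have "p ^ (r + l) dvd p ^ (r + k) * (u * (m + p ^ (r + k) * u * t))"
      using c unfolding eq by (metis cong_altdef_nat' cong_to_1_nat diff_add_inverse)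
    moreover have "p ^ (r + k) * p dvd p ^ (r + l)" if "k < l"
    proof -
      have "p ^ (r + k) * p = p ^ (r + k + 1)" by simp
      also have "\<dots> dvd p ^ (r + l)" using that by (intro le_imp_power_dvd) simp
      finally show ?thesis .
    qed
    moreover have "p ^ (r + k) \<noteq> 0" using p by (simp add: prime_gt_0_nat)
    ultimately have "l \<le> k"
      by (metis dvd_trans linorder_not_less nat_mult_dvd_cancel_disj)
    then show ?thesis unfolding m by (simp add: le_imp_power_dvd)
  qed simp
qed

lemma one_plus_power_coprime: "r \<ge> 1 \<Longrightarrow> coprime (1 + p ^ r * m) (p ^ t)" for p r m t :: nat
proof -
  assume r: "r \<ge> 1"
  have "coprime (1 + p ^ r * m) p"
  proof (rule coprimeI)
    fix c assume c: "c dvd 1 + p ^ r * m" "c dvd p"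
    have "c dvd p ^ r * m" using c(2) r by (metis dvd_mult2 dvd_power dvd_trans neq0_conv not_one_le_zero)
    then show "is_unit c" using c(1) by (metis dvd_add_left_iff)
  qed
  then show ?thesis by simp
qed

lemma one_plus_power_cong_iff:
  fixes p r l i j :: nat
  assumes p: "prime p" "odd p" and r: "r \<ge> 1"
  shows "[(1 + p ^ r) ^ i = (1 + p ^ r) ^ j] (mod p ^ (r + l)) \<longleftrightarrow> [i = j] (mod p ^ l)"
proof -
  have *: "[(1 + p ^ r) ^ i = (1 + p ^ r) ^ j] (mod p ^ (r + l)) \<longleftrightarrow> [i = j] (mod p ^ l)"
    if "i \<le> j" for i j
  proof -
    have cop: "coprime ((1 + p ^ r) ^ i) (p ^ (r + l))"
      unfolding coprime_power_left_iff
      using one_plus_power_coprime[OF r, of p 1 "r + l"] by (simp only: mult_1_right simp_thms)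
    have "[(1 + p ^ r) ^ i = (1 + p ^ r) ^ j] (mod p ^ (r + l)) \<longleftrightarrow>
        [(1 + p ^ r) ^ i * 1 = (1 + p ^ r) ^ i * (1 + p ^ r) ^ (j - i)] (mod p ^ (r + l))"
      using that by (simp add: power_add[symmetric])
    also have "\<dots> \<longleftrightarrow> [1 = (1 + p ^ r) ^ (j - i)] (mod p ^ (r + l))"
      by (rule cong_mult_lcancel_nat[OF cop])
    also have "\<dots> \<longleftrightarrow> p ^ l dvd j - i"
      using one_plus_power_cong_1_iff[OF p r] by (metis cong_sym_eq)
    also have "\<dots> \<longleftrightarrow> [i = j] (mod p ^ l)"
      using that by (simp add: cong_altdef_nat' cong_sym_eq[of i j] nat_diff_distrib' )
    finally show ?thesis .
  qed
  show ?thesis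
    using *[of i j] *[of j i] by (metis cong_sym_eq linear)
qed

text \<open>An injective self-map of a finite set is onto. The exponents
  \<open>(1 + p ^ r) ^ (p ^ k * j)\<close>, which describe a group of Galois conjugates, are
  replaced by an arithmetic progression, so that sums and products over conjugates become sums and
  products over all roots of unity of order dividing \<open>p ^ t\<close>.\<close>

lemma one_plus_power_bij:
  fixes p r k t :: nat
  assumes p: "prime p" "odd p" and r: "r \<ge> 1"
  shows "\<exists>\<mu>. bij_betw \<mu> {..<p ^ t} {..<p ^ t} \<and>
    (\<forall>j. [(1 + p ^ r) ^ (p ^ k * j) = 1 + p ^ (r + k) * \<mu> j] (mod p ^ (r + k + t)))"
proof -
  let ?G = "\<lambda>j. (1 + p ^ r) ^ (p ^ k * j)"
  have "\<exists>m<p ^ t. [?G j = 1 + p ^ (r + k) * m] (mod p ^ (r + k + t))" for j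
  proof -
    have "[?G j = 1] (mod p ^ (r + k))" using one_plus_power_cong_1_iff[OF p r] by simp
    then obtain m' where m': "?G j = 1 + p ^ (r + k) * m'"
      by (metis cong_to_1_nat dvdE le_add_diff_inverse one_le_power le_add1)
    have "[m' = m' mod p ^ t] (mod p ^ t)" by (simp add: cong_def)
    then have "[p ^ (r + k) * m' = p ^ (r + k) * (m' mod p ^ t)] (mod p ^ (r + k) * p ^ t)"
      unfolding cong_def mult_mod_right[symmetric] by (rule arg_cong)
    then have "[?G j = 1 + p ^ (r + k) * (m' mod p ^ t)] (mod p ^ (r + k + t))"
      unfolding m' power_add[of p "r + k" t] by (rule cong_add[OF cong_refl])
    moreover have "m' mod p ^ t < p ^ t" using p prime_gt_0_nat by simp
    ultimately show ?thesis by blast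
  qed
  then obtain \<mu> where \<mu>: "\<And>j. \<mu> j < p ^ t"
      "\<And>j. [?G j = 1 + p ^ (r + k) * \<mu> j] (mod p ^ (r + k + t))" by metis
  have "inj_on \<mu> {..<p ^ t}"
  proof (rule inj_onI)
    fix i j assume ij: "i \<in> {..<p ^ t}" "j \<in> {..<p ^ t}" "\<mu> i = \<mu> j"
    have "[?G i = ?G j] (mod p ^ (r + (k + t)))"
      using \<mu>(2)[of i] \<mu>(2)[of j] unfolding ij(3)
      unfolding add.assoc by (rule cong_trans[OF _ cong_sym])
    then have "[p ^ k * i = p ^ k * j] (mod p ^ (k + t))"
      by (simp only: one_plus_power_cong_iff[OF p r])
    then have "[i = j] (mod p ^ t)"
      using p by (auto simp: cong_def power_add mult_mod_right[symmetric])
    then show "i = j" using ij by (simp add: cong_def)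
  qed
  then have "bij_betw \<mu> {..<p ^ t} {..<p ^ t}"
    using \<mu>(1) by (intro bij_betw_imageI endo_inj_surj) auto
  then show ?thesis using \<mu>(2) by blast
qed

section \<open>Primitive roots of unity in a field\<close>

lemma primitive_root_nonzero:
  "primitive_root_of_unity m x \<Longrightarrow> m > 0 \<Longrightarrow> x \<noteq> (0::'k::field)"
  by (auto simp: primitive_root_of_unity_def zero_power)

lemma primitive_root_power_cong:
  fixes x :: "'k::field"
  assumes "primitive_root_of_unity m x" "[i = j] (mod m)"
  shows "x ^ i = x ^ j"
proof -
  have *: "x ^ i = x ^ (i mod m)" for i
  proof -
    have "x ^ i = x ^ (m * (i div m) + i mod m)" by simp
    also have "\<dots> = x ^ (i mod m)"
      using assms(1) by (simp only: power_add power_mult primitive_root_of_unity_def) simp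
    finally show ?thesis .
  qed
  show ?thesis using *[of i] *[of j] assms(2) by (simp add: cong_def)
qed

lemma primitive_root_power_eq_iff:
  fixes x :: "'k::field"
  assumes x: "primitive_root_of_unity m x" and m: "m > 0"
  shows "x ^ i = x ^ j \<longleftrightarrow> [i = j] (mod m)"
proof
  have mm: "x ^ (i mod m) = x ^ i" for i
    by (rule primitive_root_power_cong[OF x]) simp
  have *: "i mod m = j mod m" if le: "i mod m \<le> j mod m" and eq: "x ^ i = x ^ j" for i j
  proof -
    have "x ^ (i mod m) * x ^ (j mod m - i mod m) = x ^ (j mod m)"
      unfolding power_add[symmetric] le_add_diff_inverse[OF le] ..
    then have "x ^ (i mod m) * x ^ (j mod m - i mod m) = x ^ (i mod m)"
      by (simp only: mm eq)
    then have "x ^ (j mod m - i mod m) = 1"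
      using primitive_root_nonzero[OF x m] by simp
    moreover have "j mod m - i mod m < m" using m by (simp add: less_imp_diff_less)
    ultimately show ?thesis using x le unfolding primitive_root_of_unity_def
      by (metis diff_is_0_eq le_antisym neq0_conv)
  qed
  assume "x ^ i = x ^ j"
  then show "[i = j] (mod m)" unfolding cong_def
    using *[of i j] *[of j i] by (metis linear)
qed (use primitive_root_power_cong[OF x] in blast)

lemma primitive_root_power:
  fixes x :: "'k::field"
  assumes x: "primitive_root_of_unity (a * b) x" and ab: "a > 0" "b > 0"
  shows "primitive_root_of_unity b (x ^ a)"
  unfolding primitive_root_of_unity_def
proof (intro conjI allI impI)
  show "(x ^ a) ^ b = 1" using x by (simp add: primitive_root_of_unity_def power_mult)
  fix k assume "0 < k \<and> k < b"
  then show "(x ^ a) ^ k \<noteq> 1" using x ab by (simp add: primitive_root_of_unity_def power_mult[symmetric])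
qed

lemma primitive_root_power_coprime:
  fixes x :: "'k::field"
  assumes x: "primitive_root_of_unity m x" and m: "m > 0" and cop: "coprime a m"
  shows "primitive_root_of_unity m (x ^ a)"
  unfolding primitive_root_of_unity_def
proof (intro conjI allI impI)
  show "(x ^ a) ^ m = 1"
    using x unfolding primitive_root_of_unity_def by (metis power_mult mult.commute power_one)
  fix j assume j: "0 < j \<and> j < m"
  show "(x ^ a) ^ j \<noteq> 1"
  proof
    assume "(x ^ a) ^ j = 1"
    then have "x ^ (a * j) = x ^ 0" by (simp add: power_mult)
    then have "m dvd a * j" by (simp only: primitive_root_power_eq_iff[OF x m] cong_0_iff)
    then have "m dvd j" using cop by (metis coprime_commute coprime_dvd_mult_right_iff)
    then show False using j by (auto dest: dvd_imp_le)
  qed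
qed

text \<open>Two polynomials of degree at most m with the same coefficient in degree m coincide if
  they agree at m points; the points are the powers of x, which are distinct.\<close>

lemma prod_linear_primitive_root:
  fixes x :: "'k::field"
  assumes x: "primitive_root_of_unity m x" and m: "m > 0"
  shows "(\<Prod>j<m. [:- (x ^ j), 1:]) = monom 1 m - 1"
proof (rule poly_eqI_degree_lead_coeff[where A = "(\<lambda>j. x ^ j) ` {..<m}" and n = m])
  have deg: "degree (\<Prod>j<m. [:- (x ^ j), 1:]) = m" "lead_coeff (\<Prod>j<m. [:- (x ^ j), 1:]) = 1"
    by (subst degree_prod_eq_sum_degree; simp) (simp add: lead_coeff_prod)
  show "coeff (\<Prod>j<m. [:- (x ^ j), 1:]) m = coeff (monom 1 m - 1) m"
    using deg m by (simp add: coeff_1)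
  have inj: "inj_on (\<lambda>j. x ^ j) {..<m}"
    by (auto intro!: inj_onI simp: primitive_root_power_eq_iff[OF x m] cong_def)
  show "m \<le> card ((\<lambda>j. x ^ j) ` {..<m})" by (simp add: card_image[OF inj])
  show "degree (\<Prod>j<m. [:- (x ^ j), 1:]) \<le> m" using deg by simp
  show "degree (monom 1 m - 1 :: 'k poly) \<le> m"
    by (rule degree_diff_le) (auto simp: degree_monom_le)
next
  fix z assume "z \<in> (\<lambda>j. x ^ j) ` {..<m}"
  then obtain j where j: "j < m" "z = x ^ j" by auto
  have "poly (monom 1 m - 1) z = 0"
    using x by (simp add: j poly_monom power_mult[symmetric] mult.commute[of j])
      (simp add: power_mult primitive_root_of_unity_def)
  moreover have "poly (\<Prod>j<m. [:- (x ^ j), 1:]) z = 0"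
    unfolding poly_prod using j by (intro prod_zero) auto
  ultimately show "poly (\<Prod>j<m. [:- (x ^ j), 1:]) z = poly (monom 1 m - 1) z" by simp
qed

lemma prod_one_minus_primitive_root:
  fixes x y :: "'k::field"
  assumes x: "primitive_root_of_unity m x" and m: "m > 0"
  shows "(\<Prod>j<m. 1 - y * x ^ j) = 1 - y ^ m"
proof (cases "y = 0")
  case False
  have "(\<Prod>j<m. 1 / y - x ^ j) = (1 / y) ^ m - 1"
    using arg_cong[OF prod_linear_primitive_root[OF x m], of "\<lambda>f. poly f (1 / y)"]
    by (simp add: poly_prod poly_monom)
  then have "(\<Prod>j<m. y) * (\<Prod>j<m. 1 / y - x ^ j) = 1 - y ^ m"
    using False by (simp add: right_diff_distrib power_mult_distrib[symmetric])
  then show ?thesis using False unfolding prod.distrib[symmetric] by (simp add: right_diff_distrib)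
qed (use m in \<open>simp add: zero_power\<close>)

text \<open>Cancel X - 1 in the factorization of X^m - 1 and evaluate the quotient at 1.\<close>

lemma prod_one_minus_primitive_root':
  fixes x :: "'k::field"
  assumes x: "primitive_root_of_unity m x" and m: "m > 0"
  shows "(\<Prod>j\<in>{1..<m}. 1 - x ^ j) = of_nat m"
proof -
  have "[:- 1, 1:] * (\<Prod>j\<in>{1..<m}. [:- (x ^ j), 1:]) = (\<Prod>j<m. [:- (x ^ j), 1:])"
  proof -
    have "{..<m} = insert 0 {1..<m}" using m by auto
    then show ?thesis by simp
  qed
  also have "\<dots> = [:- 1, 1:] * (\<Sum>j<m. monom 1 j)"
  proof -
    have "monom 1 m - 1 = (monom 1 1 - 1 :: 'k poly) * (\<Sum>j<m. monom 1 j)"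
      using power_diff_1_eq[of "monom 1 1 :: 'k poly" m]
      by (simp only: monom_power power_one mult_1)
    also have "monom 1 1 - 1 = [:- 1, 1 :: 'k:]"
      by (simp add: monom_Suc one_pCons)
    finally show ?thesis unfolding prod_linear_primitive_root[OF x m] .
  qed
  finally have "(\<Prod>j\<in>{1..<m}. [:- (x ^ j), 1:]) = (\<Sum>j<m. monom 1 j)"
    by (metis mult_cancel_left pCons_eq_0_iff zero_neq_one)
  from arg_cong[OF this, of "\<lambda>f. poly f 1"] show ?thesis
    by (simp add: poly_prod poly_sum poly_monom)
qed

lemma sum_powers_root_of_unity:
  fixes y :: "'k::field"
  assumes "y ^ m = 1"
  shows "(\<Sum>j<m. y ^ j) = (if y = 1 then of_nat m else 0)"
  using assms power_diff_1_eq[of y m] by (cases "m = 0") auto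

lemma one_minus_power_factor:
  "1 - y ^ b = (1 - y) * (\<Sum>i<b. y ^ i)" for y :: "'a::comm_ring_1"
  using power_diff_1_eq[of y b] by (simp add: algebra_simps)

lemma geometric_cong:
  assumes S: "is_subring S" and y: "y \<in> S" "cong_in S q y 1" and q: "q \<in> S"
  shows "cong_in S q (\<Sum>i<b. y ^ i) (of_nat b)"
proof -
  have "cong_in S q (\<Sum>i<b. y ^ i) (\<Sum>i<b. 1 ^ i)"
    by (intro cong_in_sum cong_in_power S y q subring_1)
  then show ?thesis by simp
qed

text \<open>\<open>p = \<Prod>\<^sub>b (1 - y\<^sub>1\<^sup>b)\<close> for a primitive \<open>p\<close>-th root \<open>y\<^sub>1\<close>, and \<open>1 - y\<^sub>1\<close> is the norm of \<open>1 - y\<close>;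
  the sign comes from Wilson's theorem.\<close>

lemma prime_factorization_cyclotomic:
  fixes y :: "'k::field"
  assumes p: "prime p" and r: "r \<ge> 1" and S: "is_subring S" and y: "y \<in> S"
    and prim: "primitive_root_of_unity (p ^ r) y"
  shows "\<exists>\<epsilon>\<in>S. of_nat p = (1 - y) ^ ((p - 1) * p ^ (r - 1)) * \<epsilon> \<and> cong_in S (1 - y) \<epsilon> (- 1)"
proof -
  define \<pi> where "\<pi> = 1 - y"
  define h where "h = p ^ (r - 1)"
  define y1 where "y1 = y ^ h"
  have p0: "p > 0" "p > 1" using p prime_gt_0_nat prime_gt_1_nat by auto
  have pr: "p ^ r = h * p" "p ^ r = p * h" using r unfolding h_def by (cases r; simp)+
  have h0: "h > 0" unfolding h_def using p0 by simp
  have prim1: "primitive_root_of_unity p y1"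
    unfolding y1_def using prim h0 p0 unfolding pr(1) by (intro primitive_root_power)
  have prim2: "primitive_root_of_unity h (y ^ p)"
    using prim h0 p0 unfolding pr(2) by (intro primitive_root_power)
  have \<pi>S: "\<pi> \<in> S" unfolding \<pi>_def by (intro subring_intros S y)
  have y1S: "y1 \<in> S" unfolding y1_def by (intro subring_intros S y)
  have y_cong: "cong_in S \<pi> y 1"
    unfolding cong_in_def \<pi>_def by (rule bexI[of _ "- 1"]) (auto intro: subring_intros S)
  have y1_cong: "cong_in S \<pi> y1 1"
    using cong_in_power[OF S \<pi>S y subring_1[OF S] y_cong, of h] by (simp add: y1_def)
  \<comment> \<open>Cyclotomic units: the factors are the quotients of
    \<open>1 - y ^ (1 + p * j)\<close> by \<open>1 - y\<close> and of \<open>1 - y1 ^ b\<close> by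
    \<open>1 - y1\<close>. Modulo \<pi> each geometric sum becomes its number of summands.\<close>
  define U where "U = (\<Prod>j<h. \<Sum>i<1 + p * j. y ^ i)"
  define V where "V = (\<Prod>b\<in>{1..<p}. \<Sum>i<b. y1 ^ i)"
  have U: "1 - y1 = \<pi> ^ h * U"
  proof -
    have "1 - y1 = (\<Prod>j<h. 1 - y * (y ^ p) ^ j)"
      unfolding y1_def by (rule prod_one_minus_primitive_root[OF prim2 h0, symmetric])
    also have "\<dots> = (\<Prod>j<h. \<pi> * (\<Sum>i<1 + p * j. y ^ i))"
      unfolding \<pi>_def one_minus_power_factor[symmetric] by (simp add: power_mult)
    finally show ?thesis by (simp add: prod.distrib U_def)
  qed
  have "of_nat p = (\<Prod>b\<in>{1..<p}. 1 - y1 ^ b)"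
    using prod_one_minus_primitive_root'[OF prim1] p0 by simp
  also have "\<dots> = (1 - y1) ^ (p - 1) * V"
    unfolding one_minus_power_factor by (simp add: prod.distrib V_def)
  finally have eq: "of_nat p = \<pi> ^ ((p - 1) * h) * (U ^ (p - 1) * V)"
    unfolding U by (simp add: power_mult_distrib power_mult[symmetric] mult_ac)
  have US: "U \<in> S" and VS: "V \<in> S" unfolding U_def V_def by (intro subring_intros S y y1S)+
  \<comment> \<open>The factorization just found already shows that \<pi> divides p, which is needed
    to reduce the residues of \<open>U\<close> and \<open>V\<close> further.\<close>
  have p_cong: "cong_in S \<pi> (of_nat p) 0"
  proof -
    have "of_nat p = \<pi> * (\<pi> ^ ((p - 1) * h - 1) * (U ^ (p - 1) * V))"
      using p0 h0 unfolding eq by (cases "(p - 1) * h") (auto simp: mult_ac)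
    moreover have "\<pi> ^ ((p - 1) * h - 1) * (U ^ (p - 1) * V) \<in> S"
      by (intro subring_intros S US VS \<pi>S)
    ultimately show ?thesis unfolding cong_in_def add_0 by blast
  qed
  have cU: "cong_in S \<pi> U 1"
  proof -
    have "cong_in S \<pi> U (\<Prod>j<h. of_nat (1 + p * j))"
      unfolding U_def by (intro cong_in_prod geometric_cong S \<pi>S y y_cong subring_intros)
    moreover have "cong_in S \<pi> (\<Prod>j<h. of_nat (1 + p * j)) (\<Prod>j<h. 1 + 0 * of_nat j)"
      unfolding of_nat_add of_nat_mult of_nat_1
      by (intro cong_in_prod cong_in_add cong_in_mult cong_in_refl p_cong S \<pi>S y subring_intros)
    ultimately show ?thesis using cong_in_trans[OF S] by fastforce
  qed
  have cV: "cong_in S \<pi> V (- 1)"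
  proof -
    have "cong_in S \<pi> V (\<Prod>b\<in>{1..<p}. of_nat b)"
      unfolding V_def by (intro cong_in_prod geometric_cong S \<pi>S y1S y1_cong subring_intros)
    moreover have "{1..<p} = {1..p - 1}" using p0 by auto
    ultimately have 1: "cong_in S \<pi> V (of_nat (fact (p - 1)))"
      by (simp add: fact_prod)
    have "[fact (p - 1) = - 1] (mod int p)" by (rule wilson_theorem[OF p])
    then have "[int (fact (p - 1) + 1) = int 0] (mod int p)"
      by (simp add: cong_iff_dvd_diff add.commute)
    then have "p dvd fact (p - 1) + 1" by (simp only: cong_int_iff cong_0_iff)
    then obtain m where "fact (p - 1) + 1 = p * m" by blast
    then have "of_nat (fact (p - 1) + 1) = (of_nat (p * m) :: 'k)" by (rule arg_cong)
    then have "(of_nat (fact (p - 1)) :: 'k) = of_nat p * of_nat m - 1" by (simp add: eq_diff_eq add.commute)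
    moreover have "cong_in S \<pi> (of_nat p * of_nat m - 1) (0 * of_nat m - 1)"
      by (intro cong_in_diff cong_in_mult cong_in_refl p_cong S \<pi>S subring_intros)
    ultimately show ?thesis using 1 cong_in_trans[OF S] by fastforce
  qed
  have "cong_in S \<pi> (U ^ (p - 1) * V) (1 ^ (p - 1) * (- 1))"
    by (intro cong_in_mult cong_in_power cU cV S \<pi>S US VS subring_intros)
  then show ?thesis using eq US VS unfolding \<pi>_def h_def
    by (intro bexI[of _ "U ^ (p - 1) * V"]) (auto intro!: subring_intros S)
qed

text \<open>Here \<theta> will be an eigenvalue of the image of a root of unity under a splitting,
  so only its \<open>p ^ s\<close>-th power is assumed to lie in \<open>A\<close>.\<close>

locale cyclotomic_tower =
  fixes p r s :: nat and \<theta> :: "'k::field_char_0" and A :: "'k set"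
  assumes prime_p: "prime p" and odd_p: "odd p" and r_ge_1: "r \<ge> 1"
    and subring_A: "is_subring A"
    and prim_\<theta>: "primitive_root_of_unity (p ^ (r + s)) \<theta>"
    and \<theta>_power_in: "\<theta> ^ (p ^ s) \<in> A"
begin

definition \<pi> :: 'k where "\<pi> = 1 - \<theta> ^ (p ^ s)"
definition G :: nat where "G = 1 + p ^ r"
text \<open>For j < p^k these are the conjugates over layer r of
  \<open>\<theta> ^ (p ^ (s - k))\<close>, a primitive \<open>p ^ (r + k)\<close>-th root of unity;
  \<open>G\<close> is the exponent by which the Galois generator acts.\<close>

definition xi :: "nat \<Rightarrow> nat \<Rightarrow> 'k" where "xi k j = \<theta> ^ (p ^ (s - k) * G ^ j)"

lemma p_gt_1: "p > 1" "p > 0" "p \<ge> 3"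
  using prime_gt_1_nat[OF prime_p] odd_p by (auto simp: numeral_3_eq_3 Suc_le_eq)
    (metis One_nat_def Suc_1 Suc_lessI even_numeral)

lemma p_pos [simp]: "p > 0" "p \<noteq> 0" "p ^ k > 0" using p_gt_1 by simp_all

lemma ppow_gt_0: "p ^ k > 0" by simp

lemma \<pi>_in: "\<pi> \<in> A"
  unfolding \<pi>_def by (intro subring_intros subring_A \<theta>_power_in)

lemma prim_\<theta>_power: "k \<le> s \<Longrightarrow> primitive_root_of_unity (p ^ (r + k)) (\<theta> ^ (p ^ (s - k)))"
  by (rule primitive_root_power) (use prim_\<theta> in \<open>simp_all add: add.commute flip: power_add\<close>)

lemma \<pi>_nonzero: "\<pi> \<noteq> 0"
proof -
  have "(\<theta> ^ (p ^ s)) ^ 1 \<noteq> 1" if "1 < p ^ r"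
    using prim_\<theta>_power[of 0] that by (auto simp: primitive_root_of_unity_def)
  moreover have "1 < p ^ r" using p_gt_1 r_ge_1 by (intro one_less_power) auto
  ultimately show ?thesis by (simp add: \<pi>_def)
qed

text \<open>The ramification index of p once the \<open>p ^ r\<close>-th roots of unity are adjoined
  to an unramified base.\<close>

definition c :: nat where "c = (p - 1) * p ^ (r - 1)"

lemma p_eq: "\<exists>\<epsilon>\<in>A. of_nat p = \<pi> ^ c * \<epsilon> \<and> cong_in A \<pi> \<epsilon> (- 1)"
  unfolding c_def \<pi>_def
  by (rule prime_factorization_cyclotomic[OF prime_p r_ge_1 subring_A \<theta>_power_in])
    (use prim_\<theta>_power[of 0] in simp)

lemma c_ge_2: "c \<ge> 2"
proof -
  have "2 * 1 \<le> (p - 1) * p ^ (r - 1)"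
    using p_gt_1 by (intro mult_mono) (auto simp: Suc_le_eq)
  then show ?thesis by (simp add: c_def)
qed

text \<open>Divisibility of p by the square of \<pi>, and not just by \<pi>, is what makes
  \<open>(1 - xi k j) ^ (p ^ k)\<close> equal to \<pi> to first order later on. It holds because p -
  1 is at least 2.\<close>

lemma p_eq': "\<exists>z\<in>A. of_nat p = \<pi> * (\<pi> * z)"
proof -
  obtain \<epsilon> where \<epsilon>: "\<epsilon> \<in> A" "of_nat p = \<pi> ^ c * \<epsilon>" using p_eq by blast
  have "\<pi> ^ c = \<pi> * (\<pi> * \<pi> ^ (c - 2))"
    using c_ge_2 by (metis le_add_diff_inverse mult.assoc power2_eq_square power_add)
  then show ?thesis using \<epsilon>
    by (intro bexI[of _ "\<pi> ^ (c - 2) * \<epsilon>"]) (auto intro!: subring_intros subring_A \<pi>_in simp: mult.assoc)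
qed

lemma \<theta>_power_cong: "[i = j] (mod p ^ (r + s)) \<Longrightarrow> \<theta> ^ i = \<theta> ^ j"
  by (rule primitive_root_power_cong[OF prim_\<theta>])

lemma xi_power: 
  assumes "k \<le> s" shows "xi k j ^ (p ^ k) = \<theta> ^ (p ^ s)"
proof -
  have "xi k j ^ (p ^ k) = \<theta> ^ (p ^ s * G ^ j)"
    using assms unfolding xi_def power_mult[symmetric]
    by (metis (no_types, lifting) le_add_diff_inverse2 mult.assoc mult.commute power_add)
  also have "\<dots> = \<theta> ^ (p ^ s * 1)"
  proof (rule \<theta>_power_cong)
    have "[G ^ j = 1] (mod p ^ r)"
      using one_plus_power_cong_1_iff[OF prime_p odd_p r_ge_1, of j 0] by (simp add: G_def)
    then show "[p ^ s * G ^ j = p ^ s * 1] (mod p ^ (r + s))"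
      unfolding power_add mult.commute[of "p ^ r"] cong_def mult_mod_right[symmetric] by simp
  qed
  finally show ?thesis by simp
qed

text \<open>The trace of a power of a \<open>p ^ (r + k)\<close>-th root of unity down to layer r.
  The conjugates are the products of one of them with the \<open>p ^ k\<close>-th roots of unity,
  and the i-th powers of the latter add up to zero unless \<open>p ^ k\<close> divides i.\<close>

lemma sum_xi_power:
  assumes k: "k \<le> s"
  shows "(\<Sum>j<p ^ k. xi k j ^ i) = (if p ^ k dvd i then of_nat (p ^ k) * (\<theta> ^ (p ^ s)) ^ (i div p ^ k) else 0)"
proof -
  let ?x = "\<theta> ^ (p ^ (s - k))"
  have px: "primitive_root_of_unity (p ^ (r + k)) ?x" by (rule prim_\<theta>_power[OF k])
  obtain \<mu> where \<mu>: "bij_betw \<mu> {..<p ^ k} {..<p ^ k}"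
      "\<And>j. [(1 + p ^ r) ^ (p ^ 0 * j) = 1 + p ^ (r + 0) * \<mu> j] (mod p ^ (r + 0 + k))"
    using one_plus_power_bij[OF prime_p odd_p r_ge_1, of k 0] by metis
  have "(\<Sum>j<p ^ k. xi k j ^ i) = (\<Sum>j<p ^ k. ?x ^ i * ((?x ^ (p ^ r * i)) ^ \<mu> j))"
  proof (intro sum.cong refl)
    fix j
    have "xi k j = ?x ^ (G ^ j)" by (simp add: xi_def power_mult)
    also have "\<dots> = ?x ^ (1 + p ^ r * \<mu> j)"
      using \<mu>(2)[of j] by (intro primitive_root_power_cong[OF px]) (simp add: G_def)
    finally show "xi k j ^ i = ?x ^ i * ((?x ^ (p ^ r * i)) ^ \<mu> j)"
      by (simp only: power_mult[symmetric] power_add[symmetric]) (simp add: algebra_simps)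
  qed
  also have "\<dots> = ?x ^ i * (\<Sum>j<p ^ k. (?x ^ (p ^ r * i)) ^ \<mu> j)"
    by (simp add: sum_distrib_left)
  also have "(\<Sum>j<p ^ k. (?x ^ (p ^ r * i)) ^ \<mu> j) = (\<Sum>m<p ^ k. (?x ^ (p ^ r * i)) ^ m)"
    by (rule sum.reindex_bij_betw[OF \<mu>(1)])
  also have "\<dots> = (if ?x ^ (p ^ r * i) = 1 then of_nat (p ^ k) else 0)"
  proof (rule sum_powers_root_of_unity)
    have "?x ^ (p ^ r * i * p ^ k) = ?x ^ 0"
      by (rule primitive_root_power_cong[OF px]) (simp add: power_add cong_0_iff)
    then show "(?x ^ (p ^ r * i)) ^ p ^ k = 1" by (simp add: power_mult)
  qed
  also have "?x ^ (p ^ r * i) = 1 \<longleftrightarrow> p ^ k dvd i"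
    using primitive_root_power_eq_iff[OF px, of "p ^ r * i" 0]
    by (simp add: power_add cong_0_iff)
  also have "?x ^ i * (if p ^ k dvd i then of_nat (p ^ k) else 0) =
     (if p ^ k dvd i then of_nat (p ^ k) * (\<theta> ^ (p ^ s)) ^ (i div p ^ k) else 0)"
  proof -
    have "?x ^ i = (\<theta> ^ (p ^ s)) ^ (i div p ^ k)" if "p ^ k dvd i"
    proof -
      obtain m where m: "i = p ^ k * m" using \<open>p ^ k dvd i\<close> by blast
      have "p ^ (s - k) * p ^ k = p ^ s" using k by (simp flip: power_add)
      then show ?thesis unfolding m by (simp flip: power_mult add: mult.assoc[symmetric])
    qed
    then show ?thesis by simp
  qed
  finally show ?thesis .
qed

text \<open>The norm from layer r + s to layer r + k. The roots of unity involved are a single one,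
  y, times all \<open>p ^ (s - k)\<close>-th roots of unity, and the product over these is
  \<open>1 - y ^ (p ^ (s - k))\<close>.\<close>

lemma prod_one_minus_conjugates:
  assumes k: "k \<le> s"
  shows "(\<Prod>m<p ^ (s - k). 1 - \<theta> ^ (G ^ (o' + p ^ k * m))) = 1 - xi k o'"
proof -
  let ?y = "\<theta> ^ (G ^ o')"
  obtain \<mu> where \<mu>: "bij_betw \<mu> {..<p ^ (s - k)} {..<p ^ (s - k)}"
      "\<And>j. [(1 + p ^ r) ^ (p ^ k * j) = 1 + p ^ (r + k) * \<mu> j] (mod p ^ (r + k + (s - k)))"
    using one_plus_power_bij[OF prime_p odd_p r_ge_1, of "s - k" k] by metis
  let ?\<eta> = "\<theta> ^ (p ^ (r + k))"
  have prim\<eta>: "primitive_root_of_unity (p ^ (s - k)) ?\<eta>"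
    by (rule primitive_root_power) (use prim_\<theta> k in \<open>simp_all flip: power_add\<close>)
  have prim\<eta>': "primitive_root_of_unity (p ^ (s - k)) (?\<eta> ^ (G ^ o'))"
  proof (rule primitive_root_power_coprime[OF prim\<eta> ppow_gt_0])
    show "coprime (G ^ o') (p ^ (s - k))"
      unfolding G_def coprime_power_left_iff
      using one_plus_power_coprime[OF r_ge_1, of p 1 "s - k"] by (simp only: mult_1_right simp_thms)
  qed
  have "(\<Prod>m<p ^ (s - k). 1 - \<theta> ^ (G ^ (o' + p ^ k * m))) =
        (\<Prod>m<p ^ (s - k). 1 - ?y * (?\<eta> ^ (G ^ o')) ^ \<mu> m)"
  proof (intro prod.cong refl arg_cong2[where f = minus])
    fix m
    have "\<theta> ^ (G ^ (o' + p ^ k * m)) = \<theta> ^ (G ^ o' * (1 + p ^ (r + k) * \<mu> m))"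
      unfolding power_add[of G]
      by (intro \<theta>_power_cong cong_mult cong_refl) (use \<mu>(2)[of m] k in \<open>simp add: G_def\<close>)
    then show "\<theta> ^ (G ^ (o' + p ^ k * m)) = ?y * (?\<eta> ^ (G ^ o')) ^ \<mu> m"
      by (simp add: power_mult[symmetric] power_add[symmetric] algebra_simps)
  qed
  also have "\<dots> = (\<Prod>m<p ^ (s - k). 1 - ?y * (?\<eta> ^ (G ^ o')) ^ m)"
    by (rule prod.reindex_bij_betw[OF \<mu>(1)])
  also have "\<dots> = 1 - ?y ^ (p ^ (s - k))"
    by (rule prod_one_minus_primitive_root[OF prim\<eta>' ppow_gt_0])
  finally show ?thesis by (simp add: xi_def power_mult[symmetric] mult.commute)
qed

text \<open>Each monomial has trace zero or \<open>p ^ k\<close> times a power of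
  \<open>\<theta> ^ (p ^ s)\<close>; this is the source of the factor \<open>p ^ k\<close> in every
  orbit sum.\<close>

lemma trace_in:
  assumes k: "k \<le> s" and f: "f \<in> polys_over A"
  shows "\<exists>z\<in>A. (\<Sum>j<p ^ k. poly f (xi k j)) = of_nat (p ^ k) * z"
proof -
  have "(\<Sum>j<p ^ k. poly f (xi k j)) = (\<Sum>i\<le>degree f. coeff f i * (\<Sum>j<p ^ k. xi k j ^ i))"
    unfolding poly_altdef sum_distrib_left by (rule sum.swap)
  also have "\<dots> = (\<Sum>i\<le>degree f. of_nat (p ^ k) * (if p ^ k dvd i then coeff f i * (\<theta> ^ (p ^ s)) ^ (i div p ^ k) else 0))"
    unfolding sum_xi_power[OF k] by (intro sum.cong) auto
  finally show ?thesis unfolding sum_distrib_left[symmetric]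
    by (rule bexI) (use f \<theta>_power_in in \<open>auto simp: polys_over_def intro!: subring_intros subring_A\<close>)
qed

text \<open>For q = 1 the left-hand side is \<open>1 - xi k j ^ (p ^ k)\<close> modulo p, which is
  \<pi>, and p is divisible by the square of \<pi>. The error term comes from one polynomial for all
  j, as taking traces requires.\<close>

lemma one_minus_xi_power:
  assumes k: "k \<le> s"
  shows "\<exists>W\<in>polys_over A. \<forall>j. (1 - xi k j) ^ (p ^ k * q) = \<pi> ^ q * (1 + \<pi> * poly W (xi k j))"
proof -
  note SP = subring_polys_over[OF subring_A]
  obtain z where z: "z \<in> A" "of_nat p = \<pi> * (\<pi> * z)" using p_eq' by blast
  have "cong_in (polys_over A) (of_nat p) ((1 + - monom 1 1) ^ (p ^ k)) (1 ^ (p ^ k) + (- monom 1 1) ^ (p ^ k))"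
    by (intro freshman prime_p SP subring_intros polys_over_monom subring_A)
  then obtain W where W: "W \<in> polys_over A"
    "(1 + - monom 1 1) ^ (p ^ k) = 1 ^ (p ^ k) + (- monom 1 1) ^ (p ^ k) + of_nat p * W"
    by (auto simp: cong_in_def)
  have W': "(1 - xi k j) ^ (p ^ k) = \<pi> * (1 + \<pi> * poly (smult z W) (xi k j))" for j
  proof -
    have "(1 - xi k j) ^ (p ^ k) = 1 + (- xi k j) ^ (p ^ k) + of_nat p * poly W (xi k j)"
      using arg_cong[OF W(2), of "\<lambda>f. poly f (xi k j)"] by (simp add: poly_monom of_nat_poly)
    also have "(- xi k j) ^ (p ^ k) = - (\<theta> ^ (p ^ s))"
      using odd_p by (simp add: xi_power[OF k])
    finally show ?thesis unfolding z(2) by (simp add: \<pi>_def algebra_simps)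
  qed
  have const: "[:\<pi>:] \<in> polys_over A"
    by (simp add: polys_over_pCons subring_A \<pi>_in subring_0 SP)
  have Wz: "smult z W \<in> polys_over A" by (intro polys_over_smult subring_A z W)
  have "cong_in (polys_over A) [:\<pi>:] (1 + [:\<pi>:] * smult z W) 1"
    unfolding cong_in_def using Wz by blast
  then have "cong_in (polys_over A) [:\<pi>:] ((1 + [:\<pi>:] * smult z W) ^ q) (1 ^ q)"
    by (intro cong_in_power SP subring_intros const Wz)
  then obtain V where V: "V \<in> polys_over A" "(1 + [:\<pi>:] * smult z W) ^ q = 1 + [:\<pi>:] * V"
    by (auto simp: cong_in_def)
  show ?thesis
  proof (intro bexI[OF _ V(1)] allI)
    fix j
    have "(1 + \<pi> * poly (smult z W) (xi k j)) ^ q = 1 + \<pi> * poly V (xi k j)"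
      using arg_cong[OF V(2), of "\<lambda>f. poly f (xi k j)"] by (simp add: mult_ac)
    then show "(1 - xi k j) ^ (p ^ k * q) = \<pi> ^ q * (1 + \<pi> * poly V (xi k j))"
      by (simp only: power_mult W' power_mult_distrib)
  qed
qed

text \<open>Of the \<open>M\<close> factors, \<open>p ^ k * q\<close> are converted into
  \<open>\<pi> ^ q\<close> by the preceding lemma; the others are absorbed into the polynomial whose
  trace is taken.\<close>

lemma trace_in_power:
  assumes k: "k \<le> s" and f: "f \<in> polys_over A" and q: "p ^ k * q \<le> M"
  shows "\<exists>z\<in>A. (\<Sum>j<p ^ k. (1 - xi k j) ^ M * poly f (xi k j)) = of_nat (p ^ k) * \<pi> ^ q * z"
proof -
  note SP = subring_polys_over[OF subring_A]
  obtain W where W: "W \<in> polys_over A"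
      "\<And>j. (1 - xi k j) ^ (p ^ k * q) = \<pi> ^ q * (1 + \<pi> * poly W (xi k j))"
    using one_minus_xi_power[OF k] by blast
  let ?h = "(1 + smult \<pi> W) * (1 - monom 1 1) ^ (M - p ^ k * q) * f"
  have h: "?h \<in> polys_over A"
    by (intro SP subring_intros polys_over_smult polys_over_monom subring_A W \<pi>_in f)
  obtain z where z: "z \<in> A" "(\<Sum>j<p ^ k. poly ?h (xi k j)) = of_nat (p ^ k) * z"
    using trace_in[OF k h] by blast
  have "(\<Sum>j<p ^ k. (1 - xi k j) ^ M * poly f (xi k j)) = (\<Sum>j<p ^ k. \<pi> ^ q * poly ?h (xi k j))"
  proof (intro sum.cong refl)
    fix j
    have "(1 - xi k j) ^ M = (1 - xi k j) ^ (p ^ k * q) * (1 - xi k j) ^ (M - p ^ k * q)"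
      using q by (simp flip: power_add)
    then show "(1 - xi k j) ^ M * poly f (xi k j) = \<pi> ^ q * poly ?h (xi k j)"
      unfolding W(2) by (simp add: poly_monom mult_ac)
  qed
  then show ?thesis using z by (intro bexI[OF _ z(1)]) (simp add: sum_distrib_left[symmetric] mult_ac)
qed

text \<open>Here the range of summation in \<lambda> originates. If \<open>n mod p ^ k + l\<close>
  reaches \<open>p ^ k\<close>, one more factor \<pi> splits off. Otherwise, after removal of
  \<open>\<pi> ^ (n div p ^ k)\<close>, what remains to first order is a polynomial of degree below
  \<open>p ^ k\<close> in the root of unity, and only its constant term has nonzero trace.\<close>

lemma trace_main:
  assumes k: "k \<le> s"
  shows "\<exists>z\<in>A. (\<Sum>j<p ^ k. (1 - xi k j) ^ (n + l)) =
     of_nat (p ^ k) * \<pi> ^ (n div p ^ k) * ((if n mod p ^ k + l < p ^ k then 1 else 0) + \<pi> * z)"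
proof (cases "n mod p ^ k + l < p ^ k")
  case False
  have "p ^ k * (n div p ^ k + 1) \<le> n + l"
  proof -
    have "n + l = p ^ k * (n div p ^ k) + (n mod p ^ k + l)" by simp
    also have "\<dots> \<ge> p ^ k * (n div p ^ k) + p ^ k" using False by (intro add_left_mono) simp
    finally show ?thesis by simp
  qed
  from trace_in_power[OF k _ this, of 1] False subring_1[OF subring_polys_over[OF subring_A]]
  show ?thesis by (auto simp: mult_ac)
next
  case True
  note SP = subring_polys_over[OF subring_A]
  define q where "q = n div p ^ k"
  define m where "m = n mod p ^ k + l"
  have nl: "n + l = p ^ k * q + m" by (simp add: q_def m_def)
  have m: "m < p ^ k" using True by (simp add: m_def)
  obtain W where W: "W \<in> polys_over A"
      "\<And>j. (1 - xi k j) ^ (p ^ k * q) = \<pi> ^ q * (1 + \<pi> * poly W (xi k j))"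
    using one_minus_xi_power[OF k] by blast
  have h: "W * (1 - monom 1 1) ^ m \<in> polys_over A"
    by (intro SP subring_intros polys_over_monom subring_A W)
  obtain z where z: "z \<in> A" "(\<Sum>j<p ^ k. poly (W * (1 - monom 1 1) ^ m) (xi k j)) = of_nat (p ^ k) * z"
    using trace_in[OF k h] by blast
  have one: "(\<Sum>j<p ^ k. (1 - xi k j) ^ m) = of_nat (p ^ k)"
  proof -
    have "(\<Sum>j<p ^ k. (1 - xi k j) ^ m) = (\<Sum>j<p ^ k. \<Sum>i\<le>m. of_nat (m choose i) * (- 1) ^ i * xi k j ^ i)"
    proof (intro sum.cong refl)
      fix j
      have "(1 - xi k j) ^ m = (- xi k j + 1) ^ m" by simp
      also have "\<dots> = (\<Sum>i\<le>m. of_nat (m choose i) * (- xi k j) ^ i)"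
        by (subst binomial_ring) simp
      finally show "(1 - xi k j) ^ m = (\<Sum>i\<le>m. of_nat (m choose i) * (- 1) ^ i * xi k j ^ i)"
        by (subst (asm) power_minus) (simp add: mult.assoc)
    qed
    also have "\<dots> = (\<Sum>i\<le>m. of_nat (m choose i) * (- 1) ^ i * (\<Sum>j<p ^ k. xi k j ^ i))"
      unfolding sum_distrib_left by (rule sum.swap)
    also have "\<dots> = (\<Sum>i\<le>m. if i = 0 then of_nat (p ^ k) else 0)"
    proof (intro sum.cong refl)
      fix i assume "i \<in> {..m}"
      then have "p ^ k dvd i \<longleftrightarrow> i = 0" using m by (auto dest: dvd_imp_le)
      then show "of_nat (m choose i) * (- 1) ^ i * (\<Sum>j<p ^ k. xi k j ^ i) = (if i = 0 then of_nat (p ^ k) else 0)"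
        unfolding sum_xi_power[OF k] by auto
    qed
    finally show ?thesis by simp
  qed
  have "(\<Sum>j<p ^ k. (1 - xi k j) ^ (n + l)) =
     \<pi> ^ q * ((\<Sum>j<p ^ k. (1 - xi k j) ^ m) + \<pi> * (\<Sum>j<p ^ k. poly (W * (1 - monom 1 1) ^ m) (xi k j)))"
    unfolding nl power_add W(2) by (simp add: sum_distrib_left sum.distrib[symmetric] poly_monom algebra_simps)
  also have "\<dots> = of_nat (p ^ k) * \<pi> ^ q * (1 + \<pi> * z)"
    unfolding one z(2) by (simp add: algebra_simps)
  finally show ?thesis using True z(1) unfolding q_def by auto
qed

end

section \<open>Orbit sums\<close>

text \<open>Exponents are natural numbers, so \<open>i * (N - 1)\<close> serves throughout as the
  additive inverse of i modulo N.\<close>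

lemma mult_pred_add_self: "N > 0 \<Longrightarrow> i * (N - 1) + i = N * i" for N i :: nat
  by (cases N) simp_all

locale cyclic_action =
  fixes act :: "nat \<Rightarrow> 'w \<Rightarrow> 'w" and N :: nat
  assumes act_0: "act 0 \<omega> = \<omega>"
    and act_act: "act i (act j \<omega>) = act (i + j) \<omega>"
    and act_period: "act N \<omega> = \<omega>"
    and N_pos: "N > 0"
begin

lemma act_mult_fixed: "act i \<omega> = \<omega> \<Longrightarrow> act (i * m) \<omega> = \<omega>"
  by (induction m) (simp_all add: act_0 act_act[symmetric])

lemma act_inj: "act i \<omega> = act i \<omega>' \<Longrightarrow> \<omega> = \<omega>'"
proof -
  assume "act i \<omega> = act i \<omega>'"
  then have "act (i * (N - 1)) (act i \<omega>) = act (i * (N - 1)) (act i \<omega>')" by simp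
  moreover have "i * (N - 1) + i = N * i"
    by (rule mult_pred_add_self[OF N_pos])
  ultimately show ?thesis by (simp add: act_act act_mult_fixed act_period)
qed

text \<open>The stabilizer is a subgroup of a cyclic group of order \<open>p ^ s\<close>: by Bezout
  it contains \<open>gcd i N\<close> along with i, and this is a power of p.\<close>

lemma stabilizer_prime_power:
  assumes p: "prime p" and N: "N = p ^ s"
  shows "\<exists>k\<le>s. \<forall>i j. act i \<omega> = act j \<omega> \<longleftrightarrow> [i = j] (mod p ^ k)"
proof -
  define k where "k = (LEAST k. act (p ^ k) \<omega> = \<omega>)"
  have k: "act (p ^ k) \<omega> = \<omega>" unfolding k_def
    by (rule LeastI[of _ s]) (use act_period N in auto)
  have le: "k \<le> l" if "act (p ^ l) \<omega> = \<omega>" for l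
    unfolding k_def using that by (rule Least_le)
  have ks: "k \<le> s" using le[of s] act_period N by simp
  have fixed: "act i \<omega> = \<omega> \<longleftrightarrow> p ^ k dvd i" for i
  proof
    assume i: "act i \<omega> = \<omega>"
    show "p ^ k dvd i"
    proof (cases "i = 0")
      case False
      obtain x y where xy: "i * x = N * y + gcd i N" using bezout_nat[OF False] by blast
      have "\<omega> = act (gcd i N + N * y) \<omega>" using i act_mult_fixed[of i \<omega> x] by (simp add: xy add.commute)
      also have "\<dots> = act (gcd i N) \<omega>"
        by (simp add: act_act[symmetric] act_mult_fixed act_period)
      finally have g: "act (gcd i N) \<omega> = \<omega>" ..
      obtain l where l: "gcd i N = p ^ l"
        using divides_primepow_nat[OF p, of "gcd i N" s] unfolding N by auto
      have "p ^ k dvd p ^ l" using le[of l] g l by (simp add: le_imp_power_dvd)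
      then show ?thesis using l by (metis dvd_trans gcd_dvd1)
    qed simp
  qed (auto simp: act_mult_fixed k)
  have *: "act i \<omega> = act j \<omega> \<longleftrightarrow> [i = j] (mod p ^ k)" if "i \<le> j" for i j
  proof -
    have "act i \<omega> = act j \<omega> \<longleftrightarrow> act i (act (j - i) \<omega>) = act i \<omega>"
      using that by (auto simp: act_act)
    also have "\<dots> \<longleftrightarrow> act (j - i) \<omega> = \<omega>" by (auto dest: act_inj)
    also have "\<dots> \<longleftrightarrow> [i = j] (mod p ^ k)"
      unfolding fixed using that by (simp add: cong_altdef_nat' cong_sym_eq[of i j] nat_diff_distrib')
    finally show ?thesis .
  qed
  have "act i \<omega> = act j \<omega> \<longleftrightarrow> [i = j] (mod p ^ k)" for i j
    using *[of i j] *[of j i] by (metis cong_sym_eq linear)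
  then show ?thesis using ks by (intro exI[of _ k]) simp
qed

text \<open>One orbit is removed at a time, its complement being invariant again. In the application
  \<open>J\<close> is the ideal generated by a power of \<pi>.\<close>

lemma sum_orbits_in:
  fixes t :: "'w \<Rightarrow> 'a::comm_monoid_add"
  assumes "finite \<Omega>" and inv: "\<And>\<omega> j. \<omega> \<in> \<Omega> \<Longrightarrow> act j \<omega> \<in> \<Omega>"
    and orb: "\<And>\<omega>. \<omega> \<in> \<Omega> \<Longrightarrow>
        \<exists>K>0. (\<forall>i j. act i \<omega> = act j \<omega> \<longleftrightarrow> [i = j] (mod K)) \<and> (\<Sum>j<K. t (act j \<omega>)) \<in> J"
    and J: "0 \<in> J" "\<And>x y. x \<in> J \<Longrightarrow> y \<in> J \<Longrightarrow> x + y \<in> J"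
  shows "sum t \<Omega> \<in> J"
  using assms(1-3)
proof (induction \<Omega> rule: finite_psubset_induct)
  case (psubset \<Omega>)
  show ?case
  proof (cases "\<Omega> = {}")
    case False
    then obtain \<omega> where \<omega>: "\<omega> \<in> \<Omega>" by blast
    obtain K where K: "K > 0" "\<And>i j. act i \<omega> = act j \<omega> \<longleftrightarrow> [i = j] (mod K)"
        "(\<Sum>j<K. t (act j \<omega>)) \<in> J" using psubset.prems(2)[OF \<omega>] by blast
    let ?O = "(\<lambda>j. act j \<omega>) ` {..<K}"
    have O: "act j \<omega> \<in> ?O" for j
      using K(1) by (intro image_eqI[of _ _ "j mod K"]) (simp_all add: K(2) cong_sym_eq)
    have sub: "?O \<subseteq> \<Omega>" using psubset.prems(1)[OF \<omega>] by blast
    have "sum t ?O = (\<Sum>j<K. t (act j \<omega>))"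
      by (subst sum.reindex) (auto intro!: inj_onI simp: K(2) cong_def)
    moreover have "sum t (\<Omega> - ?O) \<in> J"
    proof (rule psubset.IH)
      show "\<Omega> - ?O \<subset> \<Omega>" using O[of 0] \<omega> by (auto simp: act_0)
      fix \<omega>' assume \<omega>': "\<omega>' \<in> \<Omega> - ?O"
      show "act j \<omega>' \<in> \<Omega> - ?O" for j
      proof -
        have "act j \<omega>' \<notin> ?O"
        proof
          assume "act j \<omega>' \<in> ?O"
          then obtain i where i: "act j \<omega>' = act i \<omega>" by blast
          have "act j (act (j * (N - 1) + i) \<omega>) = act (N * j + i) \<omega>"
            using mult_pred_add_self[OF N_pos, of j] by (simp only: act_act add.assoc[symmetric] add.commute[of j])
          also have "\<dots> = act i (act (N * j) \<omega>)" by (simp only: act_act add.commute)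
          finally have "\<omega>' = act (j * (N - 1) + i) \<omega>"
            using i act_inj by (metis act_mult_fixed act_period)
          then show False using \<omega>' O by auto
        qed
        then show ?thesis using psubset.prems(1)[of \<omega>'] \<omega>' by blast
      qed
      show "\<exists>K>0. (\<forall>i j. act i \<omega>' = act j \<omega>' \<longleftrightarrow> [i = j] (mod K)) \<and> (\<Sum>j<K. t (act j \<omega>')) \<in> J"
        using psubset.prems(2)[of \<omega>'] \<omega>' by blast
    qed
    ultimately have "sum t ?O + sum t (\<Omega> - ?O) \<in> J" using K(3) J(2) by metis
    then show ?thesis using sum.subset_diff[OF sub psubset.hyps(1), of t] by (simp add: add.commute)
  qed (use J in simp)
qed

end

section \<open>Expansion of the determinant\<close>

text \<open>The identity outside \<open>{..<N}\<close>, as \<open>permutes\<close> demands.\<close>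

definition rot :: "nat \<Rightarrow> nat \<Rightarrow> nat \<Rightarrow> nat" where
  "rot N j i = (if i < N then (i + j) mod N else i)"

lemma rot_rot: "rot N i (rot N j x) = rot N (i + j) x"
  by (auto simp: rot_def mod_simps algebra_simps)

lemma rot_comp: "rot N i \<circ> rot N j = rot N (i + j)"
  by (simp add: fun_eq_iff rot_rot)

lemma rot_cong: "[i = j] (mod N) \<Longrightarrow> rot N i = rot N j"
  by (auto simp: rot_def fun_eq_iff cong_def intro: mod_add_cong)

lemma rot_0: "rot N 0 = id"
  by (auto simp: rot_def)

lemma rot_less: "x < N \<Longrightarrow> rot N j x < N"
  by (auto simp: rot_def)

lemma rot_permutes: "rot N j permutes {..<N}"
proof (rule bij_imp_permutes)
  show "bij_betw (rot N j) {..<N} {..<N}"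
  proof (rule bij_betw_byWitness[where f' = "rot N (j * (N - 1))"])
    have "rot N (j * (N - 1) + j) = rot N 0" if "N > 0"
      unfolding mult_pred_add_self[OF that] by (intro rot_cong) (simp add: cong_0_iff)
    then show "\<forall>a\<in>{..<N}. rot N (j * (N - 1)) (rot N j a) = a"
      "\<forall>a'\<in>{..<N}. rot N j (rot N (j * (N - 1)) a') = a'"
      unfolding rot_rot by (auto simp: rot_0 add.commute)
  qed (auto simp: rot_less)
qed (auto simp: rot_def)

text \<open>A term of the expanded determinant is given by a permutation \<open>\<sigma>\<close> and, for each row \<open>i\<close>, the
  choice \<open>f i\<close> of either the summand 1 of a diagonal entry (\<open>f i = 0\<close>) or of the summand of
  index \<open>l\<close> of the \<open>P\<close>-adic expansion (\<open>f i = Suc l\<close>).\<close>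

definition terms :: "nat \<Rightarrow> ((nat \<Rightarrow> nat) \<times> (nat \<Rightarrow> nat)) set" where
  "terms N = {(\<sigma>, f). \<sigma> permutes {..<N} \<and> f \<in> (\<Pi>\<^sub>E i\<in>{..<N}. {..N}) \<and> (\<forall>i<N. f i = 0 \<longrightarrow> \<sigma> i = i)}"

text \<open>Rows and columns are rotated together: \<sigma> is conjugated by the rotation, and the
  choice made for row i moves to row i + j modulo N.\<close>

definition rotate_term :: "nat \<Rightarrow> nat \<Rightarrow> (nat \<Rightarrow> nat) \<times> (nat \<Rightarrow> nat) \<Rightarrow> (nat \<Rightarrow> nat) \<times> (nat \<Rightarrow> nat)" where
  "rotate_term N j = (\<lambda>(\<sigma>, f). (rot N j \<circ> \<sigma> \<circ> rot N (j * (N - 1)), f \<circ> rot N (j * (N - 1))))"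

lemma rot_inverse: "N > 0 \<Longrightarrow> rot N j \<circ> rot N (j * (N - 1)) = id" "N > 0 \<Longrightarrow> rot N (j * (N - 1)) \<circ> rot N j = id"
proof -
  assume N: "N > 0"
  have "rot N (j * (N - 1) + j) = rot N 0"
    unfolding mult_pred_add_self[OF N] by (intro rot_cong) (simp add: cong_0_iff)
  then show "rot N j \<circ> rot N (j * (N - 1)) = id" "rot N (j * (N - 1)) \<circ> rot N j = id"
    by (simp_all add: rot_comp rot_0 add.commute)
qed

lemma rot_inverse': "N > 0 \<Longrightarrow> rot N j (rot N (j * (N - 1)) x) = x" "N > 0 \<Longrightarrow> rot N (j * (N - 1)) (rot N j x) = x"
  using rot_inverse[of N j] by (metis comp_apply id_apply)+

lemma cyclic_action_rotate: "N > 0 \<Longrightarrow> cyclic_action (rotate_term N) N"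
proof
  assume N: "N > 0"
  fix \<omega> :: "(nat \<Rightarrow> nat) \<times> (nat \<Rightarrow> nat)" and i j
  obtain \<sigma> f where \<omega>: "\<omega> = (\<sigma>, f)" by (cases \<omega>)
  show "rotate_term N 0 \<omega> = \<omega>" by (simp add: \<omega> rotate_term_def rot_0)
  show "rotate_term N i (rotate_term N j \<omega>) = rotate_term N (i + j) \<omega>"
    unfolding \<omega> rotate_term_def
    by (simp add: fun_eq_iff rot_rot add_mult_distrib add.commute)
  have "rot N N = rot N 0" "rot N (N * (N - 1)) = rot N 0" by (auto intro!: rot_cong simp: cong_0_iff)
  then show "rotate_term N N \<omega> = \<omega>" by (simp add: \<omega> rotate_term_def rot_0)
qed

lemma finite_terms: "finite (terms N)"
proof -
  have "terms N \<subseteq> {\<sigma>. \<sigma> permutes {..<N}} \<times> (\<Pi>\<^sub>E i\<in>{..<N}. {..N})" by (auto simp: terms_def)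
  then show ?thesis by (rule finite_subset) (auto intro!: finite_PiE finite_permutations)
qed

lemma rotate_terms:
  assumes "\<omega> \<in> terms N" and N: "N > 0" shows "rotate_term N j \<omega> \<in> terms N"
proof -
  obtain \<sigma> f where \<omega>: "\<omega> = (\<sigma>, f)" "\<sigma> permutes {..<N}" "f \<in> (\<Pi>\<^sub>E i\<in>{..<N}. {..N})"
    "\<And>i. i < N \<Longrightarrow> f i = 0 \<Longrightarrow> \<sigma> i = i"
    using assms by (auto simp: terms_def)
  have "rot N j \<circ> \<sigma> \<circ> rot N (j * (N - 1)) permutes {..<N}"
    by (intro permutes_compose rot_permutes \<omega>)
  moreover have "f \<circ> rot N (j * (N - 1)) \<in> (\<Pi>\<^sub>E i\<in>{..<N}. {..N})"
  proof (rule PiE_I)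
    fix i assume "i \<in> {..<N}"
    then show "(f \<circ> rot N (j * (N - 1))) i \<in> {..N}" using \<omega>(3) rot_less[of i N] by (auto simp: PiE_iff)
  next
    fix i assume "i \<notin> {..<N}"
    then show "(f \<circ> rot N (j * (N - 1))) i = undefined"
      using \<omega>(3) by (auto simp: PiE_iff extensional_def rot_def)
  qed
  moreover have "(rot N j \<circ> \<sigma> \<circ> rot N (j * (N - 1))) i = i"
    if "i < N" "(f \<circ> rot N (j * (N - 1))) i = 0" for i
    using that \<omega>(4)[of "rot N (j * (N - 1)) i"] rot_less[of i N] rot_inverse'[OF N] by auto
  ultimately show ?thesis by (auto simp: terms_def \<omega>(1) rotate_term_def)
qed

text \<open>The power of u whose coefficient stands in row i and column \<open>\<sigma> i\<close>;
  adding N first keeps the natural subtraction exact.\<close>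

definition shift_index :: "nat \<Rightarrow> (nat \<Rightarrow> nat) \<Rightarrow> nat \<Rightarrow> nat" where
  "shift_index N \<sigma> i = (\<sigma> i + N - i) mod N"

definition support :: "nat \<Rightarrow> (nat \<Rightarrow> nat) \<Rightarrow> nat set" where
  "support N f = {i. i < N \<and> f i \<noteq> 0}"

text \<open>Counts the selected entries below the diagonal, each of which carries a factor 1 + T
  coming from \<open>u ^ N\<close>.\<close>

definition wraps :: "nat \<Rightarrow> (nat \<Rightarrow> nat) \<Rightarrow> nat" where
  "wraps N \<sigma> = card {i. i < N \<and> \<sigma> i < i}"

text \<open>Over a permutation the differences \<open>\<sigma> i - i\<close> cancel, so the shift
  indices add up to N for each wrap. Rotation alters which rows wrap but merely permutes the shift
  indices; hence the number of wraps is invariant.\<close>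

lemma wraps_eq:
  assumes "\<sigma> permutes {..<N}"
  shows "N * wraps N \<sigma> = (\<Sum>i<N. shift_index N \<sigma> i)"
proof -
  have *: "shift_index N \<sigma> i + i = \<sigma> i + (if \<sigma> i < i then N else 0)" if "i < N" for i
  proof -
    have "\<sigma> i < N" using that permutes_in_image[OF assms, of i] by simp
    then show ?thesis using that by (auto simp: shift_index_def mod_if)
  qed
  have "(\<Sum>i<N. shift_index N \<sigma> i) + (\<Sum>i<N. i) = (\<Sum>i<N. \<sigma> i) + (\<Sum>i<N. if \<sigma> i < i then N else 0)"
    unfolding sum.distrib[symmetric] by (intro sum.cong) (auto simp: *)
  also have "(\<Sum>i<N. \<sigma> i) = (\<Sum>i<N. i)"
    using sum.permute[OF assms, of id] by simp
  also have "(\<Sum>i<N. if \<sigma> i < i then N else 0) = N * wraps N \<sigma>"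
  proof -
    have "{..<N} \<inter> {i. \<sigma> i < i} = {i. i < N \<and> \<sigma> i < i}" by auto
    then show ?thesis by (simp add: sum.If_cases wraps_def)
  qed
  finally show ?thesis by simp
qed

lemma shift_index_rotate:
  assumes N: "N > 0" and \<sigma>: "\<sigma> permutes {..<N}" and i: "i < N"
  shows "shift_index N (rot N j \<circ> \<sigma> \<circ> rot N (j * (N - 1))) (rot N j i) = shift_index N \<sigma> i"
proof -
  have u: "x = y" if "x < N" "y < N" "[x + z = y + z] (mod N)" for x y z :: nat
    using that by (metis cong_add_rcancel_nat cong_less_modulus_unique_nat)
  have \<sigma>i: "\<sigma> i < N" using i permutes_in_image[OF \<sigma>, of i] by simp
  let ?i = "rot N j i"
  have l: "?i < N" by (rule rot_less[OF i])
  have 1: "[(rot N j (\<sigma> i) + N - ?i) mod N + ?i = \<sigma> i + j] (mod N)"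
  proof -
    have "[(rot N j (\<sigma> i) + N - ?i) mod N + ?i = (rot N j (\<sigma> i) + N - ?i) + ?i] (mod N)"
      by (simp add: cong_def mod_simps)
    also have "(rot N j (\<sigma> i) + N - ?i) + ?i = rot N j (\<sigma> i) + N" using l by simp
    also have "[rot N j (\<sigma> i) + N = \<sigma> i + j] (mod N)" using \<sigma>i by (simp add: rot_def cong_def)
    finally show ?thesis .
  qed
  have 2: "[(\<sigma> i + N - i) mod N + ?i = \<sigma> i + j] (mod N)"
  proof -
    have "[(\<sigma> i + N - i) mod N + ?i = (\<sigma> i + N - i) + (i + j)] (mod N)"
      using i by (simp add: cong_def rot_def mod_simps)
    also have "(\<sigma> i + N - i) + (i + j) = \<sigma> i + j + N" using i by simp
    also have "[\<sigma> i + j + N = \<sigma> i + j] (mod N)" by (simp add: cong_def)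
    finally show ?thesis .
  qed
  show ?thesis unfolding shift_index_def comp_apply rot_inverse'[OF N]
    by (rule u[of _ _ ?i]) (use N 1 2 in \<open>auto intro: cong_trans cong_sym\<close>)
qed

lemma wraps_rotate:
  assumes N: "N > 0" and \<sigma>: "\<sigma> permutes {..<N}"
  shows "wraps N (rot N j \<circ> \<sigma> \<circ> rot N (j * (N - 1))) = wraps N \<sigma>"
proof -
  let ?\<sigma> = "rot N j \<circ> \<sigma> \<circ> rot N (j * (N - 1))"
  have perm: "?\<sigma> permutes {..<N}" by (intro permutes_compose rot_permutes \<sigma>)
  have "N * wraps N ?\<sigma> = (\<Sum>i<N. shift_index N ?\<sigma> (rot N j i))"
    unfolding wraps_eq[OF perm] using sum.permute[OF rot_permutes, of "shift_index N ?\<sigma>" N j] by simp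
  also have "\<dots> = N * wraps N \<sigma>"
    unfolding wraps_eq[OF \<sigma>] by (intro sum.cong refl shift_index_rotate N \<sigma>) simp
  finally show ?thesis using N by simp
qed

lemma bij_betw_support_rotate:
  assumes N: "N > 0"
  shows "bij_betw (rot N j) (support N f) (support N (f \<circ> rot N (j * (N - 1))))"
  by (rule bij_betw_byWitness[where f' = "rot N (j * (N - 1))"])
    (auto simp: support_def rot_inverse'[OF N] rot_less simp del: One_nat_def)

text \<open>The Leibniz formula with every product of sums multiplied out. The choices left out of
  \<open>terms\<close> pick the summand of index 0 off the diagonal, where it is zero.\<close>

lemma sum_PiE_terms:
  fixes e :: "nat \<Rightarrow> nat \<Rightarrow> nat \<Rightarrow> 'a::comm_ring_1"
  assumes e0: "\<And>i j. i < N \<Longrightarrow> i \<noteq> j \<Longrightarrow> e i j 0 = 0"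
  shows "det (mat N N (\<lambda>(i, j). \<Sum>c\<le>N. e i j c)) = (\<Sum>(\<sigma>, f)\<in>terms N. of_int (sign \<sigma>) * (\<Prod>i<N. e i (\<sigma> i) (f i)))"
proof -
  let ?P = "{\<sigma>. \<sigma> permutes {..<N}}" and ?F = "\<Pi>\<^sub>E i\<in>{..<N}. {..N}"
  have "det (mat N N (\<lambda>(i, j). \<Sum>c\<le>N. e i j c)) =
      (\<Sum>\<sigma>\<in>?P. of_int (sign \<sigma>) * (\<Prod>i<N. \<Sum>c\<le>N. e i (\<sigma> i) c))"
  proof (subst det_def'[of _ N], simp, unfold atLeast0LessThan, intro sum.cong refl arg_cong2[where f = "(*)"] prod.cong)
    fix \<sigma> i assume "\<sigma> \<in> ?P" "i \<in> {..<N}"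
    then have "i < N" "\<sigma> i < N" using permutes_in_image[of \<sigma> "{..<N}" i] by auto
    then show "mat N N (\<lambda>(i, j). \<Sum>c\<le>N. e i j c) $$ (i, \<sigma> i) = (\<Sum>c\<le>N. e i (\<sigma> i) c)" by simp
  qed
  also have "\<dots> = (\<Sum>\<sigma>\<in>?P. \<Sum>f\<in>?F. of_int (sign \<sigma>) * (\<Prod>i<N. e i (\<sigma> i) (f i)))"
    by (subst prod_sum_PiE) (auto simp: sum_distrib_left)
  also have "\<dots> = (\<Sum>(\<sigma>, f)\<in>?P \<times> ?F. of_int (sign \<sigma>) * (\<Prod>i<N. e i (\<sigma> i) (f i)))"
    by (rule sum.cartesian_product)
  also have "\<dots> = (\<Sum>(\<sigma>, f)\<in>terms N. of_int (sign \<sigma>) * (\<Prod>i<N. e i (\<sigma> i) (f i)))"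
  proof (rule sum.mono_neutral_right)
    show "finite (?P \<times> ?F)" by (auto intro!: finite_PiE finite_permutations)
    show "terms N \<subseteq> ?P \<times> ?F" by (auto simp: terms_def)
    show "\<forall>\<omega>\<in>?P \<times> ?F - terms N. (case \<omega> of (\<sigma>, f) \<Rightarrow> of_int (sign \<sigma>) * (\<Prod>i<N. e i (\<sigma> i) (f i))) = 0"
    proof (safe, goal_cases)
      case (1 \<sigma> f)
      then obtain i where i: "i < N" "f i = 0" "\<sigma> i \<noteq> i" by (auto simp: terms_def)
      then have "e i (\<sigma> i) (f i) = 0" by (simp add: e0)
      then have "(\<Prod>i<N. e i (\<sigma> i) (f i)) = 0" using i(1) by (intro prod_zero) auto
      then show ?case by simp
    qed
  qed
  finally show ?thesis .
qed

text \<open>The part of a term that has coefficients in \<open>A\<close> and is unchanged by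
  rotation; the powers of conjugates of \<open>1 - \<theta>\<close> are kept apart from it.\<close>

definition term_coeff :: "nat \<Rightarrow> (nat \<Rightarrow> nat \<Rightarrow> 'k::comm_ring_1) \<Rightarrow> 'k \<Rightarrow> (nat \<Rightarrow> nat) \<times> (nat \<Rightarrow> nat) \<Rightarrow> 'k" where
  "term_coeff N a t0 = (\<lambda>(\<sigma>, f). of_int (sign \<sigma>) * t0 ^ wraps N \<sigma> *
     (\<Prod>i\<in>support N f. a (shift_index N \<sigma> i) (f i - 1)))"

lemma term_coeff_rotate:
  assumes N: "N > 0" and \<omega>: "\<omega> \<in> terms N"
  shows "term_coeff N a t0 (rotate_term N j \<omega>) = term_coeff N a t0 \<omega>"
proof -
  obtain \<sigma> f where \<omega>': "\<omega> = (\<sigma>, f)" "\<sigma> permutes {..<N}" using \<omega> by (auto simp: terms_def)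
  let ?\<sigma> = "rot N j \<circ> \<sigma> \<circ> rot N (j * (N - 1))" and ?f = "f \<circ> rot N (j * (N - 1))"
  have perm: "permutation \<sigma>" "permutation (rot N i)" for i
    using \<omega>'(2) rot_permutes by (auto simp: permutation_permutes)
  have "sign ?\<sigma> = sign (rot N j) * sign (rot N (j * (N - 1))) * sign \<sigma>"
    by (simp add: sign_compose perm permutation_compose)
  also have "sign (rot N j) * sign (rot N (j * (N - 1))) = sign (rot N j \<circ> rot N (j * (N - 1)))"
    by (simp add: sign_compose perm)
  also have "\<dots> = 1" unfolding rot_inverse[OF N] by simp
  finally have sg: "sign ?\<sigma> = sign \<sigma>" by (simp only: mult_1)
  have "(\<Prod>i\<in>support N ?f. a (shift_index N ?\<sigma> i) (?f i - 1)) =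
      (\<Prod>i\<in>support N f. a (shift_index N ?\<sigma> (rot N j i)) (?f (rot N j i) - 1))"
    by (rule prod.reindex_bij_betw[OF bij_betw_support_rotate[OF N], symmetric])
  also have "\<dots> = (\<Prod>i\<in>support N f. a (shift_index N \<sigma> i) (f i - 1))"
    by (intro prod.cong refl) (auto simp: support_def shift_index_rotate[OF N \<omega>'(2)] rot_inverse'[OF N] simp del: One_nat_def)
  finally show ?thesis
    unfolding \<omega>'(1) term_coeff_def rotate_term_def prod.case sg wraps_rotate[OF N \<omega>'(2)] by simp
qed

lemma term_coeff_in:
  assumes "is_subring S" "t0 \<in> S" "\<And>i l. i < N \<Longrightarrow> l < N \<Longrightarrow> a i l \<in> S" "\<omega> \<in> terms N"
  shows "term_coeff N a t0 \<omega> \<in> S"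
proof -
  obtain \<sigma> f where \<omega>: "\<omega> = (\<sigma>, f)" by (cases \<omega>)
  have "of_int (sign \<sigma>) \<in> S"
    by (cases \<sigma> rule: sign_cases) (auto intro: subring_intros assms(1))
  moreover have "a (shift_index N \<sigma> i) (f i - 1) \<in> S" if "i \<in> support N f" for i
  proof (rule assms(3))
    show "shift_index N \<sigma> i < N" using that by (simp add: shift_index_def support_def)
    have "f \<in> (\<Pi>\<^sub>E i\<in>{..<N}. {..N})" using assms(4) by (simp add: \<omega> terms_def)
    moreover have "i < N" "f i \<noteq> 0" using that by (auto simp: support_def)
    ultimately have "f i \<le> N" by (auto simp: PiE_iff)
    then show "f i - 1 < N" using \<open>f i \<noteq> 0\<close> by simp
  qed
  ultimately show ?thesis
    unfolding \<omega> term_coeff_def prod.case by (intro subring_intros assms(1,2))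
qed

section \<open>The trivial term and the terms supported on a single coset\<close>

definition trivial_term :: "nat \<Rightarrow> (nat \<Rightarrow> nat) \<times> (nat \<Rightarrow> nat)" where
  "trivial_term N = (id, \<lambda>i. if i < N then 0 else undefined)"

definition coset_shift :: "nat \<Rightarrow> nat \<Rightarrow> nat \<Rightarrow> nat \<Rightarrow> nat" where
  "coset_shift N K v i = (if i < N \<and> K dvd i then (i + K * v) mod N else i)"

text \<open>Up to rotation, the terms with m = 1: invariant under rotation by K, with row 0 as the
  only row of the support among the first K.\<close>

definition coset_term :: "nat \<Rightarrow> nat \<Rightarrow> nat \<Rightarrow> nat \<Rightarrow> (nat \<Rightarrow> nat) \<times> (nat \<Rightarrow> nat)" where
  "coset_term N K v l =
     (coset_shift N K v,
      \<lambda>i. if i < N then if K dvd i then Suc l else 0 else undefined)"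

lemma trivial_term_in: "trivial_term N \<in> terms N"
  by (auto simp: trivial_term_def terms_def permutes_id PiE_iff extensional_def)

lemma trivial_term_eqI:
  assumes "(\<sigma>, f) \<in> terms N" "support N f = {}"
  shows "(\<sigma>, f) = trivial_term N"
proof -
  have *: "f i = 0 \<and> \<sigma> i = i" if "i < N" for i using assms that by (auto simp: terms_def support_def)
  have "\<sigma> x = x" for x
    using assms(1) * unfolding terms_def permutes_def by (cases "x < N") auto
  then have "\<sigma> = id" by (simp add: fun_eq_iff)
  moreover have "f = (\<lambda>i. if i < N then 0 else undefined)"
    using assms * by (auto simp: terms_def fun_eq_iff PiE_iff extensional_def)
  ultimately show ?thesis by (simp add: trivial_term_def)
qed

lemma coset_shift_power:
  assumes "K dvd N"
  shows "(coset_shift N K v ^^ m) i =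
    (if i < N \<and> K dvd i then (i + m * (K * v)) mod N else i)"
  using assms by (induction m) (auto simp: coset_shift_def mod_simps dvd_mod_iff algebra_simps)

lemma coset_shift_permutes:
  assumes "K dvd N"
  shows "coset_shift N K v permutes {..<N}" (is "?\<sigma> permutes _")
proof (rule bij_imp_permutes)
  have N: "?\<sigma> ((?\<sigma> ^^ (N - 1)) i) = i" "(?\<sigma> ^^ (N - 1)) (?\<sigma> i) = i" if "i < N" for i
  proof -
    have "(?\<sigma> ^^ N) i = i" unfolding coset_shift_power[OF assms] using that by auto
    moreover have "N = Suc (N - 1)" using that by simp
    ultimately show "?\<sigma> ((?\<sigma> ^^ (N - 1)) i) = i" "(?\<sigma> ^^ (N - 1)) (?\<sigma> i) = i"
      by (metis funpow.simps(2) comp_apply, metis funpow_Suc_right comp_apply)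
  qed
  show "bij_betw ?\<sigma> {..<N} {..<N}"
    by (rule bij_betw_byWitness[where f' = "?\<sigma> ^^ (N - 1)"])
      (use N in \<open>auto simp: coset_shift_power[OF assms] coset_shift_def simp del: One_nat_def\<close>)
qed (auto simp: coset_shift_def)

lemma coset_term_in:
  assumes "K dvd N" "l < N" shows "coset_term N K v l \<in> terms N"
  using coset_shift_permutes[OF assms(1)] assms(2) by (auto simp: coset_term_def terms_def PiE_iff extensional_def coset_shift_def)

text \<open>The N-th power of the shift is the identity and N is odd, which excludes the sign
  -1.\<close>

lemma sign_coset_shift:
  assumes "K dvd N" "odd N"
  shows "sign (coset_shift N K v) = 1" (is "sign ?\<sigma> = 1")
proof -
  have perm: "permutation ?\<sigma>"
    using coset_shift_permutes[OF assms(1)] permutation_permutes by blast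
  have "permutation (?\<sigma> ^^ m) \<and> sign (?\<sigma> ^^ m) = sign ?\<sigma> ^ m" for m
    by (induction m) (simp_all add: sign_compose perm permutation_compose del: o_apply)
  then have "sign (?\<sigma> ^^ N) = sign ?\<sigma> ^ N" by blast
  moreover have "?\<sigma> ^^ N = id"
    unfolding fun_eq_iff coset_shift_power[OF assms(1)] by auto
  ultimately have "sign ?\<sigma> ^ N = 1" by simp
  then show ?thesis using assms(2) by (cases ?\<sigma> rule: sign_cases) (auto simp del: One_nat_def)
qed

lemma multiples_image:
  fixes K M :: nat assumes "K > 0"
  shows "{i. i < K * M \<and> K dvd i} = (\<lambda>m. K * m) ` {..<M}" "inj_on (\<lambda>m. K * m) {..<M}"
  using assms by (auto elim!: dvdE intro!: inj_onI)

lemma support_coset: "support N (snd (coset_term N K v l)) = {i. i < N \<and> K dvd i}"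
  by (auto simp: support_def coset_term_def)

lemma support_rotate:
  assumes "N > 0" shows "support N (snd (rotate_term N j \<omega>)) = rot N j ` support N (snd \<omega>)"
  using bij_betw_support_rotate[OF assms, of j "snd \<omega>"]
  by (cases \<omega>) (simp add: rotate_term_def bij_betw_def)

lemma card_support_rotate:
  assumes "N > 0" shows "card (support N (snd (rotate_term N j \<omega>))) = card (support N (snd \<omega>))"
  using bij_betw_same_card[OF bij_betw_support_rotate[OF assms, of j "snd \<omega>"]]
  by (cases \<omega>) (simp add: rotate_term_def)

lemma card_support_coset:
  assumes "K > 0" "N = K * M" shows "card (support N (snd (coset_term N K v l))) = M"
  unfolding support_coset assms(2) using multiples_image[OF assms(1), of M] by (simp add: card_image)

text \<open>The support has M rows, each with shift index \<open>K * v\<close>. These add up to N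
  times v, so there are v wraps, and they produce \<open>t0 ^ v\<close>.\<close>

lemma term_coeff_coset:
  assumes K: "K > 0" and N: "N = K * M" and odd: "odd N" and v: "v < M" and l: "l < N"
  shows "term_coeff N a t0 (coset_term N K v l) = t0 ^ v * a (K * v) l ^ M"
proof -
  let ?\<sigma> = "coset_shift N K v"
  have KN: "K dvd N" by (simp add: N)
  have N0: "N > 0" using odd by (cases N) auto
  have Kv: "K * v < N" using v K N by simp
  have sh: "shift_index N ?\<sigma> i = (if K dvd i then K * v else 0)" if i: "i < N" for i
    using i Kv by (auto simp: shift_index_def coset_shift_def mod_if)
  have card: "card {i. i < N \<and> K dvd i} = M"
    using multiples_image[OF K, of M] by (simp add: card_image N)
  have "N * wraps N ?\<sigma> = (\<Sum>i<N. if K dvd i then K * v else 0)"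
    unfolding wraps_eq[OF coset_shift_permutes[OF KN]] by (intro sum.cong) (auto simp: sh)
  also have "\<dots> = N * v"
  proof -
    have "{..<N} \<inter> {i. K dvd i} = {i. i < N \<and> K dvd i}" by auto
    then have "(\<Sum>i<N. if K dvd i then K * v else 0) = card {i. i < N \<and> K dvd i} * (K * v)"
      by (simp add: sum.If_cases)
    then show ?thesis unfolding card by (simp add: N)
  qed
  finally have wr: "wraps N ?\<sigma> = v" using N0 by simp
  have "(\<Prod>i\<in>{i. i < N \<and> K dvd i}. a (shift_index N ?\<sigma> i) ((if i < N then if K dvd i then Suc l else 0 else undefined) - 1)) =
     (\<Prod>i\<in>{i. i < N \<and> K dvd i}. a (K * v) l)"
    by (intro prod.cong refl) (auto simp: sh)
  also have "\<dots> = a (K * v) l ^ M" by (simp add: card)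
  finally show ?thesis
    unfolding term_coeff_def using support_coset[of N K v l]
    by (simp add: coset_term_def sign_coset_shift[OF KN odd] wr)
qed

lemma rotate_coset_fixed:
  assumes "K dvd N" "N > 0"
  shows "rotate_term N K (coset_term N K v l) = coset_term N K v l"
proof -
  have d: "K dvd rot N (K * (N - 1)) i \<longleftrightarrow> K dvd i" "rot N (K * (N - 1)) i < N \<longleftrightarrow> i < N" for i
    using assms by (auto simp: rot_def dvd_mod_iff dvd_add_left_iff simp del: One_nat_def)
  have "rot N K ((rot N (K * (N - 1)) i + K * v) mod N) = (i + K * v) mod N" if "i < N" for i
  proof -
    have "rot N K ((rot N (K * (N - 1)) i + K * v) mod N) = (i + (K * (N - 1) + K) + K * v) mod N"
      using that assms(2) by (simp add: rot_def mod_simps ac_simps)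
    also have "\<dots> = (i + K * v) mod N"
      unfolding mult_pred_add_self[OF assms(2)] by (metis add.commute add.left_commute mod_mult_self2)
    finally show ?thesis .
  qed
  then show ?thesis
    unfolding coset_term_def rotate_term_def
    by (auto simp: fun_eq_iff coset_shift_def d rot_inverse'[OF assms(2)] simp del: One_nat_def)
qed

text \<open>The support of the rotated term is the residue class of i modulo K, which recovers i;
  once the rotation is undone, the values at row 0 recover v and l.\<close>

lemma rotate_coset_inj:
  assumes K: "K > 0" "K dvd N" and N: "N > 0"
    and o: "i < K" "i' < K" and v: "K * v < N" "K * v' < N"
    and eq: "rotate_term N i (coset_term N K v l) = rotate_term N i' (coset_term N K v' l')"
  shows "i = i' \<and> v = v' \<and> l = l'"
proof -
  interpret cyclic_action "rotate_term N" N by (rule cyclic_action_rotate[OF N])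
  have KN: "K \<le> N" using K N by (simp add: dvd_imp_le)
  have S: "support N (snd (rotate_term N i (coset_term N K v l))) = {x. x < N \<and> [x = i] (mod K)}" for i v l
    unfolding support_rotate[OF N] support_coset
  proof (intro equalityI subsetI)
    fix x assume "x \<in> rot N i ` {i. i < N \<and> K dvd i}"
    then show "x \<in> {x. x < N \<and> [x = i] (mod K)}"
      using K N by (auto simp: rot_def cong_def mod_mod_cancel elim!: dvdE)
  next
    fix x assume x: "x \<in> {x. x < N \<and> [x = i] (mod K)}"
    have "x = rot N i (rot N (i * (N - 1)) x)" using rot_inverse'[OF N] by simp
    moreover have "K dvd rot N (i * (N - 1)) x"
    proof -
      have "[x + i * (N - 1) = i + i * (N - 1)] (mod K)" using x by (intro cong_add cong_refl) simp
      also have "i + i * (N - 1) = N * i" using mult_pred_add_self[OF N, of i] by simp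
      also have "[N * i = 0] (mod K)" using K by (simp add: cong_0_iff)
      finally show ?thesis using x K by (simp add: rot_def dvd_mod_iff cong_0_iff)
    qed
    ultimately show "x \<in> rot N i ` {i. i < N \<and> K dvd i}" using rot_less[of x N] x by blast
  qed
  have "i \<in> {x. x < N \<and> [x = i'] (mod K)}"
    using S[of i v l] S[of i' v' l'] eq o KN by auto
  then have i: "i = i'" using o by (simp add: cong_def)
  then have "coset_term N K v l = coset_term N K v' l'" using eq act_inj by blast
  then have "fst (coset_term N K v l) 0 = fst (coset_term N K v' l') 0" "snd (coset_term N K v l) 0 = snd (coset_term N K v' l') 0"
    by simp_all
  then show ?thesis using i N v K by (simp add: coset_term_def coset_shift_def)
qed

text \<open>After row i is rotated to row 0, the support is the set of multiples of K. All other
  rows are fixed points, and commutation with the rotation by K determines the permutation from its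
  value at 0, so that nothing but v and l remains free.\<close>

lemma coset_termI:
  assumes N: "N > 0" and K: "K > 0" "N = K * M" and \<omega>: "(\<sigma>, f) \<in> terms N"
    and fixed: "rotate_term N K (\<sigma>, f) = (\<sigma>, f)"
    and supp: "support N f \<inter> {..<K} = {i}"
  shows "\<exists>v<M. \<exists>l<N. (\<sigma>, f) = rotate_term N i (coset_term N K v l)"
proof -
  interpret cyclic_action "rotate_term N" N by (rule cyclic_action_rotate[OF N])
  have KN: "K dvd N" using K by simp
  then have KN': "K \<le> N" using N by (rule dvd_imp_le)
  have M: "M > 0" using K N by (cases M) auto
  have "i \<in> support N f \<inter> {..<K}" by (simp add: supp)
  then have i: "i < N" "f i \<noteq> 0" "i < K" by (simp_all add: support_def)
  have uniq: "x = i" if "x < N" "x < K" "f x \<noteq> 0" for x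
  proof -
    have "x \<in> support N f \<inter> {..<K}" using that by (simp add: support_def)
    then show ?thesis unfolding supp by simp
  qed
  obtain \<tau> h where \<tau>: "rotate_term N (i * (N - 1)) (\<sigma>, f) = (\<tau>, h)" by fastforce
  have eq: "rotate_term N i (\<tau>, h) = (\<sigma>, f)"
    using mult_pred_add_self[OF N, of i] act_mult_fixed[OF act_period, of i]
    unfolding \<tau>[symmetric] act_act by (simp only: add.commute)
  have \<tau>t: "(\<tau>, h) \<in> terms N" unfolding \<tau>[symmetric] by (rule rotate_terms[OF \<omega> N])
  have fixK: "rotate_term N K (\<tau>, h) = (\<tau>, h)"
  proof -
    have "rotate_term N i (rotate_term N K (\<tau>, h)) = rotate_term N K (rotate_term N i (\<tau>, h))"
      by (simp only: act_act add.commute)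
    also have "\<dots> = rotate_term N i (\<tau>, h)" by (simp only: eq fixed)
    finally show ?thesis using act_inj by blast
  qed
  have fix': "\<tau> (rot N (K * m) x) = rot N (K * m) (\<tau> x) \<and> h (rot N (K * m) x) = h x" for m x
  proof -
    have e: "rotate_term N (K * m) (\<tau>, h) = (\<tau>, h)" by (rule act_mult_fixed[OF fixK])
    then have h: "h \<circ> rot N (K * m * (N - 1)) = h"
      and t: "rot N (K * m) \<circ> \<tau> \<circ> rot N (K * m * (N - 1)) = \<tau>" by (simp_all add: rotate_term_def)
    show ?thesis using fun_cong[OF h, of "rot N (K * m) x"] fun_cong[OF t, of "rot N (K * m) x"]
      by (simp only: comp_apply rot_inverse'[OF N])
  qed
  have fi: "f i = h 0"
  proof -
    have "f = h \<circ> rot N (i * (N - 1))" using eq by (simp add: rotate_term_def)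
    then have "f i = h ((i + i * (N - 1)) mod N)" using i by (simp add: rot_def)
    moreover have "i + i * (N - 1) = N * i" using mult_pred_add_self[OF N, of i] by simp
    ultimately show ?thesis by simp
  qed
  have h0: "h 0 \<noteq> 0" using fi i by simp
  have hx: "h x = (if K dvd x then h 0 else 0)" if x: "x < N" for x
  proof (cases "K dvd x")
    case True
    then obtain m where m: "x = K * m" by blast
    have "rot N (K * m) 0 = x" using N x by (simp add: rot_def m)
    then show ?thesis using fix'[of m 0] True by simp
  next
    case False
    show ?thesis
    proof (rule ccontr)
      assume "h x \<noteq> (if K dvd x then h 0 else 0)"
      then have hx: "h x \<noteq> 0" using False by simp
      let ?y = "rot N i x"
      have y: "?y < N" by (rule rot_less[OF x])
      have fy: "f ?y = h x"
        using arg_cong[OF eq, of "\<lambda>\<omega>. snd \<omega> ?y"] by (simp add: rotate_term_def rot_inverse'[OF N] del: One_nat_def)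
      have fixf: "f (rot N (K * m) z) = f z" for m z
      proof -
        have "rotate_term N (K * m) (\<sigma>, f) = (\<sigma>, f)" by (rule act_mult_fixed[OF fixed])
        then have h: "f \<circ> rot N (K * m * (N - 1)) = f" by (simp add: rotate_term_def)
        show ?thesis using fun_cong[OF h, of "rot N (K * m) z"] by (simp only: comp_apply rot_inverse'[OF N])
      qed
      have "rot N (K * (?y div K)) (?y mod K) = ?y" 
        using y mod_less_divisor[OF K(1), of ?y] KN' unfolding rot_def[of N "K * _"] by simp
      then have "f (?y mod K) \<noteq> 0" using fixf[of "?y div K" "?y mod K"] fy hx by simp
      moreover have "?y mod K < K" "?y mod K < N"
        using mod_less_divisor[OF K(1), of ?y] KN' by simp_all
      ultimately have "?y mod K = i" using uniq by blast
      then have "[i + x = i + 0] (mod K)"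
        using x i by (simp add: rot_def cong_def mod_mod_cancel[OF KN] add.commute)
      then have "[x = 0] (mod K)" by (simp only: cong_add_lcancel_nat)
      then show False using False by (simp add: cong_0_iff)
    qed
  qed
  have perm: "\<tau> permutes {..<N}" using \<tau>t by (simp add: terms_def)
  have \<tau>id: "\<tau> x = x" if "x < N" "\<not> K dvd x" for x
    using that \<tau>t hx[of x] by (auto simp: terms_def)
  have \<tau>0: "\<tau> 0 < N" using permutes_in_image[OF perm, of 0] N by simp
  \<comment> \<open>Otherwise \<open>\<tau> 0\<close> would be a fixed point of \<tau>, and
    injectivity would force \<open>\<tau> 0 = 0\<close>, which is a multiple of K.\<close>
  have "K dvd \<tau> 0"
  proof (rule ccontr)
    assume n: "\<not> K dvd \<tau> 0"
    then have "\<tau> (\<tau> 0) = \<tau> 0" using \<tau>id \<tau>0 by simp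
    then have "\<tau> 0 = 0" using permutes_inj[OF perm] by (metis injD)
    then show False using n by simp
  qed
  then obtain v where v: "\<tau> 0 = K * v" by blast
  have vM: "v < M" using \<tau>0 v K by simp
  have \<tau>x: "\<tau> x = (x + K * v) mod N" if x: "x < N" "K dvd x" for x
  proof -
    obtain m where m: "x = K * m" using x by blast
    have "rot N (K * m) 0 = x" using N x by (simp add: rot_def m)
    then have "\<tau> x = rot N (K * m) (K * v)" using fix'[of m 0] v by simp
    then show ?thesis using \<tau>0 v m by (simp add: rot_def add.commute)
  qed
  have "\<tau> = fst (coset_term N K v (h 0 - 1))"
    using \<tau>x \<tau>id perm by (auto simp: coset_term_def coset_shift_def fun_eq_iff permutes_def)
  moreover have "h = snd (coset_term N K v (h 0 - 1))"
  proof
    fix x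
    have "h \<in> (\<Pi>\<^sub>E i\<in>{..<N}. {..N})" using \<tau>t by (simp add: terms_def)
    then have "h x = undefined" if "\<not> x < N" using that by (simp add: PiE_iff extensional_def)
    then show "h x = snd (coset_term N K v (h 0 - 1)) x"
      using hx[of x] h0 by (auto simp: coset_term_def)
  qed
  ultimately have "(\<tau>, h) = coset_term N K v (h 0 - 1)" by (metis prod.collapse)
  moreover have "h 0 - 1 < N"
  proof -
    have "h 0 \<le> N" using \<tau>t N by (auto simp: terms_def PiE_iff)
    then show ?thesis using h0 N by simp
  qed
  ultimately show ?thesis using eq vM by metis
qed

lemma double_sum_scale:
  "(\<Sum>v\<in>V. x v * (\<Sum>l\<in>L. b v l * (q * w l))) = q * (\<Sum>v\<in>V. x v * (\<Sum>l\<in>L. b v l * w l))"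
  for q :: "'a::comm_ring_1"
  by (simp add: sum_distrib_left mult_ac)

lemma double_sum_add:
  "(\<Sum>v\<in>V. x v * (\<Sum>l\<in>L. b v l * (w l + q * z l))) =
    (\<Sum>v\<in>V. x v * (\<Sum>l\<in>L. b v l * w l)) + q * (\<Sum>v\<in>V. x v * (\<Sum>l\<in>L. b v l * z l))"
  for q :: "'a::comm_ring_1"
  unfolding distrib_left sum.distrib double_sum_scale ..

section \<open>The determinant as a sum over orbits\<close>

context cyclotomic_tower
begin

text \<open>Right multiplication by d in a basis of row vectors v_i with eigenvalues
  \<open>\<theta> ^ (G ^ i)\<close> and v_i u = v_(i+1): column j receives the coefficient of the
  power j - i of u, and passing \<open>u ^ N\<close> gives the factor \<open>t0\<close> below the
  diagonal.\<close>

definition norm_matrix :: "nat \<Rightarrow> (nat \<Rightarrow> nat \<Rightarrow> 'k) \<Rightarrow> 'k \<Rightarrow> 'k mat" where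
  "norm_matrix n a t0 = mat (p ^ s) (p ^ s) (\<lambda>(i, j). (if i = j then 1 else 0) +
     (1 - \<theta> ^ (G ^ i)) ^ n * (\<Sum>l<p ^ s. a ((j + p ^ s - i) mod p ^ s) l * (1 - \<theta> ^ (G ^ i)) ^ l) *
       (if j < i then t0 else 1))"

definition conj_prod :: "nat \<Rightarrow> (nat \<Rightarrow> nat) \<Rightarrow> nat \<Rightarrow> 'k" where
  "conj_prod n f j = (\<Prod>i\<in>support (p ^ s) f. (1 - \<theta> ^ (G ^ (i + j))) ^ (n + (f i - 1)))"

lemma det_norm_matrix:
  "det (norm_matrix n a t0) = (\<Sum>\<omega>\<in>terms (p ^ s). term_coeff (p ^ s) a t0 \<omega> * conj_prod n (snd \<omega>) 0)"
proof -
  define N where "N = p ^ s"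
  define e where "e i j c = (case c of 0 \<Rightarrow> if i = j then 1 else 0
      | Suc l \<Rightarrow> a ((j + N - i) mod N) l * (1 - \<theta> ^ (G ^ i)) ^ (n + l) * (if j < i then t0 else 1))"
    for i j c :: nat
  have "norm_matrix n a t0 = mat N N (\<lambda>(i, j). \<Sum>c\<le>N. e i j c)"
    unfolding norm_matrix_def N_def[symmetric]
  proof (intro cong_mat refl, clarify)
    fix i j assume "i < N" "j < N"
    have "(\<Sum>c\<le>N. e i j c) = e i j 0 + (\<Sum>l<N. e i j (Suc l))"
      by (simp only: lessThan_Suc_atMost[symmetric] sum.lessThan_Suc_shift)
    also have "(\<Sum>l<N. e i j (Suc l)) = (1 - \<theta> ^ (G ^ i)) ^ n *
        (\<Sum>l<N. a ((j + N - i) mod N) l * (1 - \<theta> ^ (G ^ i)) ^ l) * (if j < i then t0 else 1)"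
      unfolding sum_distrib_left sum_distrib_right
      by (intro sum.cong refl) (simp add: e_def power_add)
    finally show "(if i = j then 1 else 0) + (1 - \<theta> ^ (G ^ i)) ^ n *
        (\<Sum>l<N. a ((j + N - i) mod N) l * (1 - \<theta> ^ (G ^ i)) ^ l) * (if j < i then t0 else 1) =
        (\<Sum>c\<le>N. e i j c)" by (simp add: e_def)
  qed
  then have "det (norm_matrix n a t0) = (\<Sum>(\<sigma>, f)\<in>terms N. of_int (sign \<sigma>) * (\<Prod>i<N. e i (\<sigma> i) (f i)))"
    by (simp only:) (rule sum_PiE_terms, simp add: e_def)
  also have "\<dots> = (\<Sum>\<omega>\<in>terms N. term_coeff N a t0 \<omega> * conj_prod n (snd \<omega>) 0)"
  proof (intro sum.cong refl)
    fix \<omega> assume "\<omega> \<in> terms N"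
    then obtain \<sigma> f where \<omega>: "\<omega> = (\<sigma>, f)" "\<And>i. i < N \<Longrightarrow> f i = 0 \<Longrightarrow> \<sigma> i = i" by (auto simp: terms_def)
    have "(\<Prod>i<N. e i (\<sigma> i) (f i)) = (\<Prod>i\<in>support N f. e i (\<sigma> i) (f i))"
      by (rule prod.mono_neutral_right) (auto simp: support_def \<omega> e_def)
    also have "\<dots> = (\<Prod>i\<in>support N f. a (shift_index N \<sigma> i) (f i - 1) *
        (1 - \<theta> ^ (G ^ i)) ^ (n + (f i - 1)) * (if \<sigma> i < i then t0 else 1))"
      by (intro prod.cong refl) (auto simp: support_def e_def shift_index_def split: nat.splits)
    also have "\<dots> = (\<Prod>i\<in>support N f. a (shift_index N \<sigma> i) (f i - 1)) * conj_prod n f 0 *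
        (\<Prod>i\<in>support N f. if \<sigma> i < i then t0 else 1)"
      by (simp add: prod.distrib conj_prod_def N_def)
    \<comment> \<open>Rows that wrap lie in the support, since the choice 0 forces
      \<open>\<sigma> i = i\<close>.\<close>
    also have "(\<Prod>i\<in>support N f. if \<sigma> i < i then t0 else 1) = t0 ^ wraps N \<sigma>"
    proof -
      have "support N f \<inter> {i. \<sigma> i < i} = {i. i < N \<and> \<sigma> i < i}"
        using \<omega>(2) by (force simp: support_def)
      moreover have "finite (support N f)" by (simp add: support_def)
      ultimately show ?thesis by (simp add: prod.If_cases wraps_def)
    qed
    finally show "(case \<omega> of (\<sigma>, f) \<Rightarrow> of_int (sign \<sigma>) * (\<Prod>i<N. e i (\<sigma> i) (f i))) =
        term_coeff N a t0 \<omega> * conj_prod n (snd \<omega>) 0"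
      by (simp add: \<omega>(1) term_coeff_def mult_ac)
  qed
  finally show ?thesis by (simp add: N_def)
qed

lemma conjugate_cong: "[i = j] (mod p ^ s) \<Longrightarrow> \<theta> ^ (G ^ i) = \<theta> ^ (G ^ j)"
  by (rule \<theta>_power_cong) (simp only: G_def one_plus_power_cong_iff[OF prime_p odd_p r_ge_1])

text \<open>Rotating a term by j has the effect of applying the j-th power of the Galois generator
  to its value.\<close>

lemma conj_prod_rotate:
  "conj_prod n (snd (rotate_term (p ^ s) j \<omega>)) 0 = conj_prod n (snd \<omega>) j"
proof -
  obtain \<sigma> f where \<omega>: "\<omega> = (\<sigma>, f)" by (cases \<omega>)
  let ?N = "p ^ s" let ?f = "f \<circ> rot ?N (j * (?N - 1))"
  have "conj_prod n ?f 0 = (\<Prod>i\<in>support ?N f. (1 - \<theta> ^ (G ^ (rot ?N j i))) ^ (n + (?f (rot ?N j i) - 1)))"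
    unfolding conj_prod_def add_0_right
    by (rule prod.reindex_bij_betw[OF bij_betw_support_rotate[OF ppow_gt_0], symmetric])
  also have "\<dots> = conj_prod n f j"
    unfolding conj_prod_def
  proof (intro prod.cong refl)
    fix i assume "i \<in> support ?N f"
    then have "\<theta> ^ (G ^ (rot ?N j i)) = \<theta> ^ (G ^ (i + j))"
      by (intro conjugate_cong) (simp add: rot_def support_def)
    moreover have "?f (rot ?N j i) = f i" using rot_inverse'[of ?N j i] by simp
    ultimately show "(1 - \<theta> ^ (G ^ (rot ?N j i))) ^ (n + (?f (rot ?N j i) - 1)) =
        (1 - \<theta> ^ (G ^ (i + j))) ^ (n + (f i - 1))" by simp
  qed
  finally show ?thesis by (simp add: \<omega> rotate_term_def)
qed

text \<open>A term fixed by rotation by \<open>p ^ k\<close> has support and choices periodic modulo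
  \<open>p ^ k\<close>. Each residue class then contributes a power of a norm from layer r + s to
  layer r + k.\<close>

lemma conj_prod_fixed:
  assumes k: "k \<le> s" and fixed: "rotate_term (p ^ s) (p ^ k) \<omega> = \<omega>"
  shows "conj_prod n (snd \<omega>) j =
    (\<Prod>i\<in>support (p ^ s) (snd \<omega>) \<inter> {..<p ^ k}. (1 - xi k (i + j)) ^ (n + (snd \<omega> i - 1)))"
proof -
  interpret cyclic_action "rotate_term (p ^ s)" "p ^ s" by (rule cyclic_action_rotate[OF ppow_gt_0])
  obtain \<sigma> f where \<omega>: "\<omega> = (\<sigma>, f)" by (cases \<omega>)
  let ?N = "p ^ s" and ?K = "p ^ k" and ?M = "p ^ (s - k)"
  have N: "?N = ?K * ?M" using k by (simp flip: power_add)
  have per: "f (i + ?K * m) = f i" if "i < ?K" "m < ?M" for i m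
  proof -
    have "rotate_term ?N (?K * m) \<omega> = \<omega>" by (rule act_mult_fixed[OF fixed])
    then have h: "f \<circ> rot ?N (?K * m * (?N - 1)) = f" by (simp add: \<omega> rotate_term_def)
    have "f (rot ?N (?K * m) i) = f i"
      using fun_cong[OF h, of "rot ?N (?K * m) i"] rot_inverse'[of ?N] by simp
    moreover have l: "i + ?K * m < ?N"
    proof -
      have "i + ?K * m < ?K * Suc m" using that by simp
      also have "\<dots> \<le> ?K * ?M" using that by (intro mult_left_mono) auto
      finally show ?thesis by (simp only: N)
    qed
    ultimately show ?thesis by (simp add: rot_def)
  qed
  let ?S0 = "support ?N f \<inter> {..<?K}"
  have bij: "bij_betw (\<lambda>(i, m). i + ?K * m) (?S0 \<times> {..<?M}) (support ?N f)"
  proof (rule bij_betw_byWitness[where f' = "\<lambda>x. (x mod ?K, x div ?K)"])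
    show "\<forall>x\<in>?S0 \<times> {..<?M}. (\<lambda>x. (x mod ?K, x div ?K)) ((\<lambda>(i, m). i + ?K * m) x) = x" by auto
    show "\<forall>x\<in>support ?N f. (\<lambda>(i, m). i + ?K * m) (x mod ?K, x div ?K) = x" by simp
    show "(\<lambda>(i, m). i + ?K * m) ` (?S0 \<times> {..<?M}) \<subseteq> support ?N f"
    proof safe
      fix i m assume i: "i \<in> support ?N f" "i < ?K" and m: "m < ?M"
      have "i + ?K * m < ?K * Suc m" using i by simp
      also have "\<dots> \<le> ?K * ?M" using m by (intro mult_left_mono) auto
      finally have "i + ?K * m < ?N" by (simp only: N)
      then show "i + ?K * m \<in> support ?N f" using i per[OF i(2) m] by (simp add: support_def)
    qed
    show "(\<lambda>x. (x mod ?K, x div ?K)) ` support ?N f \<subseteq> ?S0 \<times> {..<?M}"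
    proof (rule image_subsetI)
      fix x assume x: "x \<in> support ?N f"
      have m: "x mod ?K < ?K" by simp
      have d: "x div ?K < ?M" using x N by (simp add: support_def div_less_iff_less_mult mult.commute)
      have "f (x mod ?K) = f x" using per[OF m d] by simp
      moreover have "x mod ?K < ?N" using x by (auto simp: support_def intro: le_less_trans[OF mod_less_eq_dividend])
      ultimately have "x mod ?K \<in> support ?N f" using x by (simp add: support_def)
      then show "(x mod ?K, x div ?K) \<in> ?S0 \<times> {..<?M}" using m d by simp
    qed
  qed
  have "conj_prod n f j = (\<Prod>(i, m)\<in>?S0 \<times> {..<?M}. (1 - \<theta> ^ (G ^ (i + ?K * m + j))) ^ (n + (f (i + ?K * m) - 1)))"
    unfolding conj_prod_def prod.reindex_bij_betw[OF bij, symmetric] by (intro prod.cong) auto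
  also have "\<dots> = (\<Prod>i\<in>?S0. \<Prod>m<?M. (1 - \<theta> ^ (G ^ (i + ?K * m + j))) ^ (n + (f (i + ?K * m) - 1)))"
    by (rule prod.cartesian_product[symmetric])
  also have "\<dots> = (\<Prod>i\<in>?S0. (\<Prod>m<?M. 1 - \<theta> ^ (G ^ (i + j + ?K * m))) ^ (n + (f i - 1)))"
    unfolding prod_power_distrib
    by (intro prod.cong refl) (simp only: per Int_iff lessThan_iff add.assoc add.commute[of j])
  finally show ?thesis by (simp add: \<omega> prod_one_minus_conjugates[OF k])
qed

lemma xi_add: "xi k (i + j) = xi k j ^ (G ^ i)"
  by (simp add: xi_def power_mult[symmetric] power_add mult_ac)

text \<open>With m the number of support rows below \<open>p ^ k\<close>, the value of the term is a
  polynomial in \<open>xi k j\<close> with at least m n factors \<open>1 - xi k j\<close>; summing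
  over the orbit takes its trace.\<close>

lemma orbit_sum:
  assumes k: "k \<le> s" and fixed: "rotate_term (p ^ s) (p ^ k) \<omega> = \<omega>"
    and \<omega>: "\<omega> \<in> terms (p ^ s)"
    and t0: "t0 \<in> A" and a: "\<And>i l. i < p ^ s \<Longrightarrow> l < p ^ s \<Longrightarrow> a i l \<in> A"
    and q: "p ^ k * q \<le> card (support (p ^ s) (snd \<omega>) \<inter> {..<p ^ k}) * n"
  shows "\<exists>z\<in>A. (\<Sum>j<p ^ k. term_coeff (p ^ s) a t0 (rotate_term (p ^ s) j \<omega>) *
      conj_prod n (snd (rotate_term (p ^ s) j \<omega>)) 0) = of_nat (p ^ k) * \<pi> ^ q * z"
proof -
  note SP = subring_polys_over[OF subring_A]
  define f where "f = snd \<omega>"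
  define S0 where "S0 = support (p ^ s) f \<inter> {..<p ^ k}"
  have fin: "finite S0" by (simp add: S0_def)
  define M where "M = (\<Sum>i\<in>S0. n + (f i - 1))"
  have "card S0 * n \<le> M" unfolding M_def using sum_bounded_below[of S0 n "\<lambda>i. n + (f i - 1)"] by simp
  with q have q': "p ^ k * q \<le> M" by (simp add: S0_def f_def)
  \<comment> \<open>The quotients of \<open>1 - xi k j ^ (G ^ i)\<close> by
    \<open>1 - xi k j\<close>, written as geometric sums.\<close>
  define h where "h = (\<Prod>i\<in>S0. (\<Sum>m<G ^ i. monom 1 m) ^ (n + (f i - 1)) :: 'k poly)"
  have h: "h \<in> polys_over A"
    unfolding h_def by (intro SP subring_intros polys_over_monom subring_A)
  obtain z where z: "z \<in> A" "(\<Sum>j<p ^ k. (1 - xi k j) ^ M * poly h (xi k j)) = of_nat (p ^ k) * \<pi> ^ q * z"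
    using trace_in_power[OF k h q'] by blast
  have cp: "conj_prod n f j = (1 - xi k j) ^ M * poly h (xi k j)" for j
  proof -
    have "conj_prod n f j = (\<Prod>i\<in>S0. (1 - xi k j ^ (G ^ i)) ^ (n + (f i - 1)))"
      using conj_prod_fixed[OF k fixed, of n j] by (simp add: f_def S0_def xi_add)
    also have "\<dots> = (\<Prod>i\<in>S0. (1 - xi k j) ^ (n + (f i - 1)) * (\<Sum>m<G ^ i. xi k j ^ m) ^ (n + (f i - 1)))"
      unfolding one_minus_power_factor power_mult_distrib ..
    also have "\<dots> = (1 - xi k j) ^ M * poly h (xi k j)"
      by (simp add: prod.distrib M_def power_sum h_def poly_prod poly_sum poly_monom poly_power)
    finally show ?thesis .
  qed
  have "(\<Sum>j<p ^ k. term_coeff (p ^ s) a t0 (rotate_term (p ^ s) j \<omega>) *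
      conj_prod n (snd (rotate_term (p ^ s) j \<omega>)) 0) =
    term_coeff (p ^ s) a t0 \<omega> * (\<Sum>j<p ^ k. (1 - xi k j) ^ M * poly h (xi k j))"
    unfolding conj_prod_rotate term_coeff_rotate[OF ppow_gt_0 \<omega>] sum_distrib_left f_def[symmetric] cp ..
  then show ?thesis unfolding z(2) 
    by (intro bexI[of _ "term_coeff (p ^ s) a t0 \<omega> * z"])
      (auto simp: mult_ac intro!: subring_mult[OF subring_A z(1) term_coeff_in[OF subring_A t0 a \<omega>]])
qed

definition coset_terms :: "nat \<Rightarrow> ((nat \<Rightarrow> nat) \<times> (nat \<Rightarrow> nat)) set" where
  "coset_terms k = (\<lambda>(v, l, i). rotate_term (p ^ s) i (coset_term (p ^ s) (p ^ k) v l)) `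
     ({..<p ^ (s - k)} \<times> {..<p ^ s} \<times> {..<p ^ k})"

lemma ppow_split: "k \<le> s \<Longrightarrow> p ^ s = p ^ k * p ^ (s - k)"
  by (simp flip: power_add)

lemma coset_terms_subset:
  assumes k: "k \<le> s" shows "coset_terms k \<subseteq> terms (p ^ s)"
  unfolding coset_terms_def
  by (auto intro!: rotate_terms coset_term_in ppow_gt_0) (use k in \<open>simp add: le_imp_power_dvd\<close>)

lemma rotate_coset_terms:
  assumes k: "k \<le> s" and \<omega>: "\<omega> \<in> coset_terms k"
  shows "rotate_term (p ^ s) j \<omega> \<in> coset_terms k"
proof -
  interpret cyclic_action "rotate_term (p ^ s)" "p ^ s" by (rule cyclic_action_rotate[OF ppow_gt_0])
  obtain v l i where \<omega>': "v < p ^ (s - k)" "l < p ^ s" "i < p ^ k"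
      "\<omega> = rotate_term (p ^ s) i (coset_term (p ^ s) (p ^ k) v l)"
    using \<omega> by (auto simp: coset_terms_def)
  have fixed: "rotate_term (p ^ s) (p ^ k) (coset_term (p ^ s) (p ^ k) v l) = coset_term (p ^ s) (p ^ k) v l"
    by (rule rotate_coset_fixed) (use k in \<open>auto simp: le_imp_power_dvd\<close>)
  have "rotate_term (p ^ s) j \<omega> = rotate_term (p ^ s) ((j + i) mod p ^ k + p ^ k * ((j + i) div p ^ k)) (coset_term (p ^ s) (p ^ k) v l)"
    by (simp add: \<omega>'(4) act_act)
  also have "\<dots> = rotate_term (p ^ s) ((j + i) mod p ^ k) (coset_term (p ^ s) (p ^ k) v l)"
    unfolding act_act[symmetric] act_mult_fixed[OF fixed] ..
  finally show ?thesis unfolding coset_terms_def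
    by (intro image_eqI[of _ _ "(v, l, (j + i) mod p ^ k)"]) (use \<omega>' in auto)
qed

text \<open>Since this number determines k, the families for distinct k are disjoint, and none of
  them contains the trivial term.\<close>

lemma card_support_coset_terms:
  assumes k: "k \<le> s" and \<omega>: "\<omega> \<in> coset_terms k"
  shows "card (support (p ^ s) (snd \<omega>)) = p ^ (s - k)"
  using \<omega> card_support_coset[OF ppow_gt_0 ppow_split[OF k]]
  by (auto simp: coset_terms_def card_support_rotate)

text \<open>A coset term has exactly \<open>p ^ k\<close> distinct rotations, so the innermost sum
  is a trace of the kind evaluated by \<open>trace_main\<close>.\<close>

lemma sum_coset_terms:
  assumes k: "k \<le> s"
  shows "(\<Sum>\<omega>\<in>coset_terms k. term_coeff (p ^ s) a t0 \<omega> * conj_prod n (snd \<omega>) 0) =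
    (\<Sum>v<p ^ (s - k). t0 ^ v * (\<Sum>l<p ^ s. a (p ^ k * v) l ^ p ^ (s - k) * (\<Sum>j<p ^ k. (1 - xi k j) ^ (n + l))))"
proof -
  let ?t = "\<lambda>\<omega>. term_coeff (p ^ s) a t0 \<omega> * conj_prod n (snd \<omega>) 0"
  let ?c = "coset_term (p ^ s) (p ^ k)"
  let ?I = "{..<p ^ (s - k)} \<times> {..<p ^ s} \<times> {..<p ^ k}"
  have dvd: "p ^ k dvd p ^ s" using k by (simp add: le_imp_power_dvd)
  have bound: "p ^ k * v < p ^ s" if "v < p ^ (s - k)" for v
    unfolding ppow_split[OF k] using that by simp
  have inj: "inj_on (\<lambda>(v, l, i). rotate_term (p ^ s) i (?c v l)) ?I"
  proof (rule inj_onI)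
    fix x y assume xy: "x \<in> ?I" "y \<in> ?I" "(\<lambda>(v, l, i). rotate_term (p ^ s) i (?c v l)) x =
      (\<lambda>(v, l, i). rotate_term (p ^ s) i (?c v l)) y"
    obtain v l i v' l' i' where x: "x = (v, l, i)" and y: "y = (v', l', i')" by (metis prod.exhaust)
    have "i = i' \<and> v = v' \<and> l = l'"
      by (rule rotate_coset_inj[OF ppow_gt_0 dvd ppow_gt_0]) (use xy bound in \<open>auto simp: x y\<close>)
    then show "x = y" by (simp add: x y)
  qed
  have "(\<Sum>\<omega>\<in>coset_terms k. ?t \<omega>) = (\<Sum>(v, l, i)\<in>?I. ?t (rotate_term (p ^ s) i (?c v l)))"
    unfolding coset_terms_def sum.reindex[OF inj] by (simp add: case_prod_unfold)
  also have "\<dots> = (\<Sum>v<p ^ (s - k). \<Sum>l<p ^ s. \<Sum>i<p ^ k. ?t (rotate_term (p ^ s) i (?c v l)))"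
    by (simp add: sum.cartesian_product)
  also have "\<dots> = (\<Sum>v<p ^ (s - k). \<Sum>l<p ^ s. \<Sum>i<p ^ k. t0 ^ v * a (p ^ k * v) l ^ p ^ (s - k) * (1 - xi k i) ^ (n + l))"
  proof (intro sum.cong refl)
    fix v l i assume vli: "v \<in> {..<p ^ (s - k)}" "l \<in> {..<p ^ s}" "i \<in> {..<p ^ k}"
    have "?c v l \<in> terms (p ^ s)" using vli by (intro coset_term_in dvd) auto
    then have "term_coeff (p ^ s) a t0 (rotate_term (p ^ s) i (?c v l)) = t0 ^ v * a (p ^ k * v) l ^ p ^ (s - k)"
      using term_coeff_coset[OF ppow_gt_0 ppow_split[OF k], of v l] vli odd_p
      by (simp add: term_coeff_rotate[OF ppow_gt_0])
    moreover have "conj_prod n (snd (rotate_term (p ^ s) i (?c v l))) 0 = (1 - xi k i) ^ (n + l)"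
    proof -
      have S: "support (p ^ s) (snd (?c v l)) \<inter> {..<p ^ k} = {0}"
        unfolding support_coset using dvd dvd_imp_le[OF dvd ppow_gt_0] by (auto dest: dvd_imp_le)
      have fixed: "rotate_term (p ^ s) (p ^ k) (?c v l) = ?c v l"
        by (rule rotate_coset_fixed[OF dvd ppow_gt_0])
      have "snd (?c v l) 0 = Suc l" by (simp add: coset_term_def)
      then show ?thesis
        unfolding conj_prod_rotate conj_prod_fixed[OF k fixed] S by simp
    qed
    ultimately show "?t (rotate_term (p ^ s) i (?c v l)) = t0 ^ v * a (p ^ k * v) l ^ p ^ (s - k) * (1 - xi k i) ^ (n + l)"
      by simp
  qed
  finally show ?thesis by (simp add: sum_distrib_left mult.assoc)
qed


text \<open>The terms split into the trivial one, with value 1, the coset terms of all levels,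
  evaluated to first order, and the rest. The support of a remaining term with stabilizer generated
  by \<open>p ^ k\<close> meets the first \<open>p ^ k\<close> rows at least twice, which explains
  \<open>(2 * n) div p ^ k\<close> in the bound on \<open>e\<close>.\<close>

lemma det_norm_matrix_cong:
  assumes t0: "t0 \<in> A" and a: "\<And>i l. i < p ^ s \<Longrightarrow> l < p ^ s \<Longrightarrow> a i l \<in> A"
    and e: "\<And>k. k \<le> s \<Longrightarrow> e \<le> k * c + (2 * n) div p ^ k"
  shows "\<exists>Z. (\<forall>k. Z k \<in> A) \<and> (\<exists>y\<in>A. det (norm_matrix n a t0) = 1 + (\<Sum>k\<le>s. of_nat (p ^ k) * \<pi> ^ (n div p ^ k) *
     ((\<Sum>v<p ^ (s - k). t0 ^ v * (\<Sum>l | l < p ^ s \<and> n mod p ^ k + l < p ^ k. a (p ^ k * v) l ^ p ^ (s - k))) + \<pi> * Z k))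
     + \<pi> ^ e * y)"
proof -
  let ?N = "p ^ s"
  interpret act: cyclic_action "rotate_term ?N" ?N by (rule cyclic_action_rotate[OF ppow_gt_0])
  define t where "t \<omega> = term_coeff ?N a t0 \<omega> * conj_prod n (snd \<omega>) 0" for \<omega>
  define C where "C = (\<Union>k\<le>s. coset_terms k)"
  define R where "R = terms ?N - insert (trivial_term ?N) C"
  define J where "J = (\<lambda>y. \<pi> ^ e * y) ` A"
  have J: "0 \<in> J" "x \<in> J \<Longrightarrow> y \<in> J \<Longrightarrow> x + y \<in> J" "x \<in> J \<Longrightarrow> y \<in> A \<Longrightarrow> x * y \<in> J" for x y
  proof -
    show "0 \<in> J" unfolding J_def by (intro image_eqI[of _ _ 0]) (auto intro: subring_0[OF subring_A])
    show "x \<in> J \<Longrightarrow> y \<in> J \<Longrightarrow> x + y \<in> J"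
      unfolding J_def by (auto simp: distrib_left[symmetric] intro!: imageI subring_add[OF subring_A])
    show "x \<in> J \<Longrightarrow> y \<in> A \<Longrightarrow> x * y \<in> J"
      unfolding J_def by (auto simp: mult.assoc intro!: imageI subring_mult[OF subring_A])
  qed
  have triv: "support ?N (snd (trivial_term ?N)) = {}" by (auto simp: support_def trivial_term_def)
  have fin: "finite (coset_terms k)" for k by (simp add: coset_terms_def)
  have Csub: "C \<subseteq> terms ?N" unfolding C_def using coset_terms_subset by blast
  have tC: "trivial_term ?N \<notin> C"
    unfolding C_def using card_support_coset_terms[of _ "trivial_term ?N"] by (auto simp: triv)
  obtain \<epsilon> where \<epsilon>: "\<epsilon> \<in> A" "of_nat p = \<pi> ^ c * \<epsilon>" using p_eq by blast
  have pk: "of_nat (p ^ k) * \<pi> ^ ((2 * n) div p ^ k) \<in> J" if "k \<le> s" for k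
  proof -
    have "of_nat (p ^ k) * \<pi> ^ ((2 * n) div p ^ k) = \<pi> ^ (k * c + (2 * n) div p ^ k) * \<epsilon> ^ k"
      by (simp add: \<epsilon>(2) power_mult_distrib power_mult[symmetric] power_add mult_ac)
    also have "\<dots> = \<pi> ^ e * (\<pi> ^ (k * c + (2 * n) div p ^ k - e) * \<epsilon> ^ k)"
      using e[OF that] by (simp flip: power_add mult.assoc)
    finally show ?thesis unfolding J_def
      by (simp only:) (intro imageI subring_mult subring_power subring_A \<pi>_in \<epsilon>)
  qed
  have Rinv: "rotate_term ?N j \<omega> \<in> R" if \<omega>: "\<omega> \<in> R" for \<omega> j
    proof -
      have ret: "\<omega> = rotate_term ?N (j * (?N - 1)) (rotate_term ?N j \<omega>)"
        by (simp only: act.act_act mult_pred_add_self[OF ppow_gt_0] act.act_mult_fixed[OF act.act_period])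
      have "rotate_term ?N j \<omega> \<notin> C"
      proof
        assume "rotate_term ?N j \<omega> \<in> C"
        then obtain k where k: "k \<le> s" "rotate_term ?N j \<omega> \<in> coset_terms k" by (auto simp: C_def)
        have "\<omega> \<in> coset_terms k" by (subst ret) (rule rotate_coset_terms[OF k])
        then show False using \<omega> k(1) by (auto simp: R_def C_def)
      qed
      moreover have "rotate_term ?N j \<omega> \<noteq> trivial_term ?N"
      proof
        assume "rotate_term ?N j \<omega> = trivial_term ?N"
        then have "support ?N (snd \<omega>) = {}"
          using support_rotate[OF ppow_gt_0, of s j \<omega>] unfolding \<open>rotate_term ?N j \<omega> = _\<close> triv by simp
        then have "\<omega> = trivial_term ?N"
          using \<omega> trivial_term_eqI[of "fst \<omega>" "snd \<omega>" ?N] by (simp add: R_def)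
        then show False using \<omega> by (simp add: R_def)
      qed
      ultimately show ?thesis using \<omega> using rotate_terms[OF _ ppow_gt_0] by (simp add: R_def)
    qed
  have Rorb: "\<exists>K>0. (\<forall>i j. (rotate_term ?N i \<omega> = rotate_term ?N j \<omega>) = [i = j] (mod K)) \<and>
        (\<Sum>j<K. t (rotate_term ?N j \<omega>)) \<in> J" if \<omega>: "\<omega> \<in> R" for \<omega>
  proof -
    obtain k where k: "k \<le> s" "\<And>i j. rotate_term ?N i \<omega> = rotate_term ?N j \<omega> \<longleftrightarrow> [i = j] (mod p ^ k)"
      using act.stabilizer_prime_power[OF prime_p refl, of \<omega>] by blast
    have fixed: "rotate_term ?N (p ^ k) \<omega> = \<omega>"
      using k(2)[of "p ^ k" 0] by (simp add: act.act_0 cong_0_iff)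
    obtain \<sigma> f where \<omega>': "\<omega> = (\<sigma>, f)" by (cases \<omega>)
    have terms: "\<omega> \<in> terms ?N" using \<omega> by (simp add: R_def)
    let ?S0 = "support ?N f \<inter> {..<p ^ k}"
    \<comment> \<open>Periodicity modulo \<open>p ^ k\<close> moves any support row into this range,
      and only the trivial term has empty support.\<close>
    have "card ?S0 \<noteq> 0"
    proof
      assume "card ?S0 = 0"
      then have S0: "?S0 = {}" by simp
      have "support ?N f = {}"
      proof (rule ccontr)
        assume "support ?N f \<noteq> {}"
        then obtain x where x: "x < ?N" "f x \<noteq> 0" by (auto simp: support_def)
        have "rotate_term ?N (p ^ k * (x div p ^ k)) \<omega> = \<omega>" by (rule act.act_mult_fixed[OF fixed])
        then have h: "f \<circ> rot ?N (p ^ k * (x div p ^ k) * (?N - 1)) = f" by (simp add: \<omega>' rotate_term_def)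
        have "x mod p ^ k < ?N" using x by (auto intro: le_less_trans[OF mod_less_eq_dividend])
        then have "rot ?N (p ^ k * (x div p ^ k)) (x mod p ^ k) = x" using x by (simp add: rot_def)
        then have "f (x mod p ^ k) \<noteq> 0"
          using fun_cong[OF h, of x] rot_inverse'[of ?N] x by (metis comp_apply ppow_gt_0)
        then have "x mod p ^ k \<in> ?S0" using \<open>x mod p ^ k < ?N\<close> by (simp add: support_def)
        then show False using S0 by blast
      qed
      then show False using trivial_term_eqI[of \<sigma> f ?N] \<omega> \<omega>' by (simp add: R_def)
    qed
    \<comment> \<open>A single row means a rotated coset term of level k, and those were removed
      from \<open>R\<close>.\<close>
    moreover have "card ?S0 \<noteq> 1"
    proof
      assume "card ?S0 = 1"
      then obtain i where i: "?S0 = {i}" by (auto simp: card_1_singleton_iff)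
      obtain v l where vl: "v < p ^ (s - k)" "l < ?N" "\<omega> = rotate_term ?N i (coset_term ?N (p ^ k) v l)"
        using coset_termI[OF ppow_gt_0 ppow_gt_0 ppow_split[OF k(1)], of \<sigma> f i] terms fixed i \<omega>' by auto
      have "i < p ^ k" using i by blast
      then have "\<omega> \<in> coset_terms k" unfolding coset_terms_def vl(3)
        by (intro image_eqI[of _ _ "(v, l, i)"]) (use vl in auto)
      then show False using \<omega> k by (auto simp: R_def C_def)
    qed
    ultimately have c2: "2 \<le> card ?S0" by linarith
    have "p ^ k * ((2 * n) div p ^ k) \<le> 2 * n" by simp
    also have "\<dots> \<le> card ?S0 * n" using c2 by (rule mult_le_mono1)
    finally have q: "p ^ k * ((2 * n) div p ^ k) \<le> card (support ?N (snd \<omega>) \<inter> {..<p ^ k}) * n" by (simp add: \<omega>')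
    have "\<exists>z\<in>A. (\<Sum>j<p ^ k. t (rotate_term ?N j \<omega>)) = of_nat (p ^ k) * \<pi> ^ ((2 * n) div p ^ k) * z"
      unfolding t_def by (rule orbit_sum[OF k(1) fixed terms t0 _ q]) (rule a)
    then have "(\<Sum>j<p ^ k. t (rotate_term ?N j \<omega>)) \<in> J"
      using J(3)[OF pk[OF k(1)]] by auto
    then show ?thesis using k(2) by (intro exI[of _ "p ^ k"]) auto
  qed
  have R: "sum t R \<in> J"
    by (rule act.sum_orbits_in) (fact Rinv Rorb J(1) J(2) | simp add: R_def finite_terms)+
  have "sum t (terms ?N) = t (trivial_term ?N) + sum t C + sum t R"
  proof -
    have "sum t (terms ?N) = sum t R + sum t (insert (trivial_term ?N) C)"
      unfolding R_def by (rule sum.subset_diff) (use Csub trivial_term_in finite_terms in auto)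
    also have "sum t (insert (trivial_term ?N) C) = t (trivial_term ?N) + sum t C"
      using tC finite_subset[OF Csub finite_terms] by simp
    finally show ?thesis by (simp add: ac_simps)
  qed
  also have "t (trivial_term ?N) = 1"
    unfolding t_def term_coeff_def conj_prod_def triv by (auto simp: trivial_term_def wraps_def support_def)
  also have "sum t C = (\<Sum>k\<le>s. sum t (coset_terms k))"
    unfolding C_def
  proof (rule sum.UNION_disjoint)
    show "\<forall>i\<in>{..s}. \<forall>j\<in>{..s}. i \<noteq> j \<longrightarrow> coset_terms i \<inter> coset_terms j = {}"
    proof safe
      fix i j \<omega> assume ij: "i \<le> s" "j \<le> s" "i \<noteq> j" "\<omega> \<in> coset_terms i" "\<omega> \<in> coset_terms j"
      have "p ^ (s - i) = p ^ (s - j)"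
        using card_support_coset_terms[of i \<omega>] card_support_coset_terms[of j \<omega>] ij by simp
      then show "\<omega> \<in> {}" using ij p_gt_1 by (simp add: power_inject_exp)
    qed
  qed (use fin in auto)
  finally have total: "det (norm_matrix n a t0) = 1 + (\<Sum>k\<le>s. sum t (coset_terms k)) + sum t R"
    by (simp add: det_norm_matrix t_def)
  have "\<exists>z\<in>A. sum t (coset_terms k) = of_nat (p ^ k) * \<pi> ^ (n div p ^ k) *
     ((\<Sum>v<p ^ (s - k). t0 ^ v * (\<Sum>l | l < ?N \<and> n mod p ^ k + l < p ^ k. a (p ^ k * v) l ^ p ^ (s - k))) + \<pi> * z)"
    if k: "k \<le> s" for k
  proof -
    let ?b = "\<lambda>v l. a (p ^ k * v) l ^ p ^ (s - k)" and ?ind = "\<lambda>l. if n mod p ^ k + l < p ^ k then 1 else 0"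
    have "\<exists>z. \<forall>l. z l \<in> A \<and> (\<Sum>j<p ^ k. (1 - xi k j) ^ (n + l)) =
        of_nat (p ^ k) * \<pi> ^ (n div p ^ k) * (?ind l + \<pi> * z l)"
      by (intro choice allI) (use trace_main[OF k] in blast)
    then obtain z where z: "\<And>l. z l \<in> A" "\<And>l. (\<Sum>j<p ^ k. (1 - xi k j) ^ (n + l)) =
        of_nat (p ^ k) * \<pi> ^ (n div p ^ k) * (?ind l + \<pi> * z l)" by blast
    have "p ^ k * v < ?N" if "v < p ^ (s - k)" for v unfolding ppow_split[OF k] using that by simp
    then have z': "(\<Sum>v<p ^ (s - k). t0 ^ v * (\<Sum>l<?N. ?b v l * z l)) \<in> A"
      by (intro subring_intros subring_A t0 a z(1)) auto
    have "sum t (coset_terms k) = (\<Sum>v<p ^ (s - k). t0 ^ v * (\<Sum>l<?N. ?b v l *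
        (of_nat (p ^ k) * \<pi> ^ (n div p ^ k) * (?ind l + \<pi> * z l))))"
      using sum_coset_terms[OF k, of a t0 n] unfolding z(2) by (simp add: t_def[abs_def])
    also have "\<dots> = of_nat (p ^ k) * \<pi> ^ (n div p ^ k) *
        (\<Sum>v<p ^ (s - k). t0 ^ v * (\<Sum>l<?N. ?b v l * (?ind l + \<pi> * z l)))"
      by (rule double_sum_scale)
    also have "(\<Sum>v<p ^ (s - k). t0 ^ v * (\<Sum>l<?N. ?b v l * (?ind l + \<pi> * z l))) =
       (\<Sum>v<p ^ (s - k). t0 ^ v * (\<Sum>l<?N. ?b v l * ?ind l)) + \<pi> * (\<Sum>v<p ^ (s - k). t0 ^ v * (\<Sum>l<?N. ?b v l * z l))"
      by (rule double_sum_add)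
    finally have eq: "sum t (coset_terms k) = of_nat (p ^ k) * \<pi> ^ (n div p ^ k) *
       ((\<Sum>v<p ^ (s - k). t0 ^ v * (\<Sum>l<?N. ?b v l * ?ind l)) +
        \<pi> * (\<Sum>v<p ^ (s - k). t0 ^ v * (\<Sum>l<?N. ?b v l * z l)))" .
    have ind: "(\<Sum>l<?N. ?b v l * ?ind l) = (\<Sum>l | l < ?N \<and> n mod p ^ k + l < p ^ k. ?b v l)" for v
    proof -
      have "(\<Sum>l<?N. ?b v l * ?ind l) = (\<Sum>l<?N. if n mod p ^ k + l < p ^ k then ?b v l else 0)"
        by (intro sum.cong) auto
      also have "\<dots> = sum (?b v) ({..<?N} \<inter> {l. n mod p ^ k + l < p ^ k})" by (simp add: sum.If_cases)
      also have "{..<?N} \<inter> {l. n mod p ^ k + l < p ^ k} = {l. l < ?N \<and> n mod p ^ k + l < p ^ k}" by auto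
      finally show ?thesis .
    qed
    show ?thesis using eq z' unfolding ind by blast
  qed
  then have "\<exists>Z. \<forall>k. k \<le> s \<longrightarrow> Z k \<in> A \<and> sum t (coset_terms k) = of_nat (p ^ k) * \<pi> ^ (n div p ^ k) *
     ((\<Sum>v<p ^ (s - k). t0 ^ v * (\<Sum>l | l < ?N \<and> n mod p ^ k + l < p ^ k. a (p ^ k * v) l ^ p ^ (s - k))) + \<pi> * Z k)"
    by (intro choice allI) blast
  then obtain Z where Z: "\<And>k. k \<le> s \<Longrightarrow> Z k \<in> A" "\<And>k. k \<le> s \<Longrightarrow> sum t (coset_terms k) = of_nat (p ^ k) * \<pi> ^ (n div p ^ k) *
     ((\<Sum>v<p ^ (s - k). t0 ^ v * (\<Sum>l | l < ?N \<and> n mod p ^ k + l < p ^ k. a (p ^ k * v) l ^ p ^ (s - k))) + \<pi> * Z k)"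
    by blast
  obtain y where y: "y \<in> A" "sum t R = \<pi> ^ e * y" using R by (auto simp: J_def)
  \<comment> \<open>Beyond level s the error coefficients are set to 0, so that membership in
    \<open>A\<close> holds for every k.\<close>
  show ?thesis
    by (rule exI[of _ "\<lambda>k. if k \<le> s then Z k else 0"])
      (use y Z in \<open>auto simp: total subring_0[OF subring_A] intro!: bexI[OF _ y(1)] sum.cong\<close>)
qed

end

section \<open>Weights\<close>

locale prime_weights =
  fixes p r n :: nat
  assumes p3: "p \<ge> 3" and r1: "r \<ge> 1" and n1: "n \<ge> 1"
begin

text \<open>The order in \<pi> of \<open>p ^ k * \<pi> ^ (n div p ^ k)\<close>, the leading factor
  at level k.\<close>

definition val :: "nat \<Rightarrow> nat" where "val k = k * ((p - 1) * p ^ (r - 1)) + n div p ^ k"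

text \<open>With q = \<open>n div p ^ k\<close>, the difference of \<open>val k\<close> and
  \<open>val (Suc k)\<close> is q - q div p - c, where c = (p - 1) p^(r-1). The function q - q div p
  is monotone and takes the value c exactly at p^r - 1 and p^r; this is where the bounds defining
  the weight and the transitional n come from.\<close>

lemma minus_div_compare:
  fixes q :: nat
  shows "q \<ge> p ^ r + 1 \<Longrightarrow> q \<ge> q div p + (p - 1) * p ^ (r - 1) + 1"
    and "q + 2 \<le> p ^ r \<Longrightarrow> q + 1 \<le> q div p + (p - 1) * p ^ (r - 1)"
    and "p ^ r - 1 \<le> q \<Longrightarrow> q \<le> p ^ r \<Longrightarrow> q = q div p + (p - 1) * p ^ (r - 1)"
proof -
  define h where "h = p ^ (r - 1)"
  \<comment> \<open>With u = p - 1 all quantities become sums of products without subtraction, and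
    the three comparisons reduce to comparing q div p with p^(r-1).\<close>
  obtain u where u: "p = Suc u" "u \<ge> 2" using p3 by (cases p) auto
  have pr: "p ^ r = u * h + h" using r1 unfolding h_def by (cases r) (auto simp: u)
  have h1: "h \<ge> 1" unfolding h_def using p3 by simp
  define d m where "d = q div p" and "m = q mod p"
  have q: "q = u * d + d + m" "m \<le> u"
  proof -
    have "q = p * d + m" unfolding d_def m_def by simp
    then show "q = u * d + d + m" by (simp add: u)
    have "m < p" unfolding m_def using p3 by simp
    then show "m \<le> u" by (simp add: u)
  qed
  have mon: "u * d + d + u + 1 \<le> u * h + h" if "d < h"
  proof -
    have "Suc u * Suc d \<le> Suc u * h" using that by (intro mult_left_mono) auto
    then show ?thesis by simp
  qed
  have mon': "u * h + u \<le> u * d" if "h < d"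
  proof -
    have "u * Suc h \<le> u * d" using that by (intro mult_left_mono) auto
    then show ?thesis by simp
  qed
  have mon2: "u * d + u \<le> u * h" if "d < h"
  proof -
    have "u * Suc d \<le> u * h" using that by (intro mult_left_mono) auto
    then show ?thesis by simp
  qed
  have e: "(p - 1) * p ^ (r - 1) = u * h" by (simp add: u h_def)
  note fold = pr e d_def[symmetric]
  show "q \<ge> p ^ r + 1 \<Longrightarrow> q \<ge> q div p + (p - 1) * p ^ (r - 1) + 1"
    unfolding fold using q mon mon' u(2) by (cases d h rule: linorder_cases) auto
  show "q + 2 \<le> p ^ r \<Longrightarrow> q + 1 \<le> q div p + (p - 1) * p ^ (r - 1)"
  proof -
    assume a: "q + 2 \<le> p ^ r"
    have "d < h"
    proof (rule ccontr)
      assume "\<not> d < h"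
      then have "Suc u * h \<le> Suc u * d" by (intro mult_left_mono) auto
      then show False using a q unfolding pr by simp
    qed
    then have c: "u * d + u \<le> u * h" by (rule mon2)
    show ?thesis
    proof (cases "Suc d = h")
      case True
      have "u * h = u * d + u" using True by (metis mult_Suc_right add.commute)
      then show ?thesis unfolding fold using q a True unfolding pr by simp
    next
      case False
      then have "u * Suc (Suc d) \<le> u * h" using \<open>d < h\<close> by (intro mult_left_mono) auto
      then show ?thesis unfolding fold using q u(2) by simp
    qed
  qed
  show "p ^ r - 1 \<le> q \<Longrightarrow> q \<le> p ^ r \<Longrightarrow> q = q div p + (p - 1) * p ^ (r - 1)"
  proof -
    assume a: "p ^ r - 1 \<le> q" "q \<le> p ^ r"
    show ?thesis
    proof (cases "q = p ^ r")
      case True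
      then have "q = p * h" using pr by (simp add: u)
      then have "d = h" using p3 by (simp add: d_def)
      then show ?thesis unfolding fold using True pr by simp
    next
      case False
      then have qq: "q + 1 = u * h + h" using a pr h1 by linarith
      have "d < h"
      proof (rule ccontr)
        assume "\<not> d < h"
        then have "Suc u * h \<le> Suc u * d" by (intro mult_left_mono) auto
        then show False using qq q by simp
      qed
      have "Suc d = h"
      proof (rule ccontr)
        assume "Suc d \<noteq> h"
        then have "Suc u * Suc (Suc d) \<le> Suc u * h" using \<open>d < h\<close> by (intro mult_left_mono) auto
        then show False using qq q u(2) by simp
      qed
      then have "u * h = u * d + u" by (metis mult_Suc_right add.commute)
      then show ?thesis unfolding fold using qq q \<open>Suc d = h\<close> by simp
    qed
  qed
qed

lemma val_Suc: "val (Suc k) + n div p ^ k = val k + (n div p ^ k) div p + (p - 1) * p ^ (r - 1)"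
  by (simp add: val_def div_mult2_eq[symmetric] mult.commute)

text \<open>In terms of the quotients that occur in \<open>val\<close>, the weight is the first k
  with \<open>n div p ^ k \<le> p ^ r\<close>.\<close>

lemma less_iff_div: "n < p ^ (r + k) + p ^ k \<longleftrightarrow> n div p ^ k \<le> p ^ r"
proof -
  have "n < p ^ (r + k) + p ^ k \<longleftrightarrow> n < (p ^ r + 1) * p ^ k" by (simp add: power_add algebra_simps)
  also have "\<dots> \<longleftrightarrow> n div p ^ k < p ^ r + 1" using p3 by (simp add: div_less_iff_less_mult)
  finally show ?thesis by (simp only: less_Suc_eq_le Suc_eq_plus1[symmetric])
qed

lemma weight_exists: "\<exists>k. n < p ^ (r + k) + p ^ k"
proof
  have "n < 2 ^ n" by (rule less_exp)
  also have "\<dots> \<le> p ^ n" using p3 by (intro power_mono) auto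
  finally have "n < p ^ n" .
  then show "n < p ^ (r + n) + p ^ n" by simp
qed

abbreviation w where "w \<equiv> weight p r n"

lemma div_weight: "n div p ^ w \<le> p ^ r"
  unfolding less_iff_div[symmetric] weight_def using weight_exists by (rule LeastI_ex)

lemma div_below_weight: "k < w \<Longrightarrow> p ^ r + 1 \<le> n div p ^ k"
  using not_less_Least[of k "\<lambda>k. n < p ^ (r + k) + p ^ k", folded weight_def]
  unfolding less_iff_div by simp

lemma val_below: "k < w \<Longrightarrow> val w < val k"
proof (induction "w - k" arbitrary: k)
  case (Suc d)
  have "val (Suc k) < val k"
    using minus_div_compare(1)[OF div_below_weight[OF Suc.prems]] val_Suc[of k] by linarith
  moreover have "val w \<le> val (Suc k)"
    using Suc.hyps(1)[of "Suc k"] Suc.hyps(2) Suc.prems by (cases "Suc k = w") (auto simp: less_imp_le)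
  ultimately show ?case by simp
qed simp

text \<open>A further division by p brings the quotient down to at most p^(r-1), which is below p^r
  - 1 since p is at least 3. From level w + 1 on, \<open>val\<close> therefore increases
  strictly.\<close>

lemma div_above_weight: "k > w \<Longrightarrow> n div p ^ k + 2 \<le> p ^ r"
proof -
  assume k: "k > w"
  define h where "h = p ^ (r - 1)"
  have pr: "p ^ r = p * h" using r1 unfolding h_def by (cases r) auto
  have h1: "h \<ge> 1" unfolding h_def using p3 by simp
  have "n div p ^ k = (n div p ^ w) div p div p ^ (k - w - 1)"
    using k by (simp add: div_mult2_eq[symmetric] power_add[symmetric] power_Suc2[symmetric] del: power_Suc)
  also have "\<dots> \<le> (n div p ^ w) div p" by simp
  also have "\<dots> \<le> p ^ r div p" using div_weight by (rule div_le_mono)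
  also have "\<dots> = h" unfolding pr using p3 by simp
  finally have "n div p ^ k \<le> h" .
  moreover have "3 * h \<le> p * h" using p3 by simp
  ultimately show ?thesis unfolding pr using h1 by linarith
qed

lemma val_Suc_above: "k > w \<Longrightarrow> val k < val (Suc k)"
  using minus_div_compare(2)[OF div_above_weight] val_Suc[of k] by fastforce

lemma val_above: "w < k \<Longrightarrow> k < l \<Longrightarrow> val k < val l"
proof (induction l)
  case (Suc l)
  then show ?case using val_Suc_above[of l] by (cases "k = l") (auto simp: less_Suc_eq)
qed simp

lemma ordinary_div: "ordinary p r n \<Longrightarrow> n div p ^ w + 2 \<le> p ^ r"
proof -
  assume "ordinary p r n"
  then have "n < p ^ (r + w) - p ^ w" by (simp add: ordinary_def Let_def)
  also have "p ^ (r + w) - p ^ w = (p ^ r - 1) * p ^ w" by (simp add: power_add diff_mult_distrib)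
  finally have "n div p ^ w < p ^ r - 1" using p3 by (simp add: div_less_iff_less_mult)
  then show ?thesis by simp
qed

lemma transitional_div: "transitional p r n \<Longrightarrow> p ^ r - 1 \<le> n div p ^ w"
proof -
  assume "transitional p r n"
  then have "p ^ (r + w) - p ^ w \<le> n" by (simp add: transitional_def Let_def)
  also have "p ^ (r + w) - p ^ w = (p ^ r - 1) * p ^ w" by (simp add: power_add diff_mult_distrib)
  finally show ?thesis using p3 by (simp add: less_eq_div_iff_mult_less_eq)
qed

lemma ordinary_val: "ordinary p r n \<Longrightarrow> k \<noteq> w \<Longrightarrow> val w < val k"
proof -
  assume o: "ordinary p r n" and k: "k \<noteq> w"
  have "val w < val (Suc w)"
    using minus_div_compare(2)[OF ordinary_div[OF o]] val_Suc[of w] by linarith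
  then show ?thesis using k val_below[of k] val_above[of "Suc w" k]
    by (cases "k < w"; cases "k = Suc w") auto
qed

lemma transitional_val:
  assumes t: "transitional p r n"
  shows "val (Suc w) = val w" and "k \<noteq> w \<Longrightarrow> k \<noteq> Suc w \<Longrightarrow> val w < val k"
proof -
  show *: "val (Suc w) = val w"
    using minus_div_compare(3)[OF transitional_div[OF t] div_weight] val_Suc[of w] by linarith
  show "k \<noteq> w \<Longrightarrow> k \<noteq> Suc w \<Longrightarrow> val w < val k"
    using * val_below[of k] val_above[of "Suc w" k] by (cases "k < w") auto
qed

lemma ordinary_or_transitional: "ordinary p r n \<or> transitional p r n"
  using LeastI_ex[OF weight_exists, folded weight_def]
  by (auto simp: ordinary_def transitional_def Let_def not_less)

text \<open>This makes the orbits with m at least 2 negligible. Doubling n helps as soon as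
  \<open>n div p ^ k\<close> is positive. If it is zero, then k differs from w; and in the
  transitional case with k = w + 1 the number 2 n is at least \<open>p ^ k\<close>, so that the
  doubled quotient is positive after all.\<close>

lemma val_double: "val w < k * ((p - 1) * p ^ (r - 1)) + (2 * n) div p ^ k"
proof (cases "n div p ^ k = 0")
  case False
  have "2 * (n div p ^ k) \<le> (2 * n) div p ^ k"
    using p3 by (simp add: less_eq_div_iff_mult_less_eq)
  then have "val k < k * ((p - 1) * p ^ (r - 1)) + (2 * n) div p ^ k"
    unfolding val_def using False by simp
  moreover have "val w \<le> val k"
    using ordinary_or_transitional ordinary_val[of k] transitional_val(1) transitional_val(2)[of k]
    by (metis le_refl less_imp_le)
  ultimately show ?thesis by simp
next
  case True
  show ?thesis
  proof (cases "val w < val k")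
    case False
    then consider "k = w" | "transitional p r n" "k = Suc w"
      using ordinary_or_transitional ordinary_val[of k] transitional_val(2)[of k] by blast
    then show ?thesis
    proof cases
      case 1
      have False
      proof (cases w)
        case 0
        then show ?thesis using True n1 1 by simp
      next
        case (Suc u)
        have "p ^ r + 1 \<le> n div p ^ u" using div_below_weight[of u] Suc by simp
        moreover have "p ^ 1 \<le> p ^ r" using p3 r1 by (intro power_increasing) auto
        ultimately have "p \<le> n div p ^ u" by simp
        then have "(n div p ^ u) div p \<ge> 1" using p3 by (simp add: less_eq_div_iff_mult_less_eq)
        then have "n div p ^ w \<ge> 1" using Suc by (simp add: div_mult2_eq[symmetric] mult.commute)
        then show ?thesis using True 1 by simp
      qed
      then show ?thesis ..
    next
      case 2
      have "p ^ 1 \<le> p ^ r" using p3 r1 by (intro power_increasing) auto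
      then have "p - 1 \<le> n div p ^ w" using transitional_div[OF 2(1)] by simp
      then have "(p - 1) * p ^ w \<le> n" using p3 by (simp add: less_eq_div_iff_mult_less_eq)
      then have "(2 * (p - 1)) * p ^ w \<le> 2 * n" by simp
      moreover have "p * p ^ w \<le> (2 * (p - 1)) * p ^ w" using p3 by (intro mult_right_mono) auto
      ultimately have "p * p ^ w \<le> 2 * n" by (rule order_trans[rotated])
      then have "p ^ k \<le> 2 * n" using 2 by simp
      then have "1 \<le> (2 * n) div p ^ k" using p3 by (simp add: less_eq_div_iff_mult_less_eq)
      moreover have "val k = k * ((p - 1) * p ^ (r - 1))" using True by (simp add: val_def)
      ultimately show ?thesis using transitional_val(1)[OF 2(1)] 2(2) by simp
    qed
  next
    assume "val w < val k"
    then show ?thesis using True by (simp add: val_def)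
  qed
qed

end

section \<open>Leading coefficients of a determinant equal to 1\<close>

context cyclotomic_tower
begin

definition leading_sum :: "nat \<Rightarrow> (nat \<Rightarrow> nat \<Rightarrow> 'k) \<Rightarrow> 'k \<Rightarrow> nat \<Rightarrow> 'k" where
  "leading_sum n a t0 k = (\<Sum>v<p ^ (s - k). t0 ^ v *
     (\<Sum>l | l < p ^ s \<and> n mod p ^ k + l < p ^ k. a (p ^ k * v) l ^ p ^ (s - k)))"

text \<open>Dividing the expansion by the lowest power of \<pi> leaves the levels of minimal
  valuation modulo \<pi>. Level k carries the factor \<open>\<epsilon> ^ k\<close>, congruent to
  (-1)^k, so two consecutive minimal levels enter with opposite signs and their leading sums
  agree.\<close>

lemma det_eq_1_imp:
  assumes n: "n \<ge> 1" and t0: "t0 \<in> A" and a: "\<And>i l. i < p ^ s \<Longrightarrow> l < p ^ s \<Longrightarrow> a i l \<in> A"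
    and det: "det (norm_matrix n a t0) = 1"
  shows "ordinary p r n \<Longrightarrow> weight p r n \<le> s \<Longrightarrow> cong_in A \<pi> (leading_sum n a t0 (weight p r n)) 0"
    and "transitional p r n \<Longrightarrow> weight p r n + 1 \<le> s \<Longrightarrow>
      cong_in A \<pi> (leading_sum n a t0 (weight p r n + 1)) (leading_sum n a t0 (weight p r n))"
proof -
  interpret prime_weights p r n by unfold_locales (use p_gt_1 r_ge_1 n in auto)
  note S = subring_A
  let ?L = "leading_sum n a t0"
  obtain \<epsilon> where \<epsilon>: "\<epsilon> \<in> A" "of_nat p = \<pi> ^ c * \<epsilon>" "cong_in A \<pi> \<epsilon> (- 1)" using p_eq by blast
  have L: "?L k \<in> A" if "k \<le> s" for k
  proof -
    have "p ^ k * v < p ^ s" if "v < p ^ (s - k)" for v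
      unfolding ppow_split[OF \<open>k \<le> s\<close>] using that by simp
    then show ?thesis unfolding leading_sum_def by (intro subring_intros S t0 a) auto
  qed
  have vald: "val w + 1 \<le> k * c + (2 * n) div p ^ k" for k
    using val_double[of k] by (simp add: c_def)
  obtain Z y where Z: "\<And>k. Z k \<in> A" and y: "y \<in> A" and
    eq: "1 = 1 + (\<Sum>k\<le>s. of_nat (p ^ k) * \<pi> ^ (n div p ^ k) * (?L k + \<pi> * Z k)) + \<pi> ^ (val w + 1) * y"
  proof -
    obtain Z where Z: "\<forall>k. Z k \<in> A" "\<exists>y\<in>A. det (norm_matrix n a t0) = 1 +
       (\<Sum>k\<le>s. of_nat (p ^ k) * \<pi> ^ (n div p ^ k) * (?L k + \<pi> * Z k)) + \<pi> ^ (val w + 1) * y"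
      using det_norm_matrix_cong[OF t0 _ vald, of a] a unfolding leading_sum_def by blast
    then show thesis using that[of Z] unfolding det by blast
  qed
  define X where "X k = \<epsilon> ^ k * (?L k + \<pi> * Z k)" for k
  have X: "X k \<in> A" if "k \<le> s" for k
    unfolding X_def by (intro subring_intros S \<epsilon> L that \<pi>_in Z)
  have tm: "of_nat (p ^ k) * \<pi> ^ (n div p ^ k) * (?L k + \<pi> * Z k) = \<pi> ^ val k * X k" for k
    by (simp add: X_def \<epsilon>(2) val_def c_def power_mult_distrib power_mult[symmetric] power_add mult_ac)
  have sum0: "(\<Sum>k\<le>s. \<pi> ^ val k * X k) = \<pi> ^ (val w + 1) * (- y)"
    using eq unfolding tm by (simp add: algebra_simps add_eq_0_iff)
  \<comment> \<open>\<open>K\<close> is the set of levels of minimal valuation;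
    \<open>\<pi> ^ val w\<close> is cancelled in the field, where \<pi> is nonzero.\<close>
  have reduce: "cong_in A \<pi> (\<Sum>k\<in>K. X k) 0"
    if K: "K \<subseteq> {..s}" "\<And>k. k \<in> K \<Longrightarrow> val k = val w" "\<And>k. k \<le> s \<Longrightarrow> k \<notin> K \<Longrightarrow> val w < val k" for K
  proof -
    have "(\<Sum>k\<le>s. \<pi> ^ val k * X k) = (\<Sum>k\<in>K. \<pi> ^ val k * X k) + (\<Sum>k\<in>{..s} - K. \<pi> ^ val k * X k)"
      using sum.subset_diff[OF K(1), of "\<lambda>k. \<pi> ^ val k * X k"] by (simp add: add.commute)
    also have "(\<Sum>k\<in>K. \<pi> ^ val k * X k) = \<pi> ^ val w * (\<Sum>k\<in>K. X k)"
      using K(2) by (simp add: sum_distrib_left)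
    also have "(\<Sum>k\<in>{..s} - K. \<pi> ^ val k * X k) = \<pi> ^ val w * (\<pi> * (\<Sum>k\<in>{..s} - K. \<pi> ^ (val k - (val w + 1)) * X k))"
      unfolding sum_distrib_left
    proof (intro sum.cong refl)
      fix k assume "k \<in> {..s} - K"
      then have "val w + 1 \<le> val k" using K(3)[of k] by auto
      then have "\<pi> ^ val k = \<pi> ^ val w * (\<pi> * \<pi> ^ (val k - (val w + 1)))"
        by (metis le_add_diff_inverse mult.assoc power_Suc2 power_add add.commute plus_1_eq_Suc)
      then show "\<pi> ^ val k * X k = \<pi> ^ val w * (\<pi> * (\<pi> ^ (val k - (val w + 1)) * X k))" by simp
    qed
    finally have "\<pi> ^ val w * (\<pi> * (- y)) = \<pi> ^ val w * ((\<Sum>k\<in>K. X k) + \<pi> * (\<Sum>k\<in>{..s} - K. \<pi> ^ (val k - (val w + 1)) * X k))"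
      unfolding sum0 by (simp only: distrib_left power_add power_one_right mult.assoc)
    then have "\<pi> * (- y) = (\<Sum>k\<in>K. X k) + \<pi> * (\<Sum>k\<in>{..s} - K. \<pi> ^ (val k - (val w + 1)) * X k)"
      by (rule mult_left_cancel[THEN iffD1, rotated]) (simp add: \<pi>_nonzero)
    then have "(\<Sum>k\<in>K. X k) = 0 + \<pi> * (- y - (\<Sum>k\<in>{..s} - K. \<pi> ^ (val k - (val w + 1)) * X k))"
      by (simp only: right_diff_distrib) simp
    moreover have "- y - (\<Sum>k\<in>{..s} - K. \<pi> ^ (val k - (val w + 1)) * X k) \<in> A"
      by (intro subring_intros S y X \<pi>_in) auto
    ultimately show ?thesis unfolding cong_in_def by blast
  qed
  have Xc: "cong_in A \<pi> (X k) ((- 1) ^ k * ?L k)" if "k \<le> s" for k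
  proof -
    have "cong_in A \<pi> (?L k + \<pi> * Z k) (?L k)" using Z[of k] by (auto simp: cong_in_def)
    then show ?thesis unfolding X_def
      by (intro cong_in_mult cong_in_power S \<epsilon> L that \<pi>_in subring_intros)
  qed
  have sg: "(- 1) ^ w * ((- 1) ^ w * x) = x" for x :: 'k
    by (simp add: mult.assoc[symmetric] power_mult_distrib[symmetric])
  show "cong_in A \<pi> (?L w) 0" if o: "ordinary p r n" "w \<le> s"
  proof -
    have "cong_in A \<pi> (X w) 0" using reduce[of "{w}"] ordinary_val[OF o(1)] o(2) by simp
    then have "cong_in A \<pi> ((- 1) ^ w * ?L w) 0"
      using Xc[OF o(2)] cong_in_trans[OF S] cong_in_sym[OF S] by blast
    then have "cong_in A \<pi> ((- 1) ^ w * ((- 1) ^ w * ?L w)) ((- 1) ^ w * 0)"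
      by (intro cong_in_scale S subring_intros)
    then show ?thesis by (simp only: sg mult_zero_right)
  qed
  show "cong_in A \<pi> (?L (w + 1)) (?L w)" if t: "transitional p r n" "w + 1 \<le> s"
  proof -
    have "cong_in A \<pi> (\<Sum>k\<in>{w, Suc w}. X k) 0"
    proof (rule reduce)
      show "{w, Suc w} \<subseteq> {..s}" using t(2) by simp
      show "val k = val w" if "k \<in> {w, Suc w}" for k
        using that transitional_val(1)[OF t(1)] by blast
      show "val w < val k" if "k \<notin> {w, Suc w}" for k
        by (rule transitional_val(2)[OF t(1)]) (use that in simp_all)
    qed
    then have "cong_in A \<pi> (X w + X (Suc w)) 0" by simp
    moreover have "cong_in A \<pi> (X w + X (Suc w)) ((- 1) ^ w * ?L w + (- 1) ^ Suc w * ?L (Suc w))"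
      using t(2) by (intro cong_in_add S Xc) auto
    ultimately have "cong_in A \<pi> ((- 1) ^ w * ?L w + (- 1) ^ Suc w * ?L (Suc w)) 0"
      using cong_in_trans[OF S] cong_in_sym[OF S] by blast
    then have "cong_in A \<pi> ((- 1) ^ w * ((- 1) ^ w * ?L w + (- 1) ^ Suc w * ?L (Suc w))) ((- 1) ^ w * 0)"
      by (intro cong_in_scale S subring_intros)
    moreover have "(- 1) ^ w * ((- 1) ^ w * ?L w + (- 1) ^ Suc w * ?L (Suc w)) = ?L w - ?L (w + 1)"
      by (simp add: right_diff_distrib sg)
    ultimately have "cong_in A \<pi> (?L w - ?L (w + 1)) 0" by simp
    then have "cong_in A \<pi> (?L w - ?L (w + 1) + ?L (w + 1)) (0 + ?L (w + 1))"
      using t(2) by (intro cong_in_add cong_in_refl S)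
    then show ?thesis using cong_in_sym[OF S] by simp
  qed
qed

end

section \<open>The reduced norm\<close>

locale cyclic_splitting =
  fixes p r s :: nat and z c0 :: "'k::field_char_0" and A k K L :: "'k set"
    and g :: "'k \<Rightarrow> 'k" and \<iota> :: "'k \<Rightarrow> 'd::ring_1" and u :: 'd and \<phi> :: "'d \<Rightarrow> 'k mat"
  assumes prime_p: "prime p" and odd_p: "odd p" and r_ge_1: "r \<ge> 1"
    and subring_A: "is_subring A" and A_k: "A \<subseteq> k" and subring_K: "is_subring K" and k_K: "k \<subseteq> K"
    and z: "primitive_root_of_unity (p ^ (r + s)) z" "z \<in> K" "z ^ (p ^ s) \<in> A"
    and c0: "c0 \<in> A" "c0 \<noteq> 0"
    and gz: "g z = z ^ (1 + p ^ r)"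
    and alg: "is_cyclic_algebra K g (p ^ s) c0 \<iota> u"
    and split: "is_splitting k L \<iota> (p ^ s) \<phi>"
begin

abbreviation N where "N \<equiv> p ^ s"

lemma N_pos: "N > 0" using prime_p prime_gt_0_nat by simp

lemma \<iota>_1: "\<iota> 1 = 1"
  and \<iota>_add: "x \<in> K \<Longrightarrow> y \<in> K \<Longrightarrow> \<iota> (x + y) = \<iota> x + \<iota> y"
  and \<iota>_mult: "x \<in> K \<Longrightarrow> y \<in> K \<Longrightarrow> \<iota> (x * y) = \<iota> x * \<iota> y"
  and u_\<iota>: "x \<in> K \<Longrightarrow> u * \<iota> x = \<iota> (g x) * u"
  and u_N: "u ^ N = \<iota> c0"
  using alg by (auto simp: is_cyclic_algebra_def)

lemma \<iota>_0: "\<iota> 0 = 0"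
  using \<iota>_add[of 0 0] subring_0[OF subring_K] by simp

lemma \<iota>_diff: "x \<in> K \<Longrightarrow> y \<in> K \<Longrightarrow> \<iota> (x - y) = \<iota> x - \<iota> y"
  using \<iota>_add[of "x - y" y] subring_diff[OF subring_K] by (simp add: eq_diff_eq)

lemma \<iota>_power: "x \<in> K \<Longrightarrow> \<iota> (x ^ m) = \<iota> x ^ m"
  by (induction m) (simp_all add: \<iota>_1 \<iota>_mult subring_power[OF subring_K])

lemma \<iota>_sum: "(\<And>i. i \<in> I \<Longrightarrow> f i \<in> K) \<Longrightarrow> \<iota> (sum f I) = (\<Sum>i\<in>I. \<iota> (f i))"
  by (induction I rule: infinite_finite_induct) (simp_all add: \<iota>_0 \<iota>_add subring_sum[OF subring_K])

lemma \<phi>_carrier: "\<phi> x \<in> carrier_mat N N"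
  and \<phi>_add: "\<phi> (x + y) = \<phi> x + \<phi> y"
  and \<phi>_mult: "\<phi> (x * y) = \<phi> x * \<phi> y"
  and \<phi>_\<iota>: "a \<in> k \<Longrightarrow> \<phi> (\<iota> a) = a \<cdot>\<^sub>m 1\<^sub>m N"
  using split by (auto simp: is_splitting_def)

text \<open>Row vectors, as functions vanishing outside \<open>{..<N}\<close>, on which \<open>D\<close> acts from the right.\<close>

definition act :: "(nat \<Rightarrow> 'k) \<Rightarrow> 'd \<Rightarrow> nat \<Rightarrow> 'k" where
  "act y x i = (if i < N then \<Sum>j<N. y j * \<phi> x $$ (j, i) else 0)"

definition row :: "(nat \<Rightarrow> 'k) \<Rightarrow> bool" where "row y \<longleftrightarrow> (\<forall>i\<ge>N. y i = 0)"

lemma row_act: "row (act y x)" by (simp add: row_def act_def)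

lemma act_add: "act y (x + x') i = act y x i + act y x' i"
  using \<phi>_carrier[of x] \<phi>_carrier[of x'] by (simp add: act_def \<phi>_add distrib_left sum.distrib)

lemma act_mult: "act y (x * x') = act (act y x) x'"
proof
  fix i
  have "(\<Sum>j<N. y j * (\<phi> x * \<phi> x') $$ (j, i)) = (\<Sum>l<N. (\<Sum>j<N. y j * \<phi> x $$ (j, l)) * \<phi> x' $$ (l, i))" if i: "i < N"
  proof -
    have "(\<Sum>j<N. y j * (\<phi> x * \<phi> x') $$ (j, i)) = (\<Sum>j<N. \<Sum>l<N. y j * \<phi> x $$ (j, l) * \<phi> x' $$ (l, i))"
      using i \<phi>_carrier[of x] \<phi>_carrier[of x']
      by (intro sum.cong refl) (auto simp: scalar_prod_def sum_distrib_left atLeast0LessThan mult.assoc)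
    also have "\<dots> = (\<Sum>l<N. \<Sum>j<N. y j * \<phi> x $$ (j, l) * \<phi> x' $$ (l, i))" by (rule sum.swap)
    finally show ?thesis by (simp add: sum_distrib_right)
  qed
  then show "act y (x * x') i = act (act y x) x' i" by (simp add: act_def \<phi>_mult)
qed

lemma act_k: "row y \<Longrightarrow> a \<in> k \<Longrightarrow> act y (\<iota> a) i = a * y i"
proof -
  assume y: "row y" and a: "a \<in> k"
  have "(\<Sum>j<N. y j * \<phi> (\<iota> a) $$ (j, i)) = a * y i" if "i < N"
  proof -
    have "(\<Sum>j<N. y j * \<phi> (\<iota> a) $$ (j, i)) = (\<Sum>j<N. if j = i then a * y i else 0)"
      using that by (intro sum.cong) (auto simp: \<phi>_\<iota>[OF a])
    then show ?thesis using that by simp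
  qed
  then show ?thesis using y by (simp add: act_def row_def)
qed

lemma act_scale: "act (\<lambda>i. q * y i) x i = q * act y x i"
  by (simp add: act_def sum_distrib_left mult.assoc)

lemma act_sum_left: "act (\<lambda>i. \<Sum>m\<in>I. q m * y m i) x i = (\<Sum>m\<in>I. q m * act (y m) x i)"
  by (simp add: act_def sum_distrib_left sum_distrib_right mult.assoc sum.swap[of _ I])

lemma act_0: "act y 0 i = 0"
  using act_add[of y 0 0 i] by simp

lemma act_sum: "act y (sum f I) i = (\<Sum>m\<in>I. act y (f m) i)"
  by (induction I rule: infinite_finite_induct) (simp_all add: act_0 act_add)

definition eigen :: "(nat \<Rightarrow> 'k) \<Rightarrow> 'd \<Rightarrow> 'k \<Rightarrow> bool" where
  "eigen y x q \<longleftrightarrow> act y x = (\<lambda>i. q * y i)"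

lemma one_in_k: "1 \<in> k" using A_k subring_1[OF subring_A] by blast

lemma eigen_k: "row y \<Longrightarrow> a \<in> k \<Longrightarrow> eigen y (\<iota> a) a"
  by (simp add: eigen_def fun_eq_iff act_k)

lemma eigen_1: "row y \<Longrightarrow> eigen y 1 1"
  using eigen_k[of y 1] one_in_k by (simp add: \<iota>_1)

lemma eigen_diff: "eigen y x q \<Longrightarrow> eigen y x' q' \<Longrightarrow> eigen y (x - x') (q - q')"
  using act_add[of y "x - x'" x'] by (simp add: eigen_def fun_eq_iff left_diff_distrib eq_diff_eq)

lemma eigen_mult: "eigen y x q \<Longrightarrow> eigen y x' q' \<Longrightarrow> eigen y (x * x') (q * q')"
  unfolding eigen_def act_mult by (rule ext) (simp add: act_scale mult.assoc)

lemma eigen_power: "row y \<Longrightarrow> eigen y x q \<Longrightarrow> eigen y (x ^ m) (q ^ m)"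
  by (induction m) (simp_all add: eigen_1 eigen_mult)

lemma eigen_sum: "(\<And>i. i \<in> I \<Longrightarrow> eigen y (f i) (q i)) \<Longrightarrow> eigen y (sum f I) (sum q I)"
  by (simp add: eigen_def fun_eq_iff act_sum sum_distrib_right)

text \<open>The coefficients are central and act as scalars, so on an eigenvector \<theta> takes the
  place of z.\<close>

lemma eigen_expansion:
  assumes y: "row y" "eigen y (\<iota> z) \<theta>" and a: "\<And>l. l < N \<Longrightarrow> a l \<in> A"
  shows "eigen y (\<iota> (\<Sum>l<N. a l * (1 - z) ^ l)) (\<Sum>l<N. a l * (1 - \<theta>) ^ l)"
proof -
  have aK: "a l \<in> K" "a l \<in> k" if "l < N" for l using a[OF that] A_k k_K by auto
  have zK: "1 - z \<in> K" by (intro subring_intros subring_K z)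
  have "\<iota> (\<Sum>l<N. a l * (1 - z) ^ l) = (\<Sum>l<N. \<iota> (a l) * (1 - \<iota> z) ^ l)"
  proof (subst \<iota>_sum)
    show "a l * (1 - z) ^ l \<in> K" if "l \<in> {..<N}" for l
      using aK(1)[of l] that by (intro subring_intros subring_K zK) simp
    show "(\<Sum>l<N. \<iota> (a l * (1 - z) ^ l)) = (\<Sum>l<N. \<iota> (a l) * (1 - \<iota> z) ^ l)"
      using aK zK by (intro sum.cong refl)
        (simp add: \<iota>_mult \<iota>_power subring_power[OF subring_K] \<iota>_diff \<iota>_1 subring_1[OF subring_K] z)
  qed
  then show ?thesis using aK
    by (simp only:) (intro eigen_sum eigen_mult eigen_power eigen_diff eigen_1 eigen_k y; simp)
qed

text \<open>Because u z equals \<open>g z\<close> times u, right multiplication by u carries an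
  eigenvector for \<theta> to one for \<open>\<theta> ^ (1 + p ^ r)\<close>.\<close>

lemma eigen_u:
  assumes y: "row y" "eigen y (\<iota> z) \<theta>"
  shows "eigen (act y (u ^ j)) (\<iota> z) (\<theta> ^ ((1 + p ^ r) ^ j))"
proof (induction j)
  case 0
  have "act y 1 = y" using eigen_1[OF y(1)] by (simp add: eigen_def)
  then show ?case using y by simp
next
  case (Suc j)
  let ?v = "act y (u ^ j)"
  have "act (act y (u ^ Suc j)) (\<iota> z) = act ?v (u * \<iota> z)"
    by (simp only: act_mult power_Suc2)
  also have "u * \<iota> z = \<iota> z ^ (1 + p ^ r) * u" by (simp only: u_\<iota>[OF z(2)] gz \<iota>_power[OF z(2)])
  also have "act ?v (\<iota> z ^ (1 + p ^ r) * u) = act (act ?v (\<iota> z ^ (1 + p ^ r))) u" by (rule act_mult)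
  also have "act ?v (\<iota> z ^ (1 + p ^ r)) = (\<lambda>i. (\<theta> ^ ((1 + p ^ r) ^ j)) ^ (1 + p ^ r) * ?v i)"
    using eigen_power[OF row_act Suc, of "1 + p ^ r"] unfolding eigen_def .
  also have "(\<theta> ^ ((1 + p ^ r) ^ j)) ^ (1 + p ^ r) = \<theta> ^ ((1 + p ^ r) ^ Suc j)"
    by (simp only: power_mult[symmetric] power_Suc2)
  also have "act (\<lambda>i. \<theta> ^ ((1 + p ^ r) ^ Suc j) * ?v i) u = (\<lambda>i. \<theta> ^ ((1 + p ^ r) ^ Suc j) * act ?v u i)"
    by (rule ext) (rule act_scale)
  also have "act ?v u = act y (u ^ Suc j)" by (simp only: act_mult power_Suc2)
  finally show ?case unfolding eigen_def .
qed

text \<open>Since \<open>z\<^sup>N\<close> is central, the projections \<open>\<Sum>\<^sub>l \<theta>\<^sup>-\<^sup>l y z\<^sup>l\<close> of a row \<open>y\<close>, for the \<open>N\<close> roots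
  \<open>\<theta>\<close> of \<open>X\<^sup>N = z\<^sup>N\<close>, are eigenvectors with sum \<open>N y\<close>.\<close>

lemma eigenvector_exists:
  "\<exists>y \<theta>. row y \<and> y \<noteq> (\<lambda>_. 0) \<and> eigen y (\<iota> z) \<theta> \<and>
     primitive_root_of_unity (p ^ (r + s)) \<theta> \<and> \<theta> ^ N = z ^ N"
proof -
  define \<eta> where "\<eta> = z ^ (p ^ r)"
  define \<theta> where "\<theta> m = z * \<eta> ^ m" for m
  define y0 :: "nat \<Rightarrow> 'k" where "y0 i = (if i = 0 then 1 else 0)" for i
  define Y where "Y l = act y0 (\<iota> z ^ l)" for l
  define W where "W m i = (\<Sum>l<N. inverse (\<theta> m) ^ l * Y l i)" for m i
  have ppos: "p ^ t > 0" for t using prime_p prime_gt_0_nat by simp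
  have z0: "z \<noteq> 0" by (rule primitive_root_nonzero[OF z(1) ppos])
  have \<eta>0: "\<eta> \<noteq> 0" using z0 by (simp add: \<eta>_def)
  have prim\<eta>: "primitive_root_of_unity N \<eta>"
    unfolding \<eta>_def by (rule primitive_root_power) (use z ppos in \<open>simp_all flip: power_add\<close>)
  have row0: "row y0" using N_pos by (auto simp: row_def y0_def)
  have \<theta>_eq: "\<theta> m = z ^ (1 + p ^ r * m)" for m by (simp add: \<theta>_def \<eta>_def power_mult[symmetric])
  have \<theta>0: "\<theta> m \<noteq> 0" for m using z0 by (simp add: \<theta>_eq)
  have \<theta>N: "\<theta> m ^ N = z ^ N" for m
  proof -
    have "\<theta> m ^ N = z ^ N * (\<eta> ^ N) ^ m" by (simp add: \<theta>_def power_mult_distrib power_mult[symmetric] mult.commute)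
    then show ?thesis using prim\<eta> by (simp add: primitive_root_of_unity_def)
  qed
  have Ystep: "act (Y l) (\<iota> z) = Y (Suc l)" for l by (simp only: Y_def act_mult power_Suc2)
  have zNk: "z ^ N \<in> k" using z(3) A_k by blast
  have YN: "Y N i = z ^ N * Y 0 i" for i
  proof -
    have Y0: "Y 0 = y0" using eigen_1[OF row0] by (simp add: Y_def eigen_def)
    show ?thesis unfolding Y0 using act_k[OF row0 zNk] by (simp add: Y_def \<iota>_power[OF z(2)])
  qed
  have eig: "eigen (W m) (\<iota> z) (\<theta> m)" for m
    unfolding eigen_def
  proof
    fix i
    have "act (W m) (\<iota> z) i = (\<Sum>l<N. inverse (\<theta> m) ^ l * Y (Suc l) i)"
      unfolding W_def act_sum_left Ystep ..
    also have "\<dots> = \<theta> m * (\<Sum>l<N. inverse (\<theta> m) ^ Suc l * Y (Suc l) i)"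
      by (simp add: sum_distrib_left mult.assoc[symmetric] \<theta>0)
    \<comment> \<open>The sum is cyclic: its summands of index 0 and N coincide, since z^N acts as
      the scalar \<open>\<theta> m ^ N\<close>.\<close>
    also have "(\<Sum>l<N. inverse (\<theta> m) ^ Suc l * Y (Suc l) i) = W m i"
    proof -
      let ?f = "\<lambda>l. inverse (\<theta> m) ^ l * Y l i"
      have "?f 0 + (\<Sum>l<N. ?f (Suc l)) = (\<Sum>l<N. ?f l) + ?f N"
        by (rule trans[OF sum.lessThan_Suc_shift[symmetric] sum.lessThan_Suc])
      moreover have "?f N = ?f 0"
        using \<theta>N[of m] z0 by (simp add: YN power_inverse)
      ultimately show ?thesis by (simp add: W_def)
    qed
    finally show "act (W m) (\<iota> z) i = \<theta> m * W m i" .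
  qed
  have "\<exists>m. W m \<noteq> (\<lambda>_. 0)"
  proof (rule ccontr)
    assume "\<nexists>m. W m \<noteq> (\<lambda>_. 0)"
    then have W0: "W m i = 0" for m i by (metis)
    have "0 = (\<Sum>m<N. W m 0)" by (simp add: W0)
    also have "\<dots> = (\<Sum>l<N. \<Sum>m<N. inverse (\<theta> m) ^ l * Y l 0)"
      unfolding W_def by (rule sum.swap)
    also have "\<dots> = (\<Sum>l<N. if l = 0 then of_nat N * Y 0 0 else 0)"
    proof (intro sum.cong refl)
      fix l assume l: "l \<in> {..<N}"
      have "(\<Sum>m<N. inverse (\<theta> m) ^ l * Y l 0) = inverse z ^ l * Y l 0 * (\<Sum>m<N. (inverse \<eta> ^ l) ^ m)"
        by (simp add: \<theta>_def power_mult_distrib power_inverse[symmetric] sum_distrib_left sum_distrib_right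
            power_mult[symmetric] mult_ac)
      also have "(\<Sum>m<N. (inverse \<eta> ^ l) ^ m) = (if inverse \<eta> ^ l = 1 then of_nat N else 0)"
      proof (rule sum_powers_root_of_unity)
        have "(inverse \<eta> ^ l) ^ N = inverse ((\<eta> ^ N) ^ l)"
          by (simp add: power_inverse[symmetric] power_mult[symmetric] mult.commute)
        then show "(inverse \<eta> ^ l) ^ N = 1" using prim\<eta> by (simp add: primitive_root_of_unity_def)
      qed
      also have "inverse \<eta> ^ l = 1 \<longleftrightarrow> l = 0"
        using l prim\<eta> unfolding primitive_root_of_unity_def
        by (metis inverse_eq_1_iff lessThan_iff neq0_conv power_0 power_inverse)
      finally show "(\<Sum>m<N. inverse (\<theta> m) ^ l * Y l 0) = (if l = 0 then of_nat N * Y 0 0 else 0)" by simp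
    qed
    also have "\<dots> = of_nat N * Y 0 0" using N_pos by simp
    also have "Y 0 0 = 1"
    proof -
      have "Y 0 = y0" using eigen_1[OF row0] by (simp add: Y_def eigen_def)
      then show ?thesis by (simp add: y0_def)
    qed
    finally show False using N_pos by simp
  qed
  then obtain m where m: "W m \<noteq> (\<lambda>_. 0)" by blast
  have "row (W m)" using row_act by (simp add: row_def W_def Y_def)
  moreover have "primitive_root_of_unity (p ^ (r + s)) (\<theta> m)"
    unfolding \<theta>_eq by (rule primitive_root_power_coprime[OF z(1) ppos one_plus_power_coprime[OF r_ge_1]])
  ultimately show ?thesis using m eig \<theta>N by blast
qed

text \<open>Applying x to the relation and subtracting \<open>\<theta> j0\<close> times the relation
  itself removes the summand for \<open>j0\<close>.\<close>

lemma eigenvectors_independent: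
  assumes "finite J" "\<And>j. j \<in> J \<Longrightarrow> eigen (v j) x (\<theta> j)" "inj_on \<theta> J" "\<And>j. j \<in> J \<Longrightarrow> v j \<noteq> (\<lambda>_. 0)"
    "\<And>i. (\<Sum>j\<in>J. q j * v j i) = 0"
  shows "\<forall>j\<in>J. q j = 0"
  using assms
proof (induction J arbitrary: q rule: finite_induct)
  case (insert j0 J)
  have "(\<Sum>j\<in>J. (q j * (\<theta> j - \<theta> j0)) * v j i) = 0" for i
  proof -
    have "(\<Sum>j\<in>insert j0 J. q j * act (v j) x i) = act (\<lambda>i. \<Sum>j\<in>insert j0 J. q j * v j i) x i"
      by (rule act_sum_left[symmetric])
    also have "\<dots> = 0" unfolding insert.prems(4) by (simp add: act_def)
    finally have "(\<Sum>j\<in>insert j0 J. q j * (\<theta> j * v j i)) = 0"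
      using insert.prems(1) by (simp add: eigen_def)
    moreover have "\<theta> j0 * (\<Sum>j\<in>insert j0 J. q j * v j i) = 0" by (simp only: insert.prems(4) mult_zero_right)
    ultimately have "(\<Sum>j\<in>insert j0 J. q j * (\<theta> j * v j i) - \<theta> j0 * (q j * v j i)) = 0"
      by (simp only: sum_subtractf sum_distrib_left) simp
    then show ?thesis using insert.hyps by (simp add: algebra_simps)
  qed
  then have "\<forall>j\<in>J. q j * (\<theta> j - \<theta> j0) = 0"
    using insert.prems by (intro insert.IH) auto
  moreover have "\<theta> j \<noteq> \<theta> j0" if "j \<in> J" for j
    using insert.prems(2) insert.hyps that by (metis inj_onD insertI1 insertI2)
  ultimately have qJ: "\<forall>j\<in>J. q j = 0" by auto
  then have "q j0 * v j0 i = 0" for i using insert.prems(4)[of i] insert.hyps by simp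
  moreover obtain i where "v j0 i \<noteq> 0" using insert.prems(3)[of j0] by auto
  ultimately show ?case using qJ by auto
qed simp

text \<open>The rows y u^j are nonzero with distinct eigenvalues \<open>\<theta> ^ (G ^ j)\<close>,
  hence form a basis; in it right multiplication by d has the matrix \<open>norm_matrix\<close>. The
  result depends on the splitting only through \<theta>.\<close>

lemma det_\<phi>:
  assumes a: "\<And>j l. j < N \<Longrightarrow> l < N \<Longrightarrow> a j l \<in> A"
    and b: "\<And>j. j < N \<Longrightarrow> b j = (\<Sum>l<N. a j l * (1 - z) ^ l)"
    and d: "d = 1 + \<iota> ((1 - z) ^ n) * (\<Sum>j<N. \<iota> (b j) * u ^ j)"
  shows "\<exists>\<theta>. cyclotomic_tower p r s \<theta> A \<and> \<theta> ^ N = z ^ N \<and>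
    det (\<phi> d) = det (cyclotomic_tower.norm_matrix p r s \<theta> n a c0)"
proof -
  obtain y \<theta> where y: "row y" "y \<noteq> (\<lambda>_. 0)" "eigen y (\<iota> z) \<theta>"
    and \<theta>: "primitive_root_of_unity (p ^ (r + s)) \<theta>" "\<theta> ^ N = z ^ N"
    using eigenvector_exists by blast
  interpret T: cyclotomic_tower p r s \<theta> A
    by unfold_locales (use prime_p odd_p r_ge_1 subring_A \<theta> z in simp_all)
  define v where "v j = act y (u ^ j)" for j
  define \<theta>j where "\<theta>j j = \<theta> ^ (T.G ^ j)" for j
  have row_v: "row (v j)" for j by (simp add: v_def row_act)
  have eig: "eigen (v j) (\<iota> z) (\<theta>j j)" for j
    unfolding v_def \<theta>j_def T.G_def by (rule eigen_u[OF y(1,3)])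
  have v_add: "act (v j) (u ^ m) = v (j + m)" for j m by (simp only: v_def act_mult power_add)
  have v_N: "v (N + j) i = c0 * v j i" for j i
  proof -
    have "v (N + j) = act (act y (\<iota> c0)) (u ^ j)" by (simp only: v_def power_add act_mult u_N)
    also have "act y (\<iota> c0) = (\<lambda>i. c0 * y i)" using act_k[OF y(1)] c0(1) A_k by auto
    finally show ?thesis by (simp add: act_scale v_def)
  qed
  \<comment> \<open>Multiplication by the remaining power of u leads to \<open>v N\<close>, which is
    \<open>c0\<close> times the nonzero row y.\<close>
  have v_nz: "v j \<noteq> (\<lambda>_. 0)" if j: "j < N" for j
  proof
    assume "v j = (\<lambda>_. 0)"
    then have "act (v j) (u ^ (N - j)) i = 0" for i by (simp add: act_def)
    then have "v N i = 0" for i using j by (simp add: v_add)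
    then have "c0 * v 0 i = 0" for i using v_N[of 0] by simp
    then have "v 0 i = 0" for i using c0 by simp
    moreover have "v 0 = y" using eigen_1[OF y(1)] by (simp add: v_def eigen_def)
    ultimately show False using y(2) by auto
  qed
  have inj: "inj_on \<theta>j {..<N}"
  proof (rule inj_onI)
    fix i j assume ij: "i \<in> {..<N}" "j \<in> {..<N}" "\<theta>j i = \<theta>j j"
    then have "[i = j] (mod N)"
      unfolding \<theta>j_def primitive_root_power_eq_iff[OF \<theta>(1) T.ppow_gt_0] T.G_def
      by (simp only: one_plus_power_cong_iff[OF prime_p odd_p r_ge_1])
    then show "i = j" using ij by (simp add: cong_def)
  qed
  define V where "V = mat N N (\<lambda>(j, i). v j i)"
  have V: "V \<in> carrier_mat N N" by (simp add: V_def)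
  have detV: "det V \<noteq> 0"
  proof
    assume "det V = 0"
    then have "det (transpose_mat V) = 0" by (simp add: det_transpose[OF V])
    then obtain q where q: "q \<in> carrier_vec N" "q \<noteq> 0\<^sub>v N" "transpose_mat V *\<^sub>v q = 0\<^sub>v N"
      using det_0_iff_vec_prod_zero[of "transpose_mat V" N] V by auto
    have "(\<Sum>j<N. q $ j * v j i) = 0" for i
    proof (cases "i < N")
      case True
      have "(\<Sum>j<N. q $ j * v j i) = (transpose_mat V *\<^sub>v q) $ i"
        using True q(1) by (auto simp: V_def scalar_prod_def atLeast0LessThan mult.commute)
      then show ?thesis using True by (simp add: q(3))
    next
      case False
      then show ?thesis using row_v by (simp add: row_def)
    qed
    then have "\<forall>j\<in>{..<N}. q $ j = 0"
      using eig v_nz inj by (intro eigenvectors_independent[of "{..<N}" v "\<iota> z" \<theta>j]) auto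
    then have "q = 0\<^sub>v N" using q(1) by (intro eq_vecI) auto
    then show False using q(2) by simp
  qed
  define \<beta> where "\<beta> m x = (\<Sum>l<N. a m l * (1 - x) ^ l)" for m x
  have act_d: "act (v j) d i = v j i + (1 - \<theta>j j) ^ n * (\<Sum>m<N. \<beta> m (\<theta>j j) * v (j + m) i)" for j i
  proof -
    have zK: "1 - z \<in> K" by (intro subring_intros subring_K z)
    have "eigen (v j) (1 - \<iota> z) (1 - \<theta>j j)" by (intro eigen_diff eigen_1 eig row_v)
    then have "eigen (v j) ((1 - \<iota> z) ^ n) ((1 - \<theta>j j) ^ n)" by (rule eigen_power[OF row_v])
    moreover have "\<iota> ((1 - z) ^ n) = (1 - \<iota> z) ^ n"
      using zK by (simp add: \<iota>_power \<iota>_diff \<iota>_1 z subring_1[OF subring_K])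
    ultimately have e1: "act (v j) (\<iota> ((1 - z) ^ n)) = (\<lambda>i. (1 - \<theta>j j) ^ n * v j i)" by (simp add: eigen_def)
    have e2: "act (v j) (\<iota> (b m) * u ^ m) i = \<beta> m (\<theta>j j) * v (j + m) i" if "m < N" for m i
    proof -
      have "eigen (v j) (\<iota> (b m)) (\<beta> m (\<theta>j j))"
        unfolding b[OF that] \<beta>_def by (rule eigen_expansion[OF row_v eig]) (use a that in simp)
      then have "act (v j) (\<iota> (b m)) = (\<lambda>i. \<beta> m (\<theta>j j) * v j i)" by (simp add: eigen_def)
      then show ?thesis by (simp add: act_mult act_scale v_add)
    qed
    have "act (v j) 1 i = v j i" using eigen_1[OF row_v] by (simp add: eigen_def)
    moreover have "(\<Sum>m<N. act (v j) (\<iota> (b m) * u ^ m) i) = (\<Sum>m<N. \<beta> m (\<theta>j j) * v (j + m) i)"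
      by (intro sum.cong refl e2) simp
    ultimately show ?thesis
      unfolding d act_add act_mult[of _ "\<iota> ((1 - z) ^ n)"] e1 act_scale act_sum by simp
  qed
  have "V * \<phi> d = T.norm_matrix n a c0 * V"
  proof (rule eq_matI)
    show "dim_row (V * \<phi> d) = dim_row (T.norm_matrix n a c0 * V)" "dim_col (V * \<phi> d) = dim_col (T.norm_matrix n a c0 * V)"
      using \<phi>_carrier[of d] by (simp_all add: V_def T.norm_matrix_def)
  next
    fix j i assume "j < dim_row (T.norm_matrix n a c0 * V)" "i < dim_col (T.norm_matrix n a c0 * V)"
    then have ji: "j < N" "i < N" by (simp_all add: V_def T.norm_matrix_def)
    have "(V * \<phi> d) $$ (j, i) = act (v j) d i"
      using ji \<phi>_carrier[of d] by (simp add: V_def scalar_prod_def act_def atLeast0LessThan)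
    also have "\<dots> = v j i + (1 - \<theta>j j) ^ n * (\<Sum>m<N. \<beta> m (\<theta>j j) * v (j + m) i)" by (rule act_d)
    \<comment> \<open>The exponent m of u is replaced by the column x = j + m modulo N; passing N
      costs the factor \<open>c0\<close>.\<close>
    also have "(\<Sum>m<N. \<beta> m (\<theta>j j) * v (j + m) i) =
        (\<Sum>x<N. \<beta> ((x + N - j) mod N) (\<theta>j j) * (if x < j then c0 else 1) * v x i)"
    proof (rule sum.reindex_bij_witness[of _ "\<lambda>x. (x + N - j) mod N" "\<lambda>m. (j + m) mod N"])
      fix m assume m: "m \<in> {..<N}"
      then show "((j + m) mod N + N - j) mod N = m" using ji by (auto simp: mod_if)
      show "(j + m) mod N \<in> {..<N}" using N_pos by simp
      have "v (j + m) i = (if (j + m) mod N < j then c0 else 1) * v ((j + m) mod N) i"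
      proof (cases "j + m < N")
        case False
        then have "j + m = N + (j + m - N)" by simp
        then have "v (j + m) i = c0 * v (j + m - N) i" using v_N[of "j + m - N" i] by simp
        moreover have "(j + m) mod N = j + m - N" "j + m - N < j" using m ji False by (auto simp: mod_if)
        ultimately show ?thesis by simp
      qed simp
      then show "\<beta> (((j + m) mod N + N - j) mod N) (\<theta>j j) * (if (j + m) mod N < j then c0 else 1) * v ((j + m) mod N) i =
          \<beta> m (\<theta>j j) * v (j + m) i"
        using \<open>((j + m) mod N + N - j) mod N = m\<close> by simp
    next
      fix x assume x: "x \<in> {..<N}"
      then show "(j + (x + N - j) mod N) mod N = x" using ji by (auto simp: mod_if)
      show "(x + N - j) mod N \<in> {..<N}" using N_pos by simp
    qed
    also have "v j i + (1 - \<theta>j j) ^ n * (\<Sum>x<N. \<beta> ((x + N - j) mod N) (\<theta>j j) * (if x < j then c0 else 1) * v x i) =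
       (\<Sum>x<N. ((if j = x then 1 else 0) + (1 - \<theta>j j) ^ n * \<beta> ((x + N - j) mod N) (\<theta>j j) * (if x < j then c0 else 1)) * v x i)"
    proof -
      have "v j i = (\<Sum>x<N. (if j = x then 1 else 0) * v x i)"
      proof -
        have "(\<Sum>x<N. (if j = x then 1 else 0) * v x i) = (\<Sum>x<N. if j = x then v x i else 0)"
          by (intro sum.cong) auto
        then show ?thesis using ji by simp
      qed
      then show ?thesis by (simp add: distrib_right sum.distrib sum_distrib_left mult.assoc)
    qed
    also have "\<dots> = (T.norm_matrix n a c0 * V) $$ (j, i)"
      using ji by (simp add: V_def T.norm_matrix_def scalar_prod_def atLeast0LessThan \<theta>j_def \<beta>_def)
    finally show "(V * \<phi> d) $$ (j, i) = (T.norm_matrix n a c0 * V) $$ (j, i)" .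
  qed
  then have "det V * det (\<phi> d) = det (T.norm_matrix n a c0) * det V"
    using det_mult[OF V \<phi>_carrier[of d]] det_mult[OF _ V, of "T.norm_matrix n a c0"]
    by (simp add: T.norm_matrix_def)
  then have "det (\<phi> d) = det (T.norm_matrix n a c0)" using detV by simp
  then show ?thesis using T.cyclotomic_tower_axioms \<theta>(2) by blast
qed

end

section \<open>Rings of integers\<close>

lemma char_poly_over:
  assumes S: "is_subring S" and C: "C \<in> carrier_mat m m" "\<And>i j. i < m \<Longrightarrow> j < m \<Longrightarrow> C $$ (i, j) \<in> S"
  shows "char_poly C \<in> polys_over S"
proof -
  note SP = subring_polys_over[OF S]
  have "char_poly C = (\<Sum>\<sigma> | \<sigma> permutes {0..<m}. of_int (sign \<sigma>) * (\<Prod>i = 0..<m. char_poly_matrix C $$ (i, \<sigma> i)))"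
    unfolding char_poly_def using C(1) by (intro det_def') auto
  moreover have "of_int (sign \<sigma>) \<in> polys_over S" for \<sigma> :: "nat \<Rightarrow> nat"
    by (cases \<sigma> rule: sign_cases) (auto intro: subring_intros SP)
  moreover have "char_poly_matrix C $$ (i, \<sigma> i) \<in> polys_over S" if "\<sigma> permutes {0..<m}" "i < m" for \<sigma> i
  proof -
    have "\<sigma> i < m" using that permutes_in_image[of \<sigma> "{0..<m}" i] by simp
    then show ?thesis using C that
      by (auto simp: char_poly_matrix_def polys_over_pCons S intro!: subring_intros S SP)
  qed
  ultimately show ?thesis by (auto intro!: subring_intros SP)
qed

text \<open>The determinant trick: the vector of the \<open>e i\<close> is an eigenvector, with
  eigenvalue w, of a matrix over \<open>S\<close>, and the characteristic polynomial of that matrix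
  is monic over \<open>S\<close>.\<close>

lemma integral_if_finite_module:
  fixes e :: "nat \<Rightarrow> 'a::field"
  assumes S: "is_subring S"
    and stable: "\<And>i. i < m \<Longrightarrow> \<exists>q. (\<forall>j<m. q j \<in> S) \<and> w * e i = (\<Sum>j<m. q j * e j)"
    and nz: "i0 < m" "e i0 \<noteq> 0"
  shows "\<exists>f. lead_coeff f = 1 \<and> (\<forall>i. coeff f i \<in> S) \<and> poly f w = 0"
proof -
  obtain q where q: "\<And>i j. i < m \<Longrightarrow> j < m \<Longrightarrow> q i j \<in> S"
      "\<And>i. i < m \<Longrightarrow> w * e i = (\<Sum>j<m. q i j * e j)"
    using stable by metis
  define C where "C = mat m m (\<lambda>(i, j). q i j)"
  have C: "C \<in> carrier_mat m m" by (simp add: C_def)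
  have "eigenvector C (vec m e) w"
    unfolding eigenvector_def
  proof (intro conjI)
    show "vec m e \<in> carrier_vec (dim_row C)" by (simp add: C_def)
    show "vec m e \<noteq> 0\<^sub>v (dim_row C)"
    proof
      assume "vec m e = 0\<^sub>v (dim_row C)"
      then have "vec m e $ i0 = 0\<^sub>v m $ i0" by (simp add: C_def)
      then show False using nz by simp
    qed
    show "C *\<^sub>v vec m e = w \<cdot>\<^sub>v vec m e"
      by (rule eq_vecI) (auto simp: C_def scalar_prod_def q(2) atLeast0LessThan)
  qed
  then have "poly (char_poly C) w = 0"
    using eigenvalue_root_char_poly[OF C] by (auto simp: eigenvalue_def)
  moreover have "lead_coeff (char_poly C) = 1" using degree_monic_char_poly[OF C] by simp
  moreover have "char_poly C \<in> polys_over S"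
    by (rule char_poly_over[OF S C]) (simp add: C_def q)
  ultimately show ?thesis by (auto simp: polys_over_def)
qed

lemma monic_root_power:
  fixes x :: "'a::comm_ring_1"
  assumes "lead_coeff f = 1" "poly f x = 0"
  shows "x ^ degree f = (\<Sum>i<degree f. - coeff f i * x ^ i)"
proof -
  have "0 = (\<Sum>i\<le>degree f. coeff f i * x ^ i)" using assms by (simp add: poly_altdef)
  also have "\<dots> = (\<Sum>i<degree f. coeff f i * x ^ i) + x ^ degree f"
    using assms(1) by (simp add: lessThan_Suc_atMost[symmetric])
  finally show ?thesis by (simp add: sum_negf eq_neg_iff_add_eq_0 add.commute)
qed

text \<open>Multiplication by x and by y maps the \<open>S\<close>-span of the products x^i y^j with
  i < m and j < n into itself, so the same holds for x - y and x y.\<close>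

lemma integral_closed:
  fixes x y :: "'a::field"
  assumes S: "is_subring S"
    and f: "lead_coeff f = 1" "\<And>i. coeff f i \<in> S" "poly f x = 0"
    and h: "lead_coeff h = 1" "\<And>i. coeff h i \<in> S" "poly h y = 0"
  shows "\<exists>f. lead_coeff f = 1 \<and> (\<forall>i. coeff f i \<in> S) \<and> poly f (x - y) = 0"
    and "\<exists>f. lead_coeff f = 1 \<and> (\<forall>i. coeff f i \<in> S) \<and> poly f (x * y) = 0"
proof -
  define m n where "m = degree f" and "n = degree h"
  have pos: "degree f > 0" if "lead_coeff f = 1" "poly f x = 0" for f and x :: 'a
  proof (rule ccontr)
    assume "\<not> degree f > 0"
    then obtain q where "f = [:q:]" by (metis degree_eq_zeroE neq0_conv)
    then show False using that by simp
  qed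
  have pos: "m > 0" "n > 0" unfolding m_def n_def using pos f h by blast+
  define e where "e k = x ^ (k div n) * y ^ (k mod n)" for k
  define span where "span = {\<Sum>k<m * n. q k * e k | q. \<forall>k<m * n. q k \<in> S}"
  have span_e: "e k \<in> span" if "k < m * n" for k
    unfolding span_def using that
    by (intro CollectI exI[of _ "\<lambda>l. if l = k then 1 else 0"])
      (auto simp: if_distrib[of "\<lambda>q. q * _"] intro: subring_intros S cong: if_cong)
  have span_D: "\<exists>q. (\<forall>j<m * n. q j \<in> S) \<and> a = (\<Sum>j<m * n. q j * e j)" if "a \<in> span" for a
    using that by (auto simp: span_def)
  have span_add: "a + b \<in> span" if "a \<in> span" "b \<in> span" for a b
  proof -
    obtain q q' where "\<forall>k<m * n. q k \<in> S" "a = (\<Sum>k<m * n. q k * e k)" "\<forall>k<m * n. q' k \<in> S" "b = (\<Sum>k<m * n. q' k * e k)"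
      using span_D[OF \<open>a \<in> span\<close>] span_D[OF \<open>b \<in> span\<close>] by blast
    then show ?thesis unfolding span_def
      by (intro CollectI exI[of _ "\<lambda>k. q k + q' k"]) (auto simp: sum.distrib distrib_right intro: subring_add S)
  qed
  have span_scale: "q * a \<in> span" if "a \<in> span" "q \<in> S" for a q
  proof -
    obtain q' where "\<forall>k<m * n. q' k \<in> S" "a = (\<Sum>k<m * n. q' k * e k)"
      using span_D[OF \<open>a \<in> span\<close>] by blast
    then show ?thesis unfolding span_def using \<open>q \<in> S\<close>
      by (intro CollectI exI[of _ "\<lambda>k. q * q' k"]) (auto simp: sum_distrib_left mult.assoc intro: subring_mult S)
  qed
  have span_0: "0 \<in> span" unfolding span_def
    by (intro CollectI exI[of _ "\<lambda>_. 0"]) (auto intro: subring_0 S)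
  have span_sum: "sum t I \<in> span" if "\<And>i. i \<in> I \<Longrightarrow> t i \<in> span" for t :: "nat \<Rightarrow> 'a" and I
    using that by (induction I rule: infinite_finite_induct) (auto intro: span_0 span_add)
  have e_eq: "e (i * n + j) = x ^ i * y ^ j" if "j < n" for i j
    using that by (simp add: e_def)
  have index: "i * n + j < m * n" if "i < m" "j < n" for i j
  proof -
    have "i * n + j < Suc i * n" using that by simp
    also have "\<dots> \<le> m * n" using that by (intro mult_right_mono) auto
    finally show ?thesis .
  qed
  have monom_in: "x ^ i * y ^ j \<in> span" if "i \<le> m" "j < n" for i j
  proof (cases "i = m")
    case True
    have "x ^ m * y ^ j = (\<Sum>i<m. - coeff f i * (x ^ i * y ^ j))"
      unfolding m_def monic_root_power[OF f(1,3)] by (simp add: sum_distrib_right mult.assoc)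
    also have "\<dots> \<in> span"
    proof (rule span_sum, rule span_scale)
      show "- coeff f i \<in> S" for i by (intro subring_uminus S f(2))
      show "x ^ i * y ^ j \<in> span" if "i \<in> {..<m}" for i
        using span_e[OF index[of i j]] e_eq[of j i] that \<open>j < n\<close> by simp
    qed
    finally show ?thesis by (simp add: True)
  next
    case False
    then show ?thesis using that span_e[OF index[of i j]] e_eq[of j i] by simp
  qed
  have monom_in': "x ^ i * y ^ j \<in> span" if "i < m" "j \<le> n" for i j
  proof (cases "j = n")
    case True
    have "x ^ i * y ^ n = (\<Sum>j<n. - coeff h j * (x ^ i * y ^ j))"
      unfolding n_def monic_root_power[OF h(1,3)] by (simp add: sum_distrib_left mult_ac)
    also have "\<dots> \<in> span"
    proof (rule span_sum, rule span_scale)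
      show "- coeff h j \<in> S" for j by (intro subring_uminus S h(2))
      show "x ^ i * y ^ j \<in> span" if "j \<in> {..<n}" for j
        using that \<open>i < m\<close> by (intro monom_in) auto
    qed
    finally show ?thesis by (simp add: True)
  qed (use that in \<open>auto intro: monom_in\<close>)
  have x_e: "x * e k \<in> span" and y_e: "y * e k \<in> span" if "k < m * n" for k
  proof -
    have km: "k div n < m" using that pos by (simp add: div_less_iff_less_mult)
    have kn: "k mod n < n" using pos by simp
    have e: "x * e k = x ^ Suc (k div n) * y ^ (k mod n)" "y * e k = x ^ (k div n) * y ^ Suc (k mod n)"
      by (simp_all add: e_def mult_ac)
    show "x * e k \<in> span" unfolding e using km kn by (intro monom_in) auto
    show "y * e k \<in> span" unfolding e using km kn by (intro monom_in') auto
  qed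
  have x_span: "x * a \<in> span" if "a \<in> span" for a
  proof -
    obtain q where q: "\<forall>k<m * n. q k \<in> S" "a = (\<Sum>k<m * n. q k * e k)"
      using span_D[OF \<open>a \<in> span\<close>] by blast
    have "x * a = (\<Sum>k<m * n. q k * (x * e k))" by (simp add: q(2) sum_distrib_left mult_ac)
    also have "\<dots> \<in> span" using q(1) by (intro span_sum span_scale[OF x_e]) auto
    finally show ?thesis .
  qed
  have nz: "0 < m * n" "e 0 \<noteq> 0" using pos by (simp_all add: e_def)
  show "\<exists>f. lead_coeff f = 1 \<and> (\<forall>i. coeff f i \<in> S) \<and> poly f (x - y) = 0"
  proof (rule integral_if_finite_module[where e = e, OF S _ nz])
    fix k assume k: "k < m * n"
    have "(x - y) * e k = x * e k + (- 1) * (y * e k)" by (simp add: algebra_simps)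
    also have "\<dots> \<in> span" by (intro span_add span_scale x_e y_e k subring_intros S)
    finally show "\<exists>q. (\<forall>j<m * n. q j \<in> S) \<and> (x - y) * e k = (\<Sum>j<m * n. q j * e j)" by (rule span_D)
  qed
  show "\<exists>f. lead_coeff f = 1 \<and> (\<forall>i. coeff f i \<in> S) \<and> poly f (x * y) = 0"
  proof (rule integral_if_finite_module[where e = e, OF S _ nz])
    fix k assume k: "k < m * n"
    have "x * y * e k \<in> span" unfolding mult.assoc by (intro x_span y_e k)
    then show "\<exists>q. (\<forall>j<m * n. q j \<in> S) \<and> x * y * e k = (\<Sum>j<m * n. q j * e j)" by (rule span_D)
  qed
qed

lemma is_subring_subfield: "is_subfield F \<Longrightarrow> is_subring F"
  by (auto simp: is_subfield_def is_subring_def)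

lemma subring_integral_closure:
  assumes S: "is_subring S" and F: "is_subfield F"
  shows "is_subring (integral_closure S F)"
  unfolding is_subring_def
proof (intro conjI ballI)
  have "lead_coeff [:- 1, 1:] = (1::'a)" "poly [:- 1, 1:] (1::'a) = 0" by simp_all
  moreover have "\<forall>i. coeff [:- 1, 1 :: 'a:] i \<in> S"
    by (auto simp: coeff_pCons split: nat.splits intro: subring_intros S)
  ultimately show "1 \<in> integral_closure S F"
    using subring_1[OF is_subring_subfield[OF F]] unfolding integral_closure_def by blast
next
  fix x y assume xy: "x \<in> integral_closure S F" "y \<in> integral_closure S F"
  then obtain f h where f: "lead_coeff f = 1" "\<And>i. coeff f i \<in> S" "poly f x = 0"
    and h: "lead_coeff h = 1" "\<And>i. coeff h i \<in> S" "poly h y = 0" by (auto simp: integral_closure_def)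
  have "x - y \<in> F" "x * y \<in> F"
    using xy is_subring_subfield[OF F] by (auto simp: integral_closure_def intro: subring_diff subring_mult)
  then show "x - y \<in> integral_closure S F" "x * y \<in> integral_closure S F"
    unfolding integral_closure_def using integral_closed[OF S f h] by blast+
qed

text \<open>If t exceeded 1, its powers would grow at least linearly by Bernoulli, so their squares
  would grow quadratically, against a linear bound.\<close>

lemma bounded_powers_le_1:
  fixes t :: real
  assumes "t \<ge> 0" "\<And>m. t ^ m \<le> of_nat (m + 1)"
  shows "t \<le> 1"
proof (rule ccontr)
  assume "\<not> t \<le> 1"
  define h where "h = t - 1"
  have h: "h > 0" "t = 1 + h" using \<open>\<not> t \<le> 1\<close> by (auto simp: h_def)
  obtain m :: nat where m: "3 / h\<^sup>2 < of_nat m" using reals_Archimedean2 by blast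
  then have m0: "m > 0" using h by (cases m) auto
  have "1 + of_nat m * h \<le> t ^ m" using h Bernoulli_inequality[of h m] by simp
  then have "(of_nat m * h)\<^sup>2 \<le> (t ^ m)\<^sup>2" using h by (intro power_mono) auto
  also have "(t ^ m)\<^sup>2 = t ^ (m * 2)" by (simp add: power_mult)
  also have "\<dots> \<le> of_nat (m * 2 + 1)" by (rule assms(2))
  also have "\<dots> \<le> 3 * of_nat m" using m0 by simp
  finally have "of_nat m * (of_nat m * h\<^sup>2) \<le> of_nat m * (3::real)" by (simp add: power2_eq_square mult_ac)
  then have "of_nat m * h\<^sup>2 \<le> 3" using m0 by simp
  moreover have "3 < of_nat m * h\<^sup>2" using m h by (simp add: field_simps)
  ultimately show False by simp
qed

lemma padic_abs_of_nat_le_1: "prime p \<Longrightarrow> padic_abs p (of_nat m) \<le> 1"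
proof -
  assume p: "prime p"
  have "quotient_of (of_nat m) = (int m, 1)" using quotient_of_int[of "int m"] by simp
  moreover have "real p powi (- int k) \<le> 1" for k
    using p prime_ge_1_nat[OF p] by (simp add: power_int_minus inverse_le_1_iff one_le_power)
  ultimately show ?thesis by (simp add: padic_abs_def)
qed

text \<open>The absolute value is only assumed to satisfy the triangle inequality; it is ultrametric
  since it is bounded on the integers.\<close>

lemma subring_padic_integers:
  assumes p: "prime p" and Q: "is_padic_field p Q av"
  shows "is_subring {x \<in> Q. av x \<le> 1}"
proof -
  have SQ: "is_subring Q" using Q is_subring_subfield by (auto simp: is_padic_field_def)
  have nn: "av x \<ge> 0" if "x \<in> Q" for x using Q that by (simp add: is_padic_field_def)
  have mult: "av (x * y) = av x * av y" if "x \<in> Q" "y \<in> Q" for x y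
    using Q that by (simp add: is_padic_field_def)
  have tri: "av (x + y) \<le> av x + av y" if "x \<in> Q" "y \<in> Q" for x y
    using Q that by (simp add: is_padic_field_def)
  have rat: "av (of_rat q) = padic_abs p q" for q using Q by (simp add: is_padic_field_def)
  have nat1: "av (of_nat m) \<le> 1" for m
    using rat[of "of_nat m"] padic_abs_of_nat_le_1[OF p] by simp
  have av1: "av 1 = 1" using rat[of 1] by (simp add: padic_abs_def)
  have av0: "av 0 = 0" using rat[of 0] by (simp add: padic_abs_def)
  have pow: "av (x ^ m) = av x ^ m" if "x \<in> Q" for x m
    by (induction m) (simp_all add: av1 mult that subring_power[OF SQ])
  have sum: "av (sum f I) \<le> (\<Sum>i\<in>I. av (f i))" if "\<And>i. i \<in> I \<Longrightarrow> f i \<in> Q" for f :: "nat \<Rightarrow> 'a" and I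
    using that
  proof (induction I rule: infinite_finite_induct)
    case (insert i I)
    have "av (f i + sum f I) \<le> av (f i) + av (sum f I)"
      using insert by (intro tri subring_sum SQ) auto
    then show ?case using insert by fastforce
  qed (simp_all add: av0)
  have add: "av (x + y) \<le> 1" if xy: "x \<in> Q" "av x \<le> 1" "y \<in> Q" "av y \<le> 1" for x y
  proof (rule bounded_powers_le_1)
    show "av (x + y) \<ge> 0" by (intro nn subring_add SQ xy)
    fix m
    \<comment> \<open>Each of the m + 1 binomial summands has absolute value at most 1, so the
      powers are bounded linearly.\<close>
    have "av (x + y) ^ m = av (\<Sum>i\<le>m. of_nat (m choose i) * x ^ i * y ^ (m - i))"
      by (simp add: pow[symmetric] subring_add SQ xy binomial_ring)
    also have "\<dots> \<le> (\<Sum>i\<le>m. av (of_nat (m choose i) * x ^ i * y ^ (m - i)))"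
      by (intro sum subring_intros SQ xy)
    also have "\<dots> \<le> (\<Sum>i\<le>m. 1)"
    proof (rule sum_mono)
      fix i
      have "av (of_nat (m choose i) * x ^ i * y ^ (m - i)) = av (of_nat (m choose i)) * av x ^ i * av y ^ (m - i)"
        by (simp add: mult pow subring_of_nat subring_power subring_mult SQ xy)
      also have "\<dots> \<le> 1 * 1 * 1"
        by (intro mult_mono nat1 power_le_one nn xy mult_nonneg_nonneg zero_le_power) (use SQ in \<open>auto intro: subring_of_nat\<close>)
      finally show "av (of_nat (m choose i) * x ^ i * y ^ (m - i)) \<le> 1" by simp
    qed
    finally show "av (x + y) ^ m \<le> of_nat (m + 1)" by simp
  qed
  have m1: "- 1 \<in> Q" by (intro subring_intros SQ)
  have "av (- 1) * av (- 1) = 1" using mult[OF m1 m1] av1 by simp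
  then have avm1: "av (- 1) = 1" using nn[OF m1] power2_eq_1_iff[of "av (- 1)"] by (auto simp: power2_eq_square)
  show ?thesis unfolding is_subring_def
  proof (intro conjI ballI)
    show "1 \<in> {x \<in> Q. av x \<le> 1}" using av1 by (auto intro: subring_1 SQ)
    fix x y assume xy: "x \<in> {x \<in> Q. av x \<le> 1}" "y \<in> {x \<in> Q. av x \<le> 1}"
    then have xQ: "x \<in> Q" "y \<in> Q" "av x \<le> 1" "av y \<le> 1" by simp_all
    have my: "(- 1) * y \<in> Q" by (intro subring_mult SQ m1 xQ)
    have my': "av ((- 1) * y) \<le> 1" unfolding mult[OF m1 xQ(2)] avm1 using xQ by simp
    have "av (x + (- 1) * y) \<le> 1" by (rule add[OF xQ(1,3) my my'])
    then show "x - y \<in> {x \<in> Q. av x \<le> 1}" using subring_diff[OF SQ xQ(1,2)] by simp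
    have "av (x * y) \<le> 1" unfolding mult[OF xQ(1,2)] by (intro mult_le_one nn xQ)
    then show "x * y \<in> {x \<in> Q. av x \<le> 1}" using subring_mult[OF SQ xQ(1,2)] by simp
  qed
qed

lemma subring_ring_of_integers:
  assumes "prime p" "is_padic_field p Q av" "finite_extension Q F"
  shows "is_subring (ring_of_integers Q av F)"
  unfolding ring_of_integers_def
  using assms subring_padic_integers by (intro subring_integral_closure) (auto simp: finite_extension_def)

section \<open>Adjoining a root of unity\<close>

lemma adjoin_eq: "adjoin R z = (\<lambda>f. poly f z) ` polys_over R"
  by (auto simp: adjoin_def polys_over_def)

lemma subring_adjoin:
  assumes "is_subring R" shows "is_subring (adjoin R z)"
proof -
  note SP = subring_polys_over[OF assms]
  show ?thesis unfolding is_subring_def adjoin_eq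
  proof (intro conjI ballI)
    show "1 \<in> (\<lambda>f. poly f z) ` polys_over R" by (rule image_eqI[of _ _ 1]) (auto intro: subring_1 SP)
    fix x y assume "x \<in> (\<lambda>f. poly f z) ` polys_over R" "y \<in> (\<lambda>f. poly f z) ` polys_over R"
    then obtain f h where fh: "f \<in> polys_over R" "h \<in> polys_over R" "x = poly f z" "y = poly h z" by blast
    show "x - y \<in> (\<lambda>f. poly f z) ` polys_over R"
      by (rule image_eqI[of _ _ "f - h"]) (auto simp: fh intro: subring_diff SP)
    show "x * y \<in> (\<lambda>f. poly f z) ` polys_over R"
      by (rule image_eqI[of _ _ "f * h"]) (auto simp: fh intro: subring_mult SP)
  qed
qed

lemma base_subset_adjoin: "is_subring R \<Longrightarrow> R \<subseteq> adjoin R z"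
proof
  fix x assume R: "is_subring R" and x: "x \<in> R"
  show "x \<in> adjoin R z" unfolding adjoin_eq
    by (rule image_eqI[of _ _ "[:x:]"]) (auto simp: polys_over_pCons R x subring_0 subring_polys_over)
qed

lemma generator_in_adjoin: "is_subring R \<Longrightarrow> z \<in> adjoin R z"
  unfolding adjoin_eq by (rule image_eqI[of _ _ "monom 1 1"]) (auto simp: poly_monom polys_over_monom subring_1)

lemma adjoin_least:
  assumes "is_subring S" "R \<subseteq> S" "z \<in> S" shows "adjoin R z \<subseteq> S"
  using assms by (auto simp: adjoin_def poly_altdef intro!: subring_intros)

locale local_cyclotomic_ring =
  fixes p t :: nat and R :: "'a::field_char_0 set" and \<zeta> :: 'a
  assumes prime_p: "prime p" and odd_p: "odd p" and subring_R: "is_subring R"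
    and nonunits_R: "{x \<in> R. \<not> (\<exists>y\<in>R. x * y = 1)} = (\<lambda>x. of_nat p * x) ` R"
    and prim_\<zeta>: "primitive_root_of_unity (p ^ t) \<zeta>"
begin

lemma subring_adj: "is_subring (adjoin R \<zeta>)"
  by (rule subring_adjoin[OF subring_R])

lemma \<zeta>_power_1: "\<zeta> ^ (p ^ t) = 1"
  using prim_\<zeta> by (simp add: primitive_root_of_unity_def)

lemma one_not_multiple: "y \<in> R \<Longrightarrow> of_nat p * y \<noteq> 1"
proof
  assume "y \<in> R" "of_nat p * y = 1"
  then have "1 \<in> {x \<in> R. \<not> (\<exists>y\<in>R. x * y = 1)}" unfolding nonunits_R by (metis imageI)
  then show False using subring_1[OF subring_R] by auto
qed

text \<open>Nakayama's lemma for \<open>R[\<zeta>]\<close>, eliminating one power of \<open>\<zeta>\<close> at a time.\<close>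

lemma p_not_unit: "y \<in> adjoin R \<zeta> \<Longrightarrow> of_nat p * y \<noteq> 1"
proof
  assume y: "y \<in> adjoin R \<zeta>" and py: "of_nat p * y = 1"
  define span where "span j = {\<Sum>i<j. q i * \<zeta> ^ i | q. \<forall>i<j. q i \<in> R}" for j
  have ppos: "p ^ t > 0" using prime_p prime_gt_0_nat by simp
  have full: "adjoin R \<zeta> \<subseteq> span (p ^ t)"
  proof
    fix x assume "x \<in> adjoin R \<zeta>"
    then obtain f where f: "x = poly f \<zeta>" "\<And>i. coeff f i \<in> R" by (auto simp: adjoin_def)
    have "x = (\<Sum>i\<le>degree f. coeff f i * \<zeta> ^ (i mod p ^ t))"
      unfolding f(1) poly_altdef
      by (intro sum.cong refl arg_cong2[where f = "(*)"] primitive_root_power_cong[OF prim_\<zeta>]) simp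
    also have "\<dots> = (\<Sum>i\<le>degree f. \<Sum>l<p ^ t. if l = i mod p ^ t then coeff f i * \<zeta> ^ l else 0)"
      using ppos by (simp cong: if_cong)
    also have "\<dots> = (\<Sum>l<p ^ t. \<Sum>i\<le>degree f. if l = i mod p ^ t then coeff f i * \<zeta> ^ l else 0)"
      by (rule sum.swap)
    also have "\<dots> = (\<Sum>l<p ^ t. (\<Sum>i\<le>degree f. if l = i mod p ^ t then coeff f i else 0) * \<zeta> ^ l)"
      unfolding sum_distrib_right by (intro sum.cong refl) auto
    finally have "x = (\<Sum>l<p ^ t. (\<Sum>i\<le>degree f. if l = i mod p ^ t then coeff f i else 0) * \<zeta> ^ l)" .
    moreover have "(\<Sum>i\<le>degree f. if l = i mod p ^ t then coeff f i else 0) \<in> R" for l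
      by (intro subring_sum subring_R) (simp add: f(2) subring_0 subring_R)
    ultimately show "x \<in> span (p ^ t)" unfolding span_def
      by (intro CollectI exI[of _ "\<lambda>l. \<Sum>i\<le>degree f. if l = i mod p ^ t then coeff f i else 0"]) simp
  qed
  have step: "adjoin R \<zeta> \<subseteq> span j" if sub: "adjoin R \<zeta> \<subseteq> span (Suc j)" for j
  proof -
    have "y * \<zeta> ^ j \<in> adjoin R \<zeta>"
      by (intro subring_intros subring_adj y generator_in_adjoin subring_R)
    then obtain q where q: "\<forall>i<Suc j. q i \<in> R" "y * \<zeta> ^ j = (\<Sum>i<Suc j. q i * \<zeta> ^ i)"
      using sub unfolding span_def by blast
    have qj: "1 - of_nat p * q j \<in> R" by (intro subring_intros subring_R) (use q in simp)
    \<comment> \<open>\<open>R\<close> is local with maximal ideal p R, so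
      \<open>1 - of_nat p * q j\<close> will be a unit; then \<open>\<zeta> ^ j\<close> can be
      expressed by lower powers of \<zeta>.\<close>
    have "1 - of_nat p * q j \<notin> (\<lambda>x. of_nat p * x) ` R"
    proof
      assume "1 - of_nat p * q j \<in> (\<lambda>x. of_nat p * x) ` R"
      then obtain q' where "q' \<in> R" "1 - of_nat p * q j = of_nat p * q'" by blast
      then have "of_nat p * (q j + q') = 1" "q j + q' \<in> R"
        using q(1) by (auto simp: algebra_simps intro: subring_add subring_R)
      then show False using one_not_multiple by blast
    qed
    then obtain v where v: "v \<in> R" "(1 - of_nat p * q j) * v = 1"
      unfolding nonunits_R[symmetric] using qj by auto
    have "\<zeta> ^ j = of_nat p * (y * \<zeta> ^ j)" using py by (simp add: mult.assoc[symmetric])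
    also have "\<dots> = of_nat p * (\<Sum>i<j. q i * \<zeta> ^ i) + of_nat p * q j * \<zeta> ^ j"
      unfolding q(2) by (simp add: algebra_simps)
    finally have "(1 - of_nat p * q j) * \<zeta> ^ j = of_nat p * (\<Sum>i<j. q i * \<zeta> ^ i)"
      by (simp add: algebra_simps)
    then have "v * ((1 - of_nat p * q j) * \<zeta> ^ j) = v * (of_nat p * (\<Sum>i<j. q i * \<zeta> ^ i))" by simp
    moreover have "v * ((1 - of_nat p * q j) * \<zeta> ^ j) = ((1 - of_nat p * q j) * v) * \<zeta> ^ j" by (simp only: mult_ac)
    ultimately have \<zeta>j: "\<zeta> ^ j = (\<Sum>i<j. v * of_nat p * q i * \<zeta> ^ i)"
      unfolding v(2) by (simp add: sum_distrib_left mult_ac)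
    have "span (Suc j) \<subseteq> span j"
    proof
      fix x assume "x \<in> span (Suc j)"
      then obtain q' where q': "\<forall>i<Suc j. q' i \<in> R" "x = (\<Sum>i<Suc j. q' i * \<zeta> ^ i)" by (auto simp: span_def)
      have "x = (\<Sum>i<j. q' i * \<zeta> ^ i) + q' j * (\<Sum>i<j. v * of_nat p * q i * \<zeta> ^ i)"
        unfolding q'(2) using \<zeta>j by simp
      also have "\<dots> = (\<Sum>i<j. (q' i + q' j * (v * of_nat p * q i)) * \<zeta> ^ i)"
        by (simp add: sum_distrib_left distrib_right sum.distrib mult.assoc)
      finally have "x = (\<Sum>i<j. (q' i + q' j * (v * of_nat p * q i)) * \<zeta> ^ i)" .
      moreover have "q' i + q' j * (v * of_nat p * q i) \<in> R" if "i < j" for i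
        using q(1) q'(1) that by (intro subring_intros subring_R v) auto
      ultimately show "x \<in> span j" unfolding span_def
        by (intro CollectI exI[of _ "\<lambda>i. q' i + q' j * (v * of_nat p * q i)"]) simp
    qed
    then show ?thesis using that by blast
  qed
  have "adjoin R \<zeta> \<subseteq> span 1"
  proof -
    have "adjoin R \<zeta> \<subseteq> span (p ^ t - i)" if "i < p ^ t" for i
      using that
    proof (induction i)
      case (Suc i)
      have "Suc (p ^ t - Suc i) = p ^ t - i" using Suc.prems by simp
      then show ?case using Suc by (simp add: step)
    qed (simp add: full)
    from this[of "p ^ t - 1"] show ?thesis using ppos by simp
  qed
  \<comment> \<open>Only the power 0 of \<zeta> is left, so p would have an inverse in
    \<open>R\<close> itself.\<close>
  then have "y \<in> span 1" using y by blast
  then have "y \<in> R" by (auto simp: span_def)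
  then show False using one_not_multiple py by blast
qed

lemma one_minus_\<zeta>_in: "1 - \<zeta> \<in> adjoin R \<zeta>"
  by (intro subring_intros subring_adj generator_in_adjoin subring_R)

text \<open>The power \<open>(1 - \<zeta>) ^ (p ^ t)\<close> is congruent to 1 - 1 modulo p, so an
  inverse of \<open>1 - \<zeta>\<close> would yield one of p.\<close>

lemma one_minus_\<zeta>_not_unit: "y \<in> adjoin R \<zeta> \<Longrightarrow> (1 - \<zeta>) * y \<noteq> 1"
proof
  assume y: "y \<in> adjoin R \<zeta>" and u: "(1 - \<zeta>) * y = 1"
  have "cong_in (adjoin R \<zeta>) (of_nat p) ((1 + - \<zeta>) ^ (p ^ t)) (1 ^ (p ^ t) + (- \<zeta>) ^ (p ^ t))"
    by (intro freshman prime_p subring_adj subring_intros generator_in_adjoin subring_R)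
  moreover have "(- \<zeta>) ^ (p ^ t) = - 1" using odd_p by (simp add: \<zeta>_power_1)
  ultimately obtain x where x: "x \<in> adjoin R \<zeta>" "(1 - \<zeta>) ^ (p ^ t) = of_nat p * x"
    by (auto simp: cong_in_def)
  have "of_nat p * (x * y ^ (p ^ t)) = ((1 - \<zeta>) * y) ^ (p ^ t)"
    unfolding power_mult_distrib x(2) by (simp add: mult.assoc)
  then show False using p_not_unit[of "x * y ^ (p ^ t)"] x(1) y
    by (auto simp: u intro!: subring_intros subring_adj)
qed

text \<open>Modulo \<open>1 - \<zeta>\<close> a polynomial in \<zeta> reduces to its value at 1, an
  element of \<open>R\<close>. This is either a multiple of p, hence zero, or a unit, whose powers
  do not vanish. So the quotient has no nilpotents.\<close>

lemma reduced_mod: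
  assumes p: "cong_in (adjoin R \<zeta>) (1 - \<zeta>) (of_nat p) 0"
    and x: "x \<in> adjoin R \<zeta>" "cong_in (adjoin R \<zeta>) (1 - \<zeta>) (x ^ m) 0"
  shows "cong_in (adjoin R \<zeta>) (1 - \<zeta>) x 0"
proof -
  note S = subring_adj
  have \<zeta>: "\<zeta> \<in> adjoin R \<zeta>" by (rule generator_in_adjoin[OF subring_R])
  have RS: "q \<in> R \<Longrightarrow> q \<in> adjoin R \<zeta>" for q using base_subset_adjoin[OF subring_R] by blast
  obtain f where f: "x = poly f \<zeta>" "\<And>i. coeff f i \<in> R" using x(1) by (auto simp: adjoin_def)
  define q where "q = (\<Sum>i\<le>degree f. coeff f i * 1 ^ i)"
  have qR: "q \<in> R" unfolding q_def by (intro subring_intros subring_R f)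
  have "cong_in (adjoin R \<zeta>) (1 - \<zeta>) \<zeta> 1"
    unfolding cong_in_def by (rule bexI[of _ "- 1"]) (auto intro: subring_intros S)
  then have xq: "cong_in (adjoin R \<zeta>) (1 - \<zeta>) x q"
    unfolding f(1) poly_altdef q_def
    by (intro cong_in_sum cong_in_scale cong_in_power S RS f(2) \<zeta> one_minus_\<zeta>_in subring_1[OF S])
  show ?thesis
  proof (cases "q \<in> (\<lambda>x. of_nat p * x) ` R")
    case True
    then obtain q' where q': "q' \<in> R" "q = q' * of_nat p" by (auto simp: mult.commute)
    then have "cong_in (adjoin R \<zeta>) (1 - \<zeta>) q (q' * 0)"
      by (simp only:) (intro cong_in_scale S RS p)
    then show ?thesis using xq cong_in_trans[OF S] by simp
  next
    case False
    then obtain v where v: "v \<in> R" "q * v = 1" unfolding nonunits_R[symmetric] using qR by auto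
    have "cong_in (adjoin R \<zeta>) (1 - \<zeta>) (x ^ m) (q ^ m)"
      by (intro cong_in_power xq S x(1) RS qR one_minus_\<zeta>_in)
    then have "cong_in (adjoin R \<zeta>) (1 - \<zeta>) (q ^ m) 0"
      using x(2) cong_in_trans[OF S] cong_in_sym[OF S] by blast
    then have "cong_in (adjoin R \<zeta>) (1 - \<zeta>) (v ^ m * q ^ m) (v ^ m * 0)"
      by (intro cong_in_scale S subring_power RS v)
    moreover have "v ^ m * q ^ m = 1" using v(2) by (simp add: power_mult_distrib[symmetric] mult.commute)
    ultimately obtain y where "y \<in> adjoin R \<zeta>" "1 = (1 - \<zeta>) * y" by (auto simp: cong_in_def)
    then show ?thesis using one_minus_\<zeta>_not_unit by metis
  qed
qed

end

section \<open>Power series modulo \<open>\<pi>\<close>\<close>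

definition series_over :: "'a::field set \<Rightarrow> 'a fps set" where
  "series_over R = {f. \<forall>i. fps_nth f i \<in> R}"

lemma power_series_eq: "power_series R = fps_to_fls ` series_over R"
  by (auto simp: power_series_def series_over_def)

lemma subring_series_over:
  assumes "is_subring R" shows "is_subring (series_over R)"
  unfolding is_subring_def series_over_def
  by (auto simp: fps_mult_nth intro!: subring_intros assms)

lemma subring_power_series:
  assumes "is_subring R" shows "is_subring (power_series R)"
  unfolding is_subring_def power_series_eq
proof (intro conjI ballI)
  note S = subring_series_over[OF assms]
  show "1 \<in> fps_to_fls ` series_over R" by (rule image_eqI[of _ _ 1]) (auto intro: subring_1 S)
  fix x y assume "x \<in> fps_to_fls ` series_over R" "y \<in> fps_to_fls ` series_over R"
  then obtain f h where f: "f \<in> series_over R" "h \<in> series_over R" "x = fps_to_fls f" "y = fps_to_fls h" by blast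
  show "x - y \<in> fps_to_fls ` series_over R"
    by (rule image_eqI[of _ _ "f - h"]) (auto simp: f intro: subring_diff S)
  show "x * y \<in> fps_to_fls ` series_over R"
    by (rule image_eqI[of _ _ "f * h"]) (auto simp: f fls_times_fps_to_fls intro: subring_mult S)
qed

lemma fls_const_conv: "fls_const x = fps_to_fls (fps_const x)"
  by simp

lemma series_over_const: "is_subring R \<Longrightarrow> x \<in> R \<Longrightarrow> fps_const x \<in> series_over R"
  by (auto simp: series_over_def intro: subring_0)

lemma power_series_const: "is_subring R \<Longrightarrow> x \<in> R \<Longrightarrow> fls_const x \<in> power_series R"
  unfolding power_series_eq fls_const_conv by (intro imageI series_over_const)

lemma series_over_X: "is_subring R \<Longrightarrow> fps_X \<in> series_over R"
  by (auto simp: series_over_def fps_X_def intro: subring_intros)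

lemma one_plus_X_conv: "1 + fls_X = fps_to_fls (1 + fps_X)"
  by simp

lemma power_series_one_plus_X: "is_subring R \<Longrightarrow> 1 + fls_X \<in> power_series R"
  unfolding power_series_eq one_plus_X_conv
  by (intro imageI subring_add subring_1 subring_series_over series_over_X)

lemma power_series_mono: "R \<subseteq> R' \<Longrightarrow> power_series R \<subseteq> power_series R'"
  by (auto simp: power_series_def)

lemma cong_power_series_iff:
  assumes "is_subring R"
  shows "cong_in (power_series R) (fls_const q) (fps_to_fls f) 0 \<longleftrightarrow> (\<forall>m. cong_in R q (fps_nth f m) 0)"
proof
  assume "cong_in (power_series R) (fls_const q) (fps_to_fls f) 0"
  then obtain h where h: "h \<in> series_over R" "fps_to_fls f = fls_const q * fps_to_fls h"
    by (auto simp: cong_in_def power_series_eq)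
  then have "f = fps_const q * h"
    unfolding fls_const_conv fls_times_fps_to_fls[symmetric] by simp
  then show "\<forall>m. cong_in R q (fps_nth f m) 0" using h(1) by (auto simp: cong_in_def series_over_def)
next
  assume "\<forall>m. cong_in R q (fps_nth f m) 0"
  then obtain c where c: "\<And>m. c m \<in> R" "\<And>m. fps_nth f m = q * c m" by (auto simp: cong_in_def) metis
  have "f = fps_const q * Abs_fps c" by (rule fps_ext) (simp add: c(2))
  then have "fps_to_fls f = fls_const q * fps_to_fls (Abs_fps c)"
    by (simp add: fls_times_fps_to_fls)
  moreover have "fps_to_fls (Abs_fps c) \<in> power_series R"
    unfolding power_series_eq series_over_def using c(1) by auto
  ultimately show "cong_in (power_series R) (fls_const q) (fps_to_fls f) 0" by (auto simp: cong_in_def)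
qed

lemma cong_series_nth:
  "cong_in (series_over R) (of_nat p) f h \<Longrightarrow> cong_in R (of_nat p) (fps_nth f m) (fps_nth h m)"
  unfolding cong_in_def series_over_def fps_of_nat[symmetric] by auto

lemma fps_nth_power_cong:
  assumes p: "prime p" and R: "is_subring R" and f: "f \<in> series_over R"
  shows "cong_in R (of_nat p) (fps_nth (f ^ (p ^ j)) m) (if p ^ j dvd m then fps_nth f (m div p ^ j) ^ (p ^ j) else 0)"
proof -
  note S = subring_series_over[OF R]
  define q where "q = p ^ j"
  have q0: "q > 0" using p prime_gt_0_nat by (simp add: q_def)
  \<comment> \<open>Additivity of the q-th power modulo p applies to finite sums, so
    \<open>f\<close> is cut off after degree m; the q-th power of the tail \<open>t\<close> starts
    beyond degree m.\<close>
  define h where "h = (\<Sum>i\<le>m. fps_const (fps_nth f i) * fps_X ^ i)"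
  define t where "t = fps_X ^ Suc m * fps_shift (Suc m) f"
  have f_eq: "f = h + t"
  proof (rule fps_ext)
    fix k
    have "fps_nth h k = (if k \<le> m then fps_nth f k else 0)"
      by (simp add: h_def fps_sum_nth fps_X_power_iff if_distrib[of "(*) _"] cong: if_cong)
    then show "fps_nth f k = fps_nth (h + t) k"
      by (simp add: t_def fps_X_power_mult_nth del: power_Suc)
  qed
  have fR: "fps_nth f i \<in> R" for i using f by (simp add: series_over_def)
  have mon: "fps_const (fps_nth f i) * fps_X ^ i \<in> series_over R" for i
    by (intro subring_intros S series_over_const series_over_X R fR)
  have h: "h \<in> series_over R" unfolding h_def by (intro subring_sum S mon)
  have sh: "fps_shift (Suc m) f \<in> series_over R" using f by (simp add: series_over_def)
  have t: "t \<in> series_over R" unfolding t_def by (intro subring_intros S series_over_X R sh)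
  have "cong_in (series_over R) (of_nat p) (f ^ q) (h ^ q + t ^ q)"
    unfolding f_eq unfolding q_def by (rule freshman[OF p S h t])
  moreover have "cong_in (series_over R) (of_nat p) (h ^ q + t ^ q)
      ((\<Sum>i\<le>m. (fps_const (fps_nth f i) * fps_X ^ i) ^ q) + t ^ q)"
    unfolding h_def q_def by (intro cong_in_add freshman_sum cong_in_refl p S mon)
  ultimately have "cong_in (series_over R) (of_nat p) (f ^ q)
      ((\<Sum>i\<le>m. (fps_const (fps_nth f i) * fps_X ^ i) ^ q) + t ^ q)"
    using cong_in_trans[OF S] by blast
  then have "cong_in R (of_nat p) (fps_nth (f ^ q) m)
      (fps_nth ((\<Sum>i\<le>m. (fps_const (fps_nth f i) * fps_X ^ i) ^ q) + t ^ q) m)"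
    by (rule cong_series_nth)
  moreover have "fps_nth (t ^ q) m = 0"
  proof -
    have "t ^ q = fps_X ^ (Suc m * q) * fps_shift (Suc m) f ^ q"
      unfolding t_def power_mult_distrib power_mult ..
    moreover have "m < Suc m * q" using q0 by (cases q) auto
    ultimately show ?thesis by (simp add: fps_X_power_mult_nth)
  qed
  moreover have "fps_nth (\<Sum>i\<le>m. (fps_const (fps_nth f i) * fps_X ^ i) ^ q) m =
      (if q dvd m then fps_nth f (m div q) ^ q else 0)"
  proof -
    have "fps_nth (\<Sum>i\<le>m. (fps_const (fps_nth f i) * fps_X ^ i) ^ q) m =
        (\<Sum>i\<le>m. if m = i * q then fps_nth f i ^ q else 0)"
      unfolding fps_sum_nth
    proof (intro sum.cong refl)
      fix i
      have "(fps_const (fps_nth f i) * fps_X ^ i) ^ q = fps_const (fps_nth f i ^ q) * fps_X ^ (i * q)"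
        by (simp only: power_mult_distrib fps_const_power power_mult)
      then show "fps_nth ((fps_const (fps_nth f i) * fps_X ^ i) ^ q) m = (if m = i * q then fps_nth f i ^ q else 0)"
        by (simp add: fps_X_power_iff)
    qed
    also have "\<dots> = (if q dvd m then fps_nth f (m div q) ^ q else 0)"
    proof (cases "q dvd m")
      case True
      then obtain l where l: "m = l * q" by (metis dvdE mult.commute)
      have "l \<le> m" using q0 l by (cases q) auto
      have "(\<Sum>i\<le>m. if m = i * q then fps_nth f i ^ q else 0) = (\<Sum>i\<le>m. if i = l then fps_nth f l ^ q else 0)"
        using q0 by (intro sum.cong refl) (auto simp: l)
      then show ?thesis using \<open>l \<le> m\<close> q0 by (simp add: l)
    next
      case False
      then have "(\<Sum>i\<le>m. if m = i * q then fps_nth f i ^ q else 0) = 0"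
        by (intro sum.neutral) auto
      then show ?thesis using False by simp
    qed
    finally show ?thesis .
  qed
  ultimately show ?thesis unfolding q_def[symmetric] by simp
qed

lemma fps_nth_one_plus_X_power_mult:
  fixes f :: "'a::field fps"
  shows "fps_nth ((1 + fps_X) ^ v * f) m = (\<Sum>l\<le>v. if l \<le> m then of_nat (v choose l) * fps_nth f (m - l) else 0)"
proof -
  have "(1 + fps_X) ^ v * f = (\<Sum>l\<le>v. fps_const (of_nat (v choose l)) * (fps_X ^ l * f))"
    unfolding add.commute[of 1] binomial_ring sum_distrib_right
    by (simp add: fps_of_nat mult.assoc)
  then show ?thesis
    by (simp add: fps_sum_nth fps_X_power_mult_nth if_distrib[of "(*) _"] not_less cong: if_cong sum.cong)
      (intro sum.cong refl, auto)
qed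

text \<open>Modulo \<open>p\<close>, the coefficients of \<open>x\<^sup>q\<close> are supported on multiples of \<open>q\<close>, so the coefficients of index
  \<open>i q + c\<close> (\<open>c < q\<close>) give a unitriangular system for the \<open>q\<close>-th powers of the \<open>i\<close>-th coefficients.\<close>

lemma powers_independent:
  assumes p: "prime p" and R: "is_subring R" and \<pi>: "\<pi> \<in> R" "cong_in R \<pi> (of_nat p) 0"
    and red: "\<And>x m. x \<in> R \<Longrightarrow> cong_in R \<pi> (x ^ m) 0 \<Longrightarrow> cong_in R \<pi> x 0"
    and x: "\<And>v. v < p ^ j \<Longrightarrow> x v \<in> power_series R"
    and sum: "cong_in (power_series R) (fls_const \<pi>) (\<Sum>v<p ^ j. (1 + fls_X) ^ v * x v ^ (p ^ j)) 0"
    and v: "v < p ^ j"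
  shows "cong_in (power_series R) (fls_const \<pi>) (x v) 0"
proof -
  define q where "q = p ^ j"
  have q0: "q > 0" using p prime_gt_0_nat by (simp add: q_def)
  note x = x[folded q_def] and sum = sum[folded q_def] and v = v[folded q_def]
  have "\<forall>v. \<exists>f. v < q \<longrightarrow> f \<in> series_over R \<and> x v = fps_to_fls f"
    using x by (auto simp: power_series_eq)
  then obtain f where f: "\<And>v. v < q \<Longrightarrow> f v \<in> series_over R" "\<And>v. v < q \<Longrightarrow> x v = fps_to_fls (f v)"
    by metis
  have fR: "fps_nth (f v) i \<in> R" if "v < q" for v i using f(1)[OF that] by (simp add: series_over_def)
  have pc: "cong_in R \<pi> x y" if "cong_in R (of_nat p) x y" for x y
  proof -
    obtain z where z: "z \<in> R" "of_nat p = \<pi> * z" using \<pi>(2) by (auto simp: cong_in_def)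
    show ?thesis by (rule cong_in_mono[OF R z(2,1) that])
  qed
  have "(\<Sum>v<q. (1 + fls_X) ^ v * x v ^ q) = fps_to_fls (\<Sum>v<q. (1 + fps_X) ^ v * f v ^ q)"
  proof -
    have s: "fps_to_fls (sum h I) = (\<Sum>i\<in>I. fps_to_fls (h i))" for h :: "nat \<Rightarrow> 'a fps" and I
      by (induction I rule: infinite_finite_induct) auto
    show ?thesis unfolding s
      by (intro sum.cong refl)
        (simp only: lessThan_iff f(2) one_plus_X_conv fps_to_fls_power[symmetric] fls_times_fps_to_fls[symmetric])
  qed
  note sum' = this
  have pw: "cong_in R \<pi> (fps_nth (f v ^ q) m) (if q dvd m then fps_nth (f v) (m div q) ^ q else 0)"
    if "v < q" for v m
    unfolding q_def by (rule pc[OF fps_nth_power_cong[OF p R f(1)[OF that]]])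
  from sum[unfolded sum'] have coeffs: "cong_in R \<pi> (fps_nth (\<Sum>v<q. (1 + fps_X) ^ v * f v ^ q) m) 0" for m
    unfolding cong_power_series_iff[OF R] by blast
  \<comment> \<open>As v < q and the q-th power of \<open>f v\<close> has, modulo \<pi>, only terms
    of degree divisible by q, the factor \<open>(1 + fps_X) ^ v\<close> contributes in degree
    \<open>i * q + c\<close> only through its coefficient of degree c.\<close>
  have term_cong: "cong_in R \<pi> (fps_nth ((1 + fps_X) ^ v * f v ^ q) (i * q + c)) (of_nat (v choose c) * fps_nth (f v) i ^ q)"
    if v: "v < q" and c: "c < q" for v i c
  proof -
    have dvd: "q dvd i * q + c - l \<longleftrightarrow> l = c" if "l < q" "l \<le> i * q + c" for l
    proof
      assume "q dvd i * q + c - l"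
      then have "[i * q + c = l] (mod q)" using that(2) by (simp only: cong_altdef_nat[OF that(2)])
      then have "[c = l] (mod q)" by (simp add: cong_def)
      then show "l = c" using that(1) c by (simp add: cong_def)
    qed simp
    have "cong_in R \<pi> (\<Sum>l\<le>v. if l \<le> i * q + c then of_nat (v choose l) * fps_nth (f v ^ q) (i * q + c - l) else 0)
       (\<Sum>l\<le>v. if l = c then of_nat (v choose c) * fps_nth (f v) i ^ q else 0)"
    proof (rule cong_in_sum[OF R])
      fix l assume l: "l \<in> {..v}"
      then have lq: "l < q" using v by simp
      show "cong_in R \<pi> (if l \<le> i * q + c then of_nat (v choose l) * fps_nth (f v ^ q) (i * q + c - l) else 0)
         (if l = c then of_nat (v choose c) * fps_nth (f v) i ^ q else 0)"
      proof (cases "l \<le> i * q + c")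
        case True
        have "cong_in R \<pi> (fps_nth (f v ^ q) (i * q + c - l)) (if l = c then fps_nth (f v) i ^ q else 0)"
          using pw[of v "i * q + c - l", OF v] dvd[OF lq True] q0
          by (cases "l = c") simp_all
        then have "cong_in R \<pi> (of_nat (v choose l) * fps_nth (f v ^ q) (i * q + c - l))
            (of_nat (v choose l) * (if l = c then fps_nth (f v) i ^ q else 0))"
          by (intro cong_in_scale R subring_of_nat)
        then show ?thesis using True by (auto split: if_splits)
      qed (auto intro: cong_in_refl R)
    qed
    moreover have "(\<Sum>l\<le>v. if l = c then of_nat (v choose c) * fps_nth (f v) i ^ q else 0) =
        of_nat (v choose c) * fps_nth (f v) i ^ q"
      by (auto simp: not_le binomial_eq_0)
    ultimately show ?thesis unfolding fps_nth_one_plus_X_power_mult by simp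
  qed
  have system: "cong_in R \<pi> (\<Sum>v<q. of_nat (v choose c) * fps_nth (f v) i ^ q) 0" if c: "c < q" for i c
  proof -
    have "cong_in R \<pi> (\<Sum>v<q. fps_nth ((1 + fps_X) ^ v * f v ^ q) (i * q + c)) (\<Sum>v<q. of_nat (v choose c) * fps_nth (f v) i ^ q)"
      using c by (intro cong_in_sum R term_cong) auto
    then show ?thesis using coeffs[of "i * q + c"] cong_in_trans[OF R] cong_in_sym[OF R]
      unfolding fps_sum_nth by blast
  qed
  \<comment> \<open>Back substitution from the largest c: the binomial coefficient vanishes for v <
    c and is 1 for v = c, while the summands with v > c are already known to vanish modulo
    \<pi>.\<close>
  have solve: "cong_in R \<pi> (fps_nth (f c) i ^ q) 0" if "c < q" for c i
    using that
  proof (induction "q - c" arbitrary: c rule: less_induct)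
    case less
    have "cong_in R \<pi> (\<Sum>v<q. of_nat (v choose c) * fps_nth (f v) i ^ q) (\<Sum>v<q. if v = c then fps_nth (f c) i ^ q else 0)"
    proof (rule cong_in_sum[OF R])
      fix v assume v: "v \<in> {..<q}"
      consider "v < c" | "v = c" | "v > c" by linarith
      then show "cong_in R \<pi> (of_nat (v choose c) * fps_nth (f v) i ^ q) (if v = c then fps_nth (f c) i ^ q else 0)"
      proof cases
        case 3
        then have "cong_in R \<pi> (fps_nth (f v) i ^ q) 0" using v by (intro less.hyps) auto
        then have "cong_in R \<pi> (of_nat (v choose c) * fps_nth (f v) i ^ q) (of_nat (v choose c) * 0)"
          by (intro cong_in_scale R subring_of_nat)
        then show ?thesis using 3 by simp
      qed (auto simp: binomial_eq_0 intro: cong_in_refl R)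
    qed
    moreover have "(\<Sum>v<q. if v = c then fps_nth (f c) i ^ q else 0) = fps_nth (f c) i ^ q"
      using less.prems by simp
    ultimately show ?case using system[OF less.prems] cong_in_trans[OF R] cong_in_sym[OF R] by metis
  qed
  show ?thesis unfolding f(2)[OF v] cong_power_series_iff[OF R]
    using red[OF fR[OF v] solve[OF v]] by blast
qed

section \<open>Orders in cyclic algebras over power series rings\<close>

text \<open>The numbers congruent to -1 modulo \<open>p ^ k\<close> are the last ones of the blocks
  of length \<open>p ^ k\<close>, and n has position \<open>n mod p ^ k\<close> in its
  block.\<close>

lemma star_diff: "p > 0 \<Longrightarrow> star p k n - n = p ^ k - 1 - n mod p ^ k" for p k n :: nat
proof -
  assume p: "p > 0"
  define K where "K = p ^ k"
  have K: "K > 0" using p by (simp add: K_def)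
  have iff: "[int m = - 1] (mod int K) \<longleftrightarrow> K dvd m + 1" for m
  proof -
    have "[int m = - 1] (mod int K) \<longleftrightarrow> int K dvd int (m + 1)" by (simp add: cong_iff_dvd_diff add.commute)
    then show ?thesis by (simp only: int_dvd_int_iff)
  qed
  have nm: "n mod K < K" using K by simp
  have "star p k n = n + (K - 1 - n mod K)"
    unfolding star_def K_def[symmetric]
  proof (rule Least_equality)
    have "n + (K - 1 - n mod K) + 1 = K * (n div K) + K"
      using nm mult_div_mod_eq[of K n] by arith
    then have "K dvd n + (K - 1 - n mod K) + 1" by (metis dvd_add_triv_right_iff dvd_triv_left)
    then show "n \<le> n + (K - 1 - n mod K) \<and> [int (n + (K - 1 - n mod K)) = - 1] (mod int K)"
      unfolding iff by simp
  next
    fix m assume "n \<le> m \<and> [int m = - 1] (mod int K)"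
    then have m: "n \<le> m" "K dvd m + 1" unfolding iff by auto
    obtain t where t: "m + 1 = K * t" using m(2) by blast
    have "n div K < t"
    proof -
      have "K * (n div K) \<le> n" by simp
      then have "K * (n div K) < K * t" using m(1) t by linarith
      then show ?thesis by simp
    qed
    then have "K * Suc (n div K) \<le> K * t" by (intro mult_left_mono) auto
    then have "K * (n div K) + K \<le> m + 1" using t by simp
    moreover have "n = K * (n div K) + n mod K" by simp
    ultimately show "n + (K - 1 - n mod K) \<le> m" using nm by linarith
  qed
  then show ?thesis by (simp add: K_def)
qed

text \<open>Matches the summation range in \<lambda> with the condition under which
  \<open>trace_main\<close> has a nonzero leading coefficient.\<close>

lemma lam_eq:
  assumes "p > 0" "k \<le> s"
  shows "lam A P (p ^ s) p k n b = (\<Sum>l | l < p ^ s \<and> n mod p ^ k + l < p ^ k. expansion A P (p ^ s) b l)"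
proof -
  have eq: "{0..K - 1 - m} = {l. l < N \<and> m + l < K}" if "m < K" "K \<le> N" for m K N :: nat
    using that by auto
  have "{0..star p k n - n} = {l. l < p ^ s \<and> n mod p ^ k + l < p ^ k}"
    unfolding star_diff[OF assms(1)] by (rule eq) (use assms in \<open>auto intro: power_increasing\<close>)
  then show ?thesis by (simp add: lam_def)
qed

lemma subring_fraction_field:
  assumes "is_subring S" shows "is_subring (fraction_field S)"
  unfolding is_subring_def fraction_field_def
proof (intro conjI ballI)
  show "1 \<in> {x / y |x y. x \<in> S \<and> y \<in> S \<and> y \<noteq> 0}"
    using subring_1[OF assms] by (intro CollectI exI[of _ 1]) auto
  fix a b assume "a \<in> {x / y |x y. x \<in> S \<and> y \<in> S \<and> y \<noteq> 0}" "b \<in> {x / y |x y. x \<in> S \<and> y \<in> S \<and> y \<noteq> 0}"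
  then obtain x y x' y' where xy: "a = x / y" "b = x' / y'" "x \<in> S" "y \<in> S" "y \<noteq> 0" "x' \<in> S" "y' \<in> S" "y' \<noteq> 0"
    by blast
  have "a - b = (x * y' - x' * y) / (y * y')" "a * b = (x * x') / (y * y')"
    using xy by (simp_all add: diff_frac_eq)
  then show "a - b \<in> {x / y |x y. x \<in> S \<and> y \<in> S \<and> y \<noteq> 0}" "a * b \<in> {x / y |x y. x \<in> S \<and> y \<in> S \<and> y \<noteq> 0}"
    unfolding mem_Collect_eq using xy assms mult_eq_0_iff[of y y']
    by (blast intro: subring_diff subring_mult)+
qed

lemma subset_fraction_field: "is_subring S \<Longrightarrow> S \<subseteq> fraction_field S"
  unfolding fraction_field_def using subring_1 by (fastforce intro: exI[of _ 1])

lemma fraction_field_mono: "S \<subseteq> S' \<Longrightarrow> fraction_field S \<subseteq> fraction_field S'"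
  by (auto simp: fraction_field_def)

section \<open>Coefficients of elements of the order and the two congruences\<close>

locale cyclic_setting =
  fixes p r s :: nat
    and Qp F Or Ors :: "'a::field_char_0 set" and av :: "'a \<Rightarrow> real" and \<zeta> :: "nat \<Rightarrow> 'a"
    and P Q :: "'a fls" and A B :: "'a fls set" and g :: "'a fls \<Rightarrow> 'a fls"
    and \<iota> :: "'a fls \<Rightarrow> 'd::ring_1" and u :: 'd and nr :: "'d \<Rightarrow> 'a fls"
  assumes p: "prime p" "odd p" and r: "r \<ge> 1"
    and Qp: "is_padic_field p Qp av" and F: "finite_unramified_extension p Qp av F"
    and prim: "\<And>m. primitive_root_of_unity (p ^ m) (\<zeta> m)"
    and \<zeta>_step: "\<And>m. m \<ge> 1 \<Longrightarrow> \<zeta> m ^ p = \<zeta> (m - 1)"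
    and Or: "Or = adjoin (ring_of_integers Qp av F) (\<zeta> r)"
    and Ors: "Ors = adjoin (ring_of_integers Qp av F) (\<zeta> (r + s))"
    and A: "A = power_series Or" and B: "B = power_series Ors"
    and P: "P = fls_const (1 - \<zeta> (r + s))" and Q: "Q = fls_const (1 - \<zeta> r)"
    and g: "g \<in> Gal (fraction_field B) (fraction_field A)"
    and g_\<zeta>: "g (fls_const (\<zeta> (r + s))) = fls_const (\<zeta> (r + s) ^ (1 + p ^ r))"
    and alg: "is_cyclic_algebra (fraction_field B) g (p ^ s) (1 + fls_X) \<iota> u"
    and nr: "is_reduced_norm (fraction_field A) (fraction_field B) \<iota> (p ^ s) nr"
begin

abbreviation R0 where "R0 \<equiv> ring_of_integers Qp av F"
abbreviation N where "N \<equiv> p ^ s"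
abbreviation z where "z \<equiv> fls_const (\<zeta> (r + s))"

lemma p_pos: "p > 0" using p prime_gt_0_nat by blast

lemma subring_R0: "is_subring R0"
  using subring_ring_of_integers[OF p(1) Qp] F by (auto simp: finite_unramified_extension_def)

sublocale local_cyclotomic_ring p r R0 "\<zeta> r"
  using p subring_R0 F prim by unfold_locales (auto simp: finite_unramified_extension_def Let_def)

lemma subring_Or: "is_subring Or" unfolding Or by (rule subring_adj)

lemma subring_Ors: "is_subring Ors" unfolding Ors by (rule subring_adjoin[OF subring_R0])

lemma \<zeta>_power: "\<zeta> (m + i) ^ (p ^ i) = \<zeta> m"
proof (induction i)
  case (Suc i)
  have "\<zeta> (m + Suc i) ^ (p ^ Suc i) = (\<zeta> (m + Suc i) ^ p) ^ (p ^ i)" by (simp add: power_mult)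
  also have "\<zeta> (m + Suc i) ^ p = \<zeta> (m + i)" using \<zeta>_step[of "m + Suc i"] by simp
  finally show ?case using Suc by simp
qed simp

lemma \<zeta>_in: "\<zeta> r \<in> Or" "\<zeta> (r + s) \<in> Ors"
  unfolding Or Ors by (rule generator_in_adjoin[OF subring_R0])+

lemma Or_Ors: "Or \<subseteq> Ors"
proof -
  have "\<zeta> r \<in> Ors" unfolding \<zeta>_power[of r s, symmetric] by (rule subring_power[OF subring_Ors \<zeta>_in(2)])
  then show ?thesis unfolding Or
    by (intro adjoin_least subring_Ors) (auto simp: Ors base_subset_adjoin[OF subring_R0])
qed

lemma subring_A: "is_subring A" and subring_B: "is_subring B"
  unfolding A B by (intro subring_power_series subring_Or subring_Ors)+

lemma A_B: "A \<subseteq> B" unfolding A B by (rule power_series_mono[OF Or_Ors])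

lemma B_K: "B \<subseteq> fraction_field B" by (rule subset_fraction_field[OF subring_B])

lemma A_k: "A \<subseteq> fraction_field A" by (rule subset_fraction_field[OF subring_A])

lemma prim_z: "primitive_root_of_unity (p ^ (r + s)) z"
  using prim[of "r + s"] by (simp add: primitive_root_of_unity_def flip: fls_const_power)

lemma z_in: "z \<in> B" unfolding B by (rule power_series_const[OF subring_Ors \<zeta>_in(2)])

lemma z_power: "z ^ N = fls_const (\<zeta> r)" by (simp add: \<zeta>_power flip: fls_const_power)

lemma z_power_in: "z ^ N \<in> A" unfolding z_power A by (rule power_series_const[OF subring_Or \<zeta>_in(1)])

lemma P_eq: "P = 1 - z" by (simp add: P flip: fls_minus_const)

lemma Q_eq: "Q = 1 - z ^ N" by (simp add: Q z_power flip: fls_minus_const)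

lemma t0_in: "1 + fls_X \<in> A" unfolding A by (rule power_series_one_plus_X[OF subring_Or])

text \<open>\<open>\<rho>\<^sup>N\<close> is a combination of lower powers of \<open>\<rho>\<close> for \<open>\<rho> = 1 - \<zeta>\<^sub>r\<^sub>+\<^sub>s\<close>, since \<open>(1 - \<rho>)\<^sup>N = \<zeta>\<^sub>r\<close>.\<close>

lemma Ors_expansion: "y \<in> Ors \<Longrightarrow> \<exists>q. (\<forall>i<N. q i \<in> Or) \<and> y = (\<Sum>i<N. q i * (1 - \<zeta> (r + s)) ^ i)"
proof -
  define \<rho> where "\<rho> = 1 - \<zeta> (r + s)"
  define W where "W = {\<Sum>i<N. q i * \<rho> ^ i | q. \<forall>i<N. q i \<in> Or}"
  have W_D: "\<exists>q. (\<forall>i<N. q i \<in> Or) \<and> y = (\<Sum>i<N. q i * \<rho> ^ i)" if "y \<in> W" for y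
    using that by (auto simp: W_def)
  have W_add: "x + y \<in> W" if "x \<in> W" "y \<in> W" for x y
  proof -
    obtain q q' where "\<forall>i<N. q i \<in> Or" "x = (\<Sum>i<N. q i * \<rho> ^ i)" "\<forall>i<N. q' i \<in> Or" "y = (\<Sum>i<N. q' i * \<rho> ^ i)"
      using W_D[OF \<open>x \<in> W\<close>] W_D[OF \<open>y \<in> W\<close>] by blast
    then show ?thesis unfolding W_def
      by (intro CollectI exI[of _ "\<lambda>i. q i + q' i"])
        (auto simp: sum.distrib distrib_right intro: subring_add subring_Or)
  qed
  have W_scale: "a * y \<in> W" if "a \<in> Or" "y \<in> W" for a y
  proof -
    obtain q where "\<forall>i<N. q i \<in> Or" "y = (\<Sum>i<N. q i * \<rho> ^ i)" using W_D[OF \<open>y \<in> W\<close>] by blast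
    then show ?thesis unfolding W_def using \<open>a \<in> Or\<close>
      by (intro CollectI exI[of _ "\<lambda>i. a * q i"])
        (auto simp: sum_distrib_left mult.assoc intro: subring_mult subring_Or)
  qed
  have W_sum: "sum f I \<in> W" if "\<And>i. i \<in> I \<Longrightarrow> f i \<in> W" for f :: "nat \<Rightarrow> 'a" and I
  proof -
    have "0 \<in> W" unfolding W_def
      by (intro CollectI exI[of _ "\<lambda>_. 0"]) (auto intro: subring_0 subring_Or)
    then show ?thesis using that by (induction I rule: infinite_finite_induct) (auto intro: W_add)
  qed
  have W_power: "\<rho> ^ j \<in> W" if "j < N" for j
    unfolding W_def using that
    by (intro CollectI exI[of _ "\<lambda>i. if i = j then 1 else 0"])
      (auto simp: if_distrib[of "\<lambda>q. q * _"] intro: subring_0 subring_1 subring_Or cong: if_cong)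
  have N_pos: "N > 0" using p_pos by simp
  have W_N: "\<rho> ^ N \<in> W"
  proof -
    have "\<zeta> r = (- \<rho> + 1) ^ N" by (simp add: \<rho>_def \<zeta>_power)
    also have "\<dots> = (\<Sum>i\<le>N. of_nat (N choose i) * (- \<rho>) ^ i)" by (subst binomial_ring) simp
    also have "\<dots> = (\<Sum>i<N. of_nat (N choose i) * (- \<rho>) ^ i) + (- \<rho>) ^ N"
      by (simp add: lessThan_Suc_atMost[symmetric])
    also have "(- \<rho>) ^ N = - (\<rho> ^ N)" using p by simp
    finally have "\<rho> ^ N = (\<Sum>i<N. of_nat (N choose i) * (- \<rho>) ^ i) + (- \<zeta> r) * \<rho> ^ 0" by simp
    also have "(\<Sum>i<N. of_nat (N choose i) * (- \<rho>) ^ i) = (\<Sum>i<N. (of_nat (N choose i) * (- 1) ^ i) * \<rho> ^ i)"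
      by (intro sum.cong refl) (simp add: power_minus[of \<rho>] mult.assoc)
    finally show ?thesis
    proof (simp only:)
      have "(\<Sum>i<N. (of_nat (N choose i) * (- 1) ^ i) * \<rho> ^ i) \<in> W"
        by (intro W_sum W_scale W_power subring_intros subring_Or) auto
      moreover have "(- \<zeta> r) * \<rho> ^ 0 \<in> W"
        by (intro W_scale W_power subring_uminus subring_Or \<zeta>_in N_pos)
      ultimately show "(\<Sum>i<N. (of_nat (N choose i) * (- 1) ^ i) * \<rho> ^ i) + (- \<zeta> r) * \<rho> ^ 0 \<in> W"
        by (rule W_add)
    qed
  qed
  have W_mult: "\<rho> * y \<in> W" if "y \<in> W" for y
  proof -
    obtain q where q: "\<forall>i<N. q i \<in> Or" "y = (\<Sum>i<N. q i * \<rho> ^ i)" using W_D[OF \<open>y \<in> W\<close>] by blast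
    have "\<rho> * y = (\<Sum>i<N. q i * \<rho> ^ Suc i)" by (simp add: q(2) sum_distrib_left mult_ac)
    also have "\<dots> \<in> W"
    proof (rule W_sum, rule W_scale)
      fix i assume i: "i \<in> {..<N}"
      show "q i \<in> Or" using q(1) i by simp
      show "\<rho> ^ Suc i \<in> W"
      proof (cases "Suc i = N")
        case True
        then show ?thesis using W_N by (simp only:)
      next
        case False
        then show ?thesis using i by (intro W_power) simp
      qed
    qed
    finally show ?thesis .
  qed
  have "poly f (\<zeta> (r + s)) \<in> W" if "f \<in> polys_over R0" for f
    using that
  proof (induction f)
    case 0
    have "(\<Sum>i\<in>{}. \<rho> ^ i) \<in> W" by (rule W_sum) simp
    then show ?case by simp
  next
    case (pCons a f)
    have af: "a \<in> R0" "f \<in> polys_over R0" using pCons.prems by (simp_all add: polys_over_pCons subring_R0)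
    have "a \<in> Or" using af(1) base_subset_adjoin[OF subring_R0, of "\<zeta> r"] Or by blast
    have y: "poly f (\<zeta> (r + s)) \<in> W" by (rule pCons.IH[OF af(2)])
    have "poly (pCons a f) (\<zeta> (r + s)) = a * \<rho> ^ 0 + (poly f (\<zeta> (r + s)) + (- 1) * (\<rho> * poly f (\<zeta> (r + s))))"
      by (simp add: \<rho>_def algebra_simps)
    also have "\<dots> \<in> W"
      by (intro W_add y W_scale[OF \<open>a \<in> Or\<close>] W_power N_pos W_scale[OF _ W_mult[OF y]] subring_uminus subring_1 subring_Or)
    finally show ?case .
  qed
  then show "y \<in> Ors \<Longrightarrow> \<exists>q. (\<forall>i<N. q i \<in> Or) \<and> y = (\<Sum>i<N. q i * (1 - \<zeta> (r + s)) ^ i)"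
    unfolding Ors adjoin_eq \<rho>_def[symmetric] using W_D by blast
qed

text \<open>The expansion is carried out for each coefficient of the series in T. The number of
  powers of \<open>P\<close> is the same for all of them, so the results assemble to N power
  series.\<close>

lemma B_expansion: "b \<in> B \<Longrightarrow> \<exists>a. (\<forall>i<N. a i \<in> A) \<and> b = (\<Sum>i<N. a i * P ^ i)"
proof -
  assume "b \<in> B"
  then obtain f where f: "b = fps_to_fls f" "\<And>m. fps_nth f m \<in> Ors" by (auto simp: B power_series_def)
  obtain q where q: "\<And>m i. i < N \<Longrightarrow> q m i \<in> Or" "\<And>m. fps_nth f m = (\<Sum>i<N. q m i * (1 - \<zeta> (r + s)) ^ i)"
    using Ors_expansion[OF f(2)] by metis
  have sum_conv: "fps_to_fls (sum h I) = (\<Sum>i\<in>I. fps_to_fls (h i))" for h :: "nat \<Rightarrow> 'a fps" and I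
    by (induction I rule: infinite_finite_induct) auto
  have "f = (\<Sum>i<N. Abs_fps (\<lambda>m. q m i) * fps_const ((1 - \<zeta> (r + s)) ^ i))"
    by (rule fps_ext) (simp add: q(2) fps_sum_nth)
  then have "b = (\<Sum>i<N. fps_to_fls (Abs_fps (\<lambda>m. q m i)) * P ^ i)"
    unfolding f(1) P fls_const_power[symmetric] by (simp only: sum_conv fls_times_fps_to_fls fls_const_conv)
  moreover have "fps_to_fls (Abs_fps (\<lambda>m. q m i)) \<in> A" if "i < N" for i
    unfolding A power_series_eq series_over_def using q(1)[OF that] by auto
  ultimately show ?thesis by (intro exI[of _ "\<lambda>i. fps_to_fls (Abs_fps (\<lambda>m. q m i))"]) auto
qed

lemma g_add: "x \<in> B \<Longrightarrow> y \<in> B \<Longrightarrow> g (x + y) = g x + g y"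
  and g_mult: "x \<in> B \<Longrightarrow> y \<in> B \<Longrightarrow> g (x * y) = g x * g y"
  and g_A: "x \<in> A \<Longrightarrow> g x = x"
  using g B_K A_k by (auto simp: Gal_def subset_iff)

lemma g_poly: "f \<in> polys_over A \<Longrightarrow> x \<in> B \<Longrightarrow> g (poly f x) = poly f (g x) \<and> poly f x \<in> B"
proof (induction f)
  case 0
  then show ?case using g_A subring_0[OF subring_A] subring_0[OF subring_B] by simp
next
  case (pCons a f)
  have a: "a \<in> A" "f \<in> polys_over A" using pCons.prems by (simp_all add: polys_over_pCons subring_A)
  then have IH: "g (poly f x) = poly f (g x)" "poly f x \<in> B" using pCons by auto
  have aB: "a \<in> B" using a A_B by blast
  have "x * poly f x \<in> B" by (intro subring_mult subring_B IH pCons.prems)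
  then show ?case using a aB IH pCons.prems
    by (simp add: g_add g_mult g_A subring_add[OF subring_B])
qed

lemma g_z_power: "g (1 - z ^ m) = 1 - z ^ (m * (1 + p ^ r))"
proof -
  have "1 - monom 1 m \<in> polys_over A"
    by (intro subring_diff subring_1 subring_polys_over polys_over_monom subring_A)
  from g_poly[OF this z_in] have "g (1 - z ^ m) = 1 - g z ^ m" by (simp add: poly_monom)
  moreover have "g z = z ^ (1 + p ^ r)" by (simp only: g_\<zeta> fls_const_power)
  ultimately show ?thesis by (simp only: power_mult[symmetric] mult.commute)
qed

text \<open>The difference gives a polynomial over \<open>A\<close> of degree below N with root
  \<open>P\<close>. As g fixes \<open>A\<close>, the N distinct conjugates of \<open>P\<close> under
  powers of g are roots as well, so the polynomial vanishes.\<close>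

lemma expansion_unique:
  assumes a: "\<And>i. i < N \<Longrightarrow> a i \<in> A" and a': "\<And>i. i < N \<Longrightarrow> a' i \<in> A"
    and eq: "(\<Sum>i<N. a i * P ^ i) = (\<Sum>i<N. a' i * P ^ i)" and i: "i < N"
  shows "a i = a' i"
proof -
  define f where "f = (\<Sum>i<N. monom (a i - a' i) i)"
  have f: "f \<in> polys_over A"
    unfolding f_def
    by (intro subring_sum subring_polys_over subring_A polys_over_monom subring_diff a a') auto
  have root: "poly f (1 - z ^ ((1 + p ^ r) ^ j)) = 0" for j
  proof (induction j)
    case 0
    have "poly f P = (\<Sum>i<N. a i * P ^ i) - (\<Sum>i<N. a' i * P ^ i)"
      by (simp add: f_def poly_sum poly_monom left_diff_distrib sum_subtractf)
    then show ?case using eq by (simp add: P_eq)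
  next
    case (Suc j)
    have x: "1 - z ^ ((1 + p ^ r) ^ j) \<in> B" by (intro subring_intros subring_B z_in)
    have "poly f (1 - z ^ ((1 + p ^ r) ^ Suc j)) = g (poly f (1 - z ^ ((1 + p ^ r) ^ j)))"
      using g_poly[OF f x] by (simp only: g_z_power power_Suc2)
    also have "\<dots> = 0" using g_A[of 0] subring_0[OF subring_A] by (simp only: Suc)
    finally show ?case .
  qed
  have "f = 0"
  proof (rule ccontr)
    assume f0: "f \<noteq> 0"
    let ?roots = "(\<lambda>j. 1 - z ^ ((1 + p ^ r) ^ j)) ` {..<N}"
    have "inj_on (\<lambda>j. 1 - z ^ ((1 + p ^ r) ^ j)) {..<N}"
    proof (rule inj_onI)
      fix i j assume ij: "i \<in> {..<N}" "j \<in> {..<N}" "1 - z ^ ((1 + p ^ r) ^ i) = 1 - z ^ ((1 + p ^ r) ^ j)"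
      then have "z ^ ((1 + p ^ r) ^ i) = z ^ ((1 + p ^ r) ^ j)" by simp
      moreover have "p ^ (r + s) > 0" using p_pos by simp
      ultimately have "[i = j] (mod N)"
        by (simp only: primitive_root_power_eq_iff[OF prim_z] one_plus_power_cong_iff[OF p r])
      then show "i = j" using ij by (simp add: cong_def)
    qed
    then have "card ?roots = N" by (simp add: card_image)
    moreover have "card ?roots \<le> card {x. poly f x = 0}"
      using root by (intro card_mono poly_roots_finite f0) auto
    moreover have "card {x. poly f x = 0} \<le> degree f" by (rule card_poly_roots_bound[OF f0])
    moreover have "degree f < N"
    proof -
      have "degree f \<le> N - 1" unfolding f_def
        by (rule degree_sum_le) (auto intro: order_trans[OF degree_monom_le])
      moreover have "N > 0" using p_pos by simp
      ultimately show ?thesis by linarith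
    qed
    ultimately show False by simp
  qed
  moreover have "coeff f i = a i - a' i"
    using i by (simp add: f_def coeff_sum)
  ultimately show ?thesis by simp
qed

lemma expansion:
  assumes b: "b \<in> B"
  shows "\<And>i. i < N \<Longrightarrow> expansion A P N b i \<in> A" and "b = (\<Sum>i<N. expansion A P N b i * P ^ i)"
proof -
  obtain a where a: "\<And>i. i < N \<Longrightarrow> a i \<in> A" "b = (\<Sum>i<N. a i * P ^ i)" using B_expansion[OF b] by blast
  define E where "E a \<longleftrightarrow> (\<forall>i<N. a i \<in> A) \<and> (\<forall>i\<ge>N. a i = 0) \<and> b = (\<Sum>i<N. a i * P ^ i)" for a
  have "E (\<lambda>i. if i < N then a i else 0)" using a by (simp add: E_def)
  moreover have "a1 = a2" if E: "E a1" "E a2" for a1 a2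
  proof
    fix i
    show "a1 i = a2 i" using expansion_unique[of a1 a2 i] E by (cases "i < N") (auto simp: E_def)
  qed
  ultimately have "\<exists>!a. E a" by blast
  then have "E (expansion A P N b)"
    unfolding expansion_def E_def[symmetric] by (rule theI')
  then show "\<And>i. i < N \<Longrightarrow> expansion A P N b i \<in> A" "b = (\<Sum>i<N. expansion A P N b i * P ^ i)"
    by (auto simp: E_def)
qed

lemma lam_in: "b \<in> B \<Longrightarrow> k \<le> s \<Longrightarrow> lam A P N p k n b \<in> A"
  unfolding lam_eq[OF p_pos] by (intro subring_sum subring_A expansion) auto

lemma Q_in: "Q \<in> A" unfolding Q_eq by (intro subring_diff subring_1 subring_A z_power_in)

lemma p_cong: "cong_in Or (1 - \<zeta> r) (of_nat p) 0" "cong_in A Q (of_nat p) 0"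
proof -
  obtain \<epsilon> where \<epsilon>: "\<epsilon> \<in> Or" "of_nat p = (1 - \<zeta> r) ^ ((p - 1) * p ^ (r - 1)) * \<epsilon>"
    using prime_factorization_cyclotomic[OF p(1) r subring_Or \<zeta>_in(1) prim] by blast
  have "(p - 1) * p ^ (r - 1) > 0" using p prime_gt_1_nat[of p] by simp
  then have "of_nat p = 0 + (1 - \<zeta> r) * ((1 - \<zeta> r) ^ ((p - 1) * p ^ (r - 1) - 1) * \<epsilon>)"
    unfolding \<epsilon>(2) by (cases "(p - 1) * p ^ (r - 1)") auto
  moreover have mem: "(1 - \<zeta> r) ^ ((p - 1) * p ^ (r - 1) - 1) * \<epsilon> \<in> Or"
    by (intro subring_intros subring_Or \<zeta>_in \<epsilon>)
  ultimately show c: "cong_in Or (1 - \<zeta> r) (of_nat p) 0" unfolding cong_in_def by blast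
  then obtain y where y: "y \<in> Or" "of_nat p = (1 - \<zeta> r) * y" by (auto simp: cong_in_def)
  then have "of_nat p = Q * fls_const y" by (simp add: Q fls_of_nat)
  then show "cong_in A Q (of_nat p) 0"
    using power_series_const[OF subring_Or y(1)] by (auto simp: cong_in_def A)
qed

lemma cong_p_imp: "cong_in A (of_nat p) x y \<Longrightarrow> cong_in A Q x y"
proof -
  assume c: "cong_in A (of_nat p) x y"
  obtain z where "z \<in> A" "of_nat p = Q * z" using p_cong(2) by (auto simp: cong_in_def)
  then show ?thesis using cong_in_mono[OF subring_A _ _ c] by blast
qed

lemma independent:
  assumes "\<And>v. v < p ^ j \<Longrightarrow> x v \<in> A" "cong_in A Q (\<Sum>v<p ^ j. (1 + fls_X) ^ v * x v ^ (p ^ j)) 0" "v < p ^ j"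
  shows "cong_in A Q (x v) 0"
  using powers_independent[OF p(1) subring_Or _ p_cong(1), of j x v] assms
    reduced_mod[folded Or, OF p_cong(1)] subring_diff[OF subring_Or subring_1[OF subring_Or] \<zeta>_in(1)]
  unfolding A Q by blast

text \<open>Reduces to the preceding case, since modulo p, and hence modulo \<open>Q\<close>, the
  \<open>p ^ j\<close>-th power of x is the sum of those of x - y and y.\<close>

lemma independent_diff:
  assumes x: "\<And>v. v < p ^ j \<Longrightarrow> x v \<in> A" and y: "\<And>v. v < p ^ j \<Longrightarrow> y v \<in> A"
    and c: "cong_in A Q (\<Sum>v<p ^ j. (1 + fls_X) ^ v * x v ^ (p ^ j)) (\<Sum>v<p ^ j. (1 + fls_X) ^ v * y v ^ (p ^ j))"
    and v: "v < p ^ j"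
  shows "cong_in A Q (x v) (y v)"
proof -
  note S = subring_A
  let ?t = "\<lambda>v. (1 + fls_X :: 'a fls) ^ v"
  have "cong_in A Q (\<Sum>v<p ^ j. ?t v * x v ^ (p ^ j)) (\<Sum>v<p ^ j. ?t v * ((x v - y v) ^ (p ^ j) + y v ^ (p ^ j)))"
  proof (rule cong_in_sum[OF S], rule cong_in_scale[OF S])
    fix v assume "v \<in> {..<p ^ j}"
    then have "cong_in A Q ((x v - y v + y v) ^ (p ^ j)) ((x v - y v) ^ (p ^ j) + y v ^ (p ^ j))"
      by (intro cong_p_imp freshman p S subring_diff x y) auto
    then show "cong_in A Q (x v ^ (p ^ j)) ((x v - y v) ^ (p ^ j) + y v ^ (p ^ j))" by simp
  qed (intro subring_power S t0_in)
  then have "cong_in A Q (\<Sum>v<p ^ j. ?t v * ((x v - y v) ^ (p ^ j) + y v ^ (p ^ j))) (\<Sum>v<p ^ j. ?t v * y v ^ (p ^ j))"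
    using c cong_in_trans[OF S] cong_in_sym[OF S] by blast
  then have "cong_in A Q ((\<Sum>v<p ^ j. ?t v * ((x v - y v) ^ (p ^ j) + y v ^ (p ^ j))) - (\<Sum>v<p ^ j. ?t v * y v ^ (p ^ j)))
     ((\<Sum>v<p ^ j. ?t v * y v ^ (p ^ j)) - (\<Sum>v<p ^ j. ?t v * y v ^ (p ^ j)))"
    by (intro cong_in_diff S cong_in_refl)
  then have "cong_in A Q (\<Sum>v<p ^ j. ?t v * (x v - y v) ^ (p ^ j)) 0"
    by (simp add: distrib_left sum.distrib)
  then have "cong_in A Q (x v - y v) 0"
    using independent[of j "\<lambda>v. x v - y v" v] subring_diff[OF S x y] v by blast
  then show ?thesis by (simp add: cong_in_iff)
qed

text \<open>In \<open>leading_sum\<close> each inner sum of \<open>p ^ (s - k)\<close>-th powers is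
  replaced by the power of the sum, which brings in \<lambda>. In the transitional case the two
  levels involve different exponents, and level w is regrouped so that both are written with q-th
  powers for q = p^(s-w-1).\<close>

lemma norm_1_imp:
  assumes n: "n \<ge> 1" and b: "\<And>j. j < N \<Longrightarrow> b j \<in> B"
    and d: "d = 1 + \<iota> (P ^ n) * (\<Sum>j<N. \<iota> (b j) * u ^ j)" and nrd: "nr d = 1"
  shows "ordinary p r n \<Longrightarrow> weight p r n \<le> s \<Longrightarrow> v < p ^ (s - weight p r n) \<Longrightarrow>
      cong_in A Q (lam A P N p (weight p r n) n (b (p ^ weight p r n * v))) 0"
    and "transitional p r n \<Longrightarrow> weight p r n + 1 \<le> s \<Longrightarrow> v < p ^ (s - (weight p r n + 1)) \<Longrightarrow>
      cong_in A Q (lam A P N p (weight p r n + 1) n (b (p ^ (weight p r n + 1) * v)))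
        (\<Sum>z<p. lam A P N p (weight p r n) n (b (p ^ weight p r n * v + p ^ (s - 1) * z)) ^ p * (1 + fls_X) ^ z)"
proof -
  note S = subring_A
  let ?w = "weight p r n" and ?t = "\<lambda>v. (1 + fls_X :: 'a fls) ^ v"
  define a where "a j = expansion A P N (b j)" for j
  have a: "a j l \<in> A" if "j < N" "l < N" for j l unfolding a_def by (rule expansion(1)[OF b[OF that(1)] that(2)])
  have b_eq: "b j = (\<Sum>l<N. a j l * (1 - z) ^ l)" if "j < N" for j
    unfolding a_def P_eq[symmetric] by (rule expansion(2)[OF b[OF that]])
  obtain \<phi> where \<phi>: "is_splitting (fraction_field A) (fraction_field B) \<iota> N \<phi>" "\<And>x. nr x = det (\<phi> x)"
    using nr by (auto simp: is_reduced_norm_def)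
  interpret C: cyclic_splitting p r s z "1 + fls_X" A "fraction_field A" "fraction_field B" "fraction_field B" g \<iota> u \<phi>
  proof
    show "1 + fls_X \<noteq> (0 :: 'a fls)" unfolding one_plus_X_conv
      by (simp only: fps_to_fls_eq_0_iff) (auto simp: fps_eq_iff intro!: exI[of _ 0])
    show "is_subring (fraction_field B)" by (rule subring_fraction_field[OF subring_B])
    show "fraction_field A \<subseteq> fraction_field B" by (rule fraction_field_mono[OF A_B])
    show "z \<in> fraction_field B" using z_in B_K by blast
    show "g z = z ^ (1 + p ^ r)" using g_\<zeta> by (simp only: fls_const_power)
  qed (use p r S A_k prim_z z_power_in t0_in alg \<phi>(1) in simp_all)
  obtain \<theta> where \<theta>: "cyclotomic_tower p r s \<theta> A" "\<theta> ^ N = z ^ N"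
      "det (\<phi> d) = det (cyclotomic_tower.norm_matrix p r s \<theta> n a (1 + fls_X))"
    using C.det_\<phi>[of a b d n] a b_eq d unfolding P_eq by blast
  interpret T: cyclotomic_tower p r s \<theta> A by (rule \<theta>(1))
  have \<pi>: "T.\<pi> = Q" by (simp add: T.\<pi>_def \<theta>(2) Q_eq)
  have det1: "det (T.norm_matrix n a (1 + fls_X)) = 1" using \<theta>(3) \<phi>(2)[of d] nrd by simp
  let ?lam = "\<lambda>k v. lam A P N p k n (b (p ^ k * v))"
  have idx: "p ^ k * v < N" if "k \<le> s" "v < p ^ (s - k)" for k v
    unfolding T.ppow_split[OF that(1)] using that(2) p_pos by simp
  have lead: "cong_in A Q (T.leading_sum n a (1 + fls_X) k) (\<Sum>v<p ^ (s - k). ?t v * ?lam k v ^ (p ^ (s - k)))"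
    if k: "k \<le> s" for k
    unfolding T.leading_sum_def
  proof (rule cong_in_sum[OF S], rule cong_in_scale[OF S])
    fix v assume v: "v \<in> {..<p ^ (s - k)}"
    show "cong_in A Q (\<Sum>l | l < N \<and> n mod p ^ k + l < p ^ k. a (p ^ k * v) l ^ p ^ (s - k)) (?lam k v ^ (p ^ (s - k)))"
      unfolding lam_eq[OF p_pos k] a_def[symmetric]
      by (rule cong_in_sym[OF S], rule cong_p_imp, rule freshman_sum[OF p(1) S])
        (use a[OF idx[OF k]] v in auto)
  qed (intro subring_power S t0_in)
  have lamA: "?lam k v \<in> A" if "k \<le> s" "v < p ^ (s - k)" for k v
    by (intro lam_in b idx that)
  show "cong_in A Q (?lam ?w v) 0" if "ordinary p r n" "?w \<le> s" "v < p ^ (s - ?w)"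
  proof (rule independent[of "s - ?w" "?lam ?w"])
    show "cong_in A Q (\<Sum>v<p ^ (s - ?w). ?t v * ?lam ?w v ^ (p ^ (s - ?w))) 0"
      using lead[OF that(2)] T.det_eq_1_imp(1)[OF n t0_in a det1 that(1,2)]
      unfolding \<pi> using cong_in_trans[OF S] cong_in_sym[OF S] by blast
  qed (use that lamA in auto)
  show "cong_in A Q (?lam (?w + 1) v) (\<Sum>z<p. lam A P N p ?w n (b (p ^ ?w * v + p ^ (s - 1) * z)) ^ p * ?t z)"
    if t: "transitional p r n" "?w + 1 \<le> s" "v < p ^ (s - (?w + 1))"
  proof -
    define q where "q = p ^ (s - (?w + 1))"
    have q0: "q > 0" using p_pos by (simp add: q_def)
    have qp: "p ^ (s - ?w) = q * p"
    proof -
      have "s - ?w = Suc (s - (?w + 1))" using t(2) by simp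
      then show ?thesis by (simp add: q_def)
    qed
    have wq: "p ^ ?w * q = p ^ (s - 1)" using t(2) by (simp add: q_def flip: power_add)
    let ?y = "\<lambda>v z. lam A P N p ?w n (b (p ^ ?w * v + p ^ (s - 1) * z))"
    have yz: "?y v z = ?lam ?w (v + q * z)" for v z
      unfolding wq[symmetric] by (simp only: distrib_left mult.assoc)
    have vq: "v + q * z < q * p" if "v < q" "z < p" for v z
    proof -
      have "v + q * z < q * Suc z" using that by simp
      also have "\<dots> \<le> q * p" using that by (intro mult_left_mono) auto
      finally show ?thesis .
    qed
    have yA: "?y v z \<in> A" if "v < q" "z < p" for v z
      unfolding yz using vq[OF that] t(2) by (intro lamA) (auto simp: qp)
    \<comment> \<open>Division with remainder x = v + q z splits (1 + T)^x into (1 + T)^v and a q-th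
      power, and \<open>p ^ w * q = p ^ (s - 1)\<close> turns the index into the one of the
      theorem.\<close>
    have "(\<Sum>x<q * p. ?t x * ?lam ?w x ^ (q * p)) = (\<Sum>v<q. \<Sum>z<p. ?t (v + q * z) * ?lam ?w (v + q * z) ^ (q * p))"
    proof -
      have bij: "bij_betw (\<lambda>(v, z). v + q * z) ({..<q} \<times> {..<p}) {..<q * p}"
        by (rule bij_betw_byWitness[where f' = "\<lambda>x. (x mod q, x div q)"])
          (use q0 vq in \<open>auto simp: div_less_iff_less_mult mult.commute\<close>)
      show ?thesis unfolding sum.cartesian_product
        by (subst sum.reindex_bij_betw[OF bij, symmetric]) (simp add: case_prod_unfold)
    qed
    also have "\<dots> = (\<Sum>v<q. ?t v * (\<Sum>z<p. (?y v z ^ p * ?t z) ^ q))"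
      unfolding yz by (simp add: sum_distrib_left power_add power_mult power_mult_distrib mult_ac power_commutes)
    finally have decomp: "(\<Sum>x<q * p. ?t x * ?lam ?w x ^ (q * p)) = (\<Sum>v<q. ?t v * (\<Sum>z<p. (?y v z ^ p * ?t z) ^ q))" .
    have 1: "cong_in A Q (\<Sum>v<q. ?t v * ?lam (?w + 1) v ^ q) (\<Sum>x<q * p. ?t x * ?lam ?w x ^ (q * p))"
    proof -
      have ws: "?w \<le> s" using t(2) by simp
      have "cong_in A Q (T.leading_sum n a (1 + fls_X) (?w + 1)) (T.leading_sum n a (1 + fls_X) ?w)"
        using T.det_eq_1_imp(2)[OF n t0_in a det1 t(1,2)] unfolding \<pi> by blast
      then show ?thesis using lead[OF t(2)] lead[OF ws] unfolding qp q_def[symmetric]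
        using cong_in_trans[OF S] cong_in_sym[OF S] by blast
    qed
    have yt: "?y v z ^ p * ?t z \<in> A" if "v < q" "z < p" for v z
      by (intro subring_mult subring_power S yA that t0_in)
    \<comment> \<open>Pulling the q-th power out of the sum over z gives both sides the shape to
      which independence applies.\<close>
    have 2: "cong_in A Q (\<Sum>v<q. ?t v * (\<Sum>z<p. (?y v z ^ p * ?t z) ^ q)) (\<Sum>v<q. ?t v * (\<Sum>z<p. ?y v z ^ p * ?t z) ^ q)"
    proof (rule cong_in_sum[OF S], rule cong_in_scale[OF S])
      fix v assume "v \<in> {..<q}"
      then show "cong_in A Q (\<Sum>z<p. (?y v z ^ p * ?t z) ^ q) ((\<Sum>z<p. ?y v z ^ p * ?t z) ^ q)"
        unfolding q_def
        by (intro cong_in_sym[OF S cong_p_imp] freshman_sum p S) (use yt in \<open>auto simp: q_def\<close>)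
    qed (intro subring_power S t0_in)
    show ?thesis
    proof (rule independent_diff[of "s - (?w + 1)" "?lam (?w + 1)" "\<lambda>v. \<Sum>z<p. ?y v z ^ p * ?t z"])
      show "?lam (?w + 1) v \<in> A" if "v < p ^ (s - (?w + 1))" for v by (rule lamA[OF t(2) that])
      show "(\<Sum>z<p. ?y v z ^ p * ?t z) \<in> A" if "v < p ^ (s - (?w + 1))" for v
        using yt[of v] that by (intro subring_sum S) (auto simp: q_def)
      show "cong_in A Q (\<Sum>v<p ^ (s - (?w + 1)). ?t v * ?lam (?w + 1) v ^ (p ^ (s - (?w + 1))))
          (\<Sum>v<p ^ (s - (?w + 1)). ?t v * (\<Sum>z<p. ?y v z ^ p * ?t z) ^ (p ^ (s - (?w + 1))))"
        unfolding q_def[symmetric] by (rule cong_in_trans[OF S 1[unfolded decomp] 2])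
      show "v < p ^ (s - (?w + 1))" by (rule t(3))
    qed
  qed
qed

text \<open>The case of exponent p of independence: modulo \<open>Q\<close>, the right-hand side of
  (ii) retains every single \<lambda> that enters it.\<close>

lemma frobenius_sum_cong_iff:
  assumes x: "\<And>z. z < p \<Longrightarrow> x z \<in> A" and y: "\<And>z. z < p \<Longrightarrow> y z \<in> A"
  shows "cong_in A Q (\<Sum>z<p. x z ^ p * (1 + fls_X) ^ z) (\<Sum>z<p. y z ^ p * (1 + fls_X) ^ z) \<longleftrightarrow>
    (\<forall>z<p. cong_in A Q (x z) (y z))"
proof
  assume c: "cong_in A Q (\<Sum>z<p. x z ^ p * (1 + fls_X) ^ z) (\<Sum>z<p. y z ^ p * (1 + fls_X) ^ z)"
  show "\<forall>z<p. cong_in A Q (x z) (y z)"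
    using independent_diff[of 1 x y] x y c by (simp add: mult.commute)
next
  assume "\<forall>z<p. cong_in A Q (x z) (y z)"
  then show "cong_in A Q (\<Sum>z<p. x z ^ p * (1 + fls_X) ^ z) (\<Sum>z<p. y z ^ p * (1 + fls_X) ^ z)"
    by (intro cong_in_sum cong_in_mult cong_in_power cong_in_refl subring_power subring_A Q_in x y t0_in) auto
qed

end

theorem mainTheorem5:
  fixes p r s n w :: nat
    and Qp F Or Ors :: "'a::field_char_0 set" and av :: "'a \<Rightarrow> real" and \<zeta> :: "nat \<Rightarrow> 'a"
    and P Q :: "'a fls" and A B :: "'a fls set" and g :: "'a fls \<Rightarrow> 'a fls"
    and \<iota> :: "'a fls \<Rightarrow> 'd::ring_1" and u :: 'd and \<Delta> :: "'d set" and nr :: "'d \<Rightarrow> 'a fls"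
    and d :: 'd and b :: "nat \<Rightarrow> 'a fls"
  assumes "prime p" and "odd p" and "r \<ge> 1" and "s \<ge> 1"
    and "is_padic_field p Qp av" and "finite_unramified_extension p Qp av F"
    and "\<And>m. primitive_root_of_unity (p ^ m) (\<zeta> m)"
    and "\<zeta> 0 = 1" and "\<And>m. m \<ge> 1 \<Longrightarrow> \<zeta> m ^ p = \<zeta> (m - 1)"
    and "Or = adjoin (ring_of_integers Qp av F) (\<zeta> r)"
    and "Ors = adjoin (ring_of_integers Qp av F) (\<zeta> (r + s))"
    and "A = power_series Or" and "B = power_series Ors"
    and "P = fls_const (1 - \<zeta> (r + s))" and "Q = fls_const (1 - \<zeta> r)"
    and "g \<in> Gal (fraction_field B) (fraction_field A)"
    and "g (fls_const (\<zeta> (r + s))) = fls_const (\<zeta> (r + s) ^ (1 + p ^ r))"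
    and "is_cyclic_algebra (fraction_field B) g (p ^ s) (1 + fls_X) \<iota> u"
    and "\<Delta> = cyclic_order B (p ^ s) \<iota> u"
    and "is_reduced_norm (fraction_field A) (fraction_field B) \<iota> (p ^ s) nr"
    and "\<And>j. j < p ^ s \<Longrightarrow> b j \<in> B"
    and "d = 1 + \<iota> (P ^ n) * (\<Sum>j<p ^ s. \<iota> (b j) * u ^ j)"
    and "is_level \<iota> \<Delta> P d n" and "nr d = 1"
    and "w = weight p r n"
  shows
    "(ordinary p r n \<and> w \<le> s \<longrightarrow>
        (\<forall>v<p ^ (s - w). lam A P (p ^ s) p w n (b (p ^ w * v)) \<in> (\<lambda>a. Q * a) ` A)) \<and>
     (transitional p r n \<and> w + 1 \<le> s \<longrightarrow>
        (\<forall>v<p ^ (s - (w + 1)).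
           lam A P (p ^ s) p (w + 1) n (b (p ^ (w + 1) * v))
             - (\<Sum>z = 0..p - 1. lam A P (p ^ s) p w n (b (p ^ w * v + p ^ (s - 1) * z)) ^ p
                              * (1 + fls_X) ^ z)
           \<in> (\<lambda>a. Q * a) ` A) \<and>
        (\<forall>d' b'.
           (\<forall>j<p ^ s. b' j \<in> B) \<and>
           d' = 1 + \<iota> (P ^ n) * (\<Sum>j<p ^ s. \<iota> (b' j) * u ^ j) \<and>
           is_level \<iota> \<Delta> P d' n \<and> nr d' = 1 \<longrightarrow>
           (\<forall>v<p ^ (s - (w + 1)).
              lam A P (p ^ s) p (w + 1) n (b (p ^ (w + 1) * v))
                - lam A P (p ^ s) p (w + 1) n (b' (p ^ (w + 1) * v)) \<in> (\<lambda>a. Q * a) ` A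
              \<longleftrightarrow>
              (\<forall>z<p. lam A P (p ^ s) p w n (b (p ^ w * v + p ^ (s - 1) * z))
                     - lam A P (p ^ s) p w n (b' (p ^ w * v + p ^ (s - 1) * z))
                     \<in> (\<lambda>a. Q * a) ` A))))"
proof -
  interpret cyclic_setting p r s Qp F Or Ors av \<zeta> P Q A B g \<iota> u nr
    by unfold_locales (fact assms)+
  have n: "n \<ge> 1" using assms(23) by (simp add: is_level_def)
  have idx: "p ^ w * v + p ^ (s - 1) * z < p ^ s" if "w + 1 \<le> s" "v < p ^ (s - (w + 1))" "z < p" for v z
  proof -
    have "p ^ w * v < p ^ w * p ^ (s - (w + 1))" using that p_pos by simp
    also have "\<dots> = p ^ (s - 1)" using that(1) by (simp flip: power_add)
    finally have "p ^ w * v + p ^ (s - 1) * z < p ^ (s - 1) * Suc z" by simp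
    also have "\<dots> \<le> p ^ (s - 1) * p" using that by (intro mult_left_mono) auto
    also have "\<dots> = p ^ s" using that(1) by (simp flip: power_Suc2)
    finally show ?thesis .
  qed
  have range: "{0..p - 1} = {..<p}" using p_pos by auto
  show ?thesis
  proof (intro conjI impI allI)
    fix v assume "ordinary p r n \<and> w \<le> s" "v < p ^ (s - w)"
    then show "lam A P (p ^ s) p w n (b (p ^ w * v)) \<in> (\<lambda>a. Q * a) ` A"
      using norm_1_imp(1)[OF n assms(21,22,24), of v] unfolding assms(25) cong_in_iff by simp
  next
    fix v assume "transitional p r n \<and> w + 1 \<le> s" "v < p ^ (s - (w + 1))"
    then show "lam A P (p ^ s) p (w + 1) n (b (p ^ (w + 1) * v))
             - (\<Sum>z = 0..p - 1. lam A P (p ^ s) p w n (b (p ^ w * v + p ^ (s - 1) * z)) ^ p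
                              * (1 + fls_X) ^ z) \<in> (\<lambda>a. Q * a) ` A"
      using norm_1_imp(2)[OF n assms(21,22,24), of v] unfolding assms(25) cong_in_iff range by blast
  next
    fix d' b' v
    assume t: "transitional p r n \<and> w + 1 \<le> s"
      and d': "(\<forall>j<p ^ s. b' j \<in> B) \<and> d' = 1 + \<iota> (P ^ n) * (\<Sum>j<p ^ s. \<iota> (b' j) * u ^ j) \<and>
           is_level \<iota> \<Delta> P d' n \<and> nr d' = 1"
      and v: "v < p ^ (s - (w + 1))"
    let ?x = "\<lambda>b z. lam A P (p ^ s) p w n (b (p ^ w * v + p ^ (s - 1) * z))"
    let ?l = "\<lambda>b. lam A P (p ^ s) p (w + 1) n (b (p ^ (w + 1) * v))"
    let ?S = "\<lambda>b. \<Sum>z<p. ?x b z ^ p * (1 + fls_X) ^ z"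
    have ws: "w \<le> s" using t by simp
    have x: "?x b z \<in> A" if "z < p" for z by (intro lam_in assms(21) idx v that ws) (use t in simp)
    have x': "?x b' z \<in> A" if "z < p" for z
      using d' by (intro lam_in ws) (use idx[of v z] t v that in blast)
    have c: "cong_in A Q (?l b) (?S b)"
      using norm_1_imp(2)[OF n assms(21,22,24), of v] t v unfolding assms(25) by blast
    have c': "cong_in A Q (?l b') (?S b')"
      using norm_1_imp(2)[OF n, of b' d' v] d' t v unfolding assms(25) by blast
    \<comment> \<open>By (ii) for both elements, comparing their values of \<lambda>^+ amounts to
      comparing the sums over z; in this sense the two sets of data determine each other.\<close>
    have "cong_in A Q (?l b) (?l b') \<longleftrightarrow> cong_in A Q (?S b) (?S b')"
      using c c' cong_in_trans[OF subring_A] cong_in_sym[OF subring_A] by blast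
    also have "\<dots> \<longleftrightarrow> (\<forall>z<p. cong_in A Q (?x b z) (?x b' z))"
      by (rule frobenius_sum_cong_iff[OF x x'])
    finally show "?l b - ?l b' \<in> (\<lambda>a. Q * a) ` A \<longleftrightarrow> (\<forall>z<p. ?x b z - ?x b' z \<in> (\<lambda>a. Q * a) ` A)"
      unfolding cong_in_iff .
  qed
qed

end
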